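(* Let $(R,\mathfrak m)$ be a local hypersurface domain and set $c:=\dim(R)+1$. Suppose that every finitely generated $R$-module $M$ such that $M$ and $M\otimes_R\operatorname{Ext}^{c-1}_R(M,R)$ are Cohen--Macaulay $R$-modules, both of grade $c-1$, has finite projective dimension. Then $R$ is regular. In particular, any singular (i.e. non-regular) local hypersurface domain fails to satisfy this condition.
   Context: A local hypersurface is a ring $R=S/(f)$ where $(S,\mathfrak n)$ is a regular local ring and $0\ne f\in\mathfrak n$. The grade of a finitely generated module $M$ is the length of a maximal $R$-regular sequence contained in $\operatorname{Ann}(M)$. *)

theory Defs
  imports "HOL-Library.Extended_Nat" "HOL-Algebra.QuotRing" "HOL-Algebra.Module" "HOL-Algebra.Ring_Divisibility"
begin

section \<open>Local rings and hypersurfaces\<close>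

definition local_ring :: "('a, 'r) ring_scheme \<Rightarrow> bool" where
  "local_ring R \<longleftrightarrow> cring R \<and> (\<exists>!m. maximalideal m R)"

definition max_ideal :: "('a, 'r) ring_scheme \<Rightarrow> 'a set" where
  "max_ideal R = (THE m. maximalideal m R)"

text \<open>The supremum of the lengths of chains of primes; it is 0 for the zero ring.\<close>

definition krull_dim :: "('a, 'r) ring_scheme \<Rightarrow> enat" where
  "krull_dim R = Sup {enat n | n. \<exists>p :: nat \<Rightarrow> 'a set.
     (\<forall>i\<le>n. primeideal (p i) R) \<and> (\<forall>i<n. p i \<subset> p (Suc i))}"

definition regular_local_ring :: "('a, 'r) ring_scheme \<Rightarrow> bool" where
  "regular_local_ring R \<longleftrightarrow> noetherian_ring R \<and> local_ring R \<and>
     (\<exists>A \<subseteq> carrier R. finite A \<and> enat (card A) = krull_dim R \<and> max_ideal R = Idl\<^bsub>R\<^esub> A)"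

definition local_hypersurface ::
  "('a, 'r) ring_scheme \<Rightarrow> ('s, 't) ring_scheme \<Rightarrow> 's \<Rightarrow> bool" where
  "local_hypersurface R S f \<longleftrightarrow> ring R \<and> regular_local_ring S \<and>
     f \<in> max_ideal S \<and> f \<noteq> \<zero>\<^bsub>S\<^esub> \<and> R \<simeq> (S Quot (PIdl\<^bsub>S\<^esub> f))"


section \<open>Constructions with modules\<close>

text \<open>The record of modules extends that of rings, but the module axioms say nothing about
  the fields \<open>mult\<close> and \<open>one\<close>; below they are left \<open>undefined\<close>.\<close>

definition self_module :: "('a, 'r) ring_scheme \<Rightarrow> ('a, 'a) module" where
  "self_module R = \<lparr>carrier = carrier R, mult = mult R, one = one R,
     zero = zero R, add = add R, smult = mult R\<rparr>"

definition gen_submodule ::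
  "('a, 'r) ring_scheme \<Rightarrow> ('a, 'b, 'm) module_scheme \<Rightarrow> 'b set \<Rightarrow> 'b set" where
  "gen_submodule R M A = \<Inter>{N. submodule N R M \<and> A \<subseteq> N}"

definition finitely_generated ::
  "('a, 'r) ring_scheme \<Rightarrow> ('a, 'b, 'm) module_scheme \<Rightarrow> bool" where
  "finitely_generated R M \<longleftrightarrow> module R M \<and>
     (\<exists>A \<subseteq> carrier M. finite A \<and> gen_submodule R M A = carrier M)"

definition annihilator ::
  "('a, 'r) ring_scheme \<Rightarrow> ('a, 'b, 'm) module_scheme \<Rightarrow> 'a set" where
  "annihilator R M = {a \<in> carrier R. \<forall>x \<in> carrier M. a \<odot>\<^bsub>M\<^esub> x = \<zero>\<^bsub>M\<^esub>}"

definition module_hom ::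
  "('a, 'r) ring_scheme \<Rightarrow> ('a, 'b, 'm) module_scheme \<Rightarrow> ('a, 'c, 'n) module_scheme
    \<Rightarrow> ('b \<Rightarrow> 'c) set" where
  "module_hom R M N = {h \<in> carrier M \<rightarrow> carrier N.
     (\<forall>x \<in> carrier M. \<forall>y \<in> carrier M. h (x \<oplus>\<^bsub>M\<^esub> y) = h x \<oplus>\<^bsub>N\<^esub> h y) \<and>
     (\<forall>a \<in> carrier R. \<forall>x \<in> carrier M. h (a \<odot>\<^bsub>M\<^esub> x) = a \<odot>\<^bsub>N\<^esub> h x)}"

text \<open>Elements of \<open>Hom\<close> are extensional functions, so that equality of functions is equality
  of homomorphisms.\<close>

definition hom_module ::
  "('a, 'r) ring_scheme \<Rightarrow> ('a, 'b, 'm) module_scheme \<Rightarrow> ('a, 'c, 'n) module_scheme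
    \<Rightarrow> ('a, 'b \<Rightarrow> 'c) module" where
  "hom_module R M N = \<lparr>carrier = module_hom R M N \<inter> extensional (carrier M),
     mult = undefined, one = undefined,
     zero = (\<lambda>x\<in>carrier M. \<zero>\<^bsub>N\<^esub>),
     add = (\<lambda>g h. \<lambda>x\<in>carrier M. g x \<oplus>\<^bsub>N\<^esub> h x),
     smult = (\<lambda>a h. \<lambda>x\<in>carrier M. a \<odot>\<^bsub>N\<^esub> h x)\<rparr>"

definition quot_module ::
  "('a, 'b, 'm) module_scheme \<Rightarrow> 'b set \<Rightarrow> ('a, 'b set) module" where
  "quot_module M N = \<lparr>carrier = a_rcosets\<^bsub>M\<^esub> N, mult = undefined, one = undefined,
     zero = N, add = set_add M,
     smult = (\<lambda>a X. \<Union>x\<in>X. N +>\<^bsub>M\<^esub> (a \<odot>\<^bsub>M\<^esub> x))\<rparr>"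

definition free_module ::
  "('a, 'r) ring_scheme \<Rightarrow> 'x set \<Rightarrow> ('a, 'x \<Rightarrow> 'a) module" where
  "free_module R X = \<lparr>carrier = {v. (\<forall>x\<in>X. v x \<in> carrier R) \<and> (\<forall>x. x \<notin> X \<longrightarrow> v x = \<zero>\<^bsub>R\<^esub>) \<and>
       finite {x. v x \<noteq> \<zero>\<^bsub>R\<^esub>}},
     mult = undefined, one = undefined,
     zero = (\<lambda>_. \<zero>\<^bsub>R\<^esub>), add = (\<lambda>v w x. v x \<oplus>\<^bsub>R\<^esub> w x), smult = (\<lambda>a v x. a \<otimes>\<^bsub>R\<^esub> v x)\<rparr>"

definition basis_vec :: "('a, 'r) ring_scheme \<Rightarrow> 'x \<Rightarrow> 'x \<Rightarrow> 'a" where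
  "basis_vec R x = (\<lambda>y. if y = x then \<one>\<^bsub>R\<^esub> else \<zero>\<^bsub>R\<^esub>)"

definition tensor_relations ::
  "('a, 'r) ring_scheme \<Rightarrow> ('a, 'b, 'm) module_scheme \<Rightarrow> ('a, 'c, 'n) module_scheme
    \<Rightarrow> ('b \<times> 'c \<Rightarrow> 'a) set" where
  "tensor_relations R M N =
    (let F = free_module R (carrier M \<times> carrier N); e = (\<lambda>x y. basis_vec R (x, y)) in
      {e (x \<oplus>\<^bsub>M\<^esub> x') y \<ominus>\<^bsub>F\<^esub> (e x y \<oplus>\<^bsub>F\<^esub> e x' y) | x x' y.
         x \<in> carrier M \<and> x' \<in> carrier M \<and> y \<in> carrier N} \<union>
      {e x (y \<oplus>\<^bsub>N\<^esub> y') \<ominus>\<^bsub>F\<^esub> (e x y \<oplus>\<^bsub>F\<^esub> e x y') | x y y'.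
         x \<in> carrier M \<and> y \<in> carrier N \<and> y' \<in> carrier N} \<union>
      {e (a \<odot>\<^bsub>M\<^esub> x) y \<ominus>\<^bsub>F\<^esub> a \<odot>\<^bsub>F\<^esub> e x y | a x y.
         a \<in> carrier R \<and> x \<in> carrier M \<and> y \<in> carrier N} \<union>
      {e x (a \<odot>\<^bsub>N\<^esub> y) \<ominus>\<^bsub>F\<^esub> a \<odot>\<^bsub>F\<^esub> e x y | a x y.
         a \<in> carrier R \<and> x \<in> carrier M \<and> y \<in> carrier N})"

definition tensor_module ::
  "('a, 'r) ring_scheme \<Rightarrow> ('a, 'b, 'm) module_scheme \<Rightarrow> ('a, 'c, 'n) module_scheme
    \<Rightarrow> ('a, ('b \<times> 'c \<Rightarrow> 'a) set) module" where
  "tensor_module R M N =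
    (let F = free_module R (carrier M \<times> carrier N)
     in quot_module F (gen_submodule R F (tensor_relations R M N)))"


section \<open>Depth, grade, Cohen--Macaulay modules\<close>

text \<open>The submodule \<open>(A)M\<close>.\<close>

definition ideal_smult ::
  "('a, 'r) ring_scheme \<Rightarrow> ('a, 'b, 'm) module_scheme \<Rightarrow> 'a set \<Rightarrow> 'b set" where
  "ideal_smult R M A = gen_submodule R M {a \<odot>\<^bsub>M\<^esub> x | a x. a \<in> A \<and> x \<in> carrier M}"

text \<open>Each entry is a nonzerodivisor on \<open>M\<close> modulo its predecessors, and \<open>(xs)M \<noteq> M\<close>.\<close>

definition regular_seq ::
  "('a, 'r) ring_scheme \<Rightarrow> ('a, 'b, 'm) module_scheme \<Rightarrow> 'a list \<Rightarrow> bool" where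
  "regular_seq R M xs \<longleftrightarrow> set xs \<subseteq> carrier R \<and>
     (\<forall>i < length xs. \<forall>y \<in> carrier M.
        xs ! i \<odot>\<^bsub>M\<^esub> y \<in> ideal_smult R M (set (take i xs)) \<longrightarrow>
        y \<in> ideal_smult R M (set (take i xs))) \<and>
     ideal_smult R M (set xs) \<noteq> carrier M"

definition max_regular_length ::
  "('a, 'r) ring_scheme \<Rightarrow> 'a set \<Rightarrow> ('a, 'b, 'm) module_scheme \<Rightarrow> enat" where
  "max_regular_length R I M = Sup {enat (length xs) | xs. regular_seq R M xs \<and> set xs \<subseteq> I}"

definition grade :: "('a, 'r) ring_scheme \<Rightarrow> ('a, 'b, 'm) module_scheme \<Rightarrow> enat" where
  "grade R M = max_regular_length R (annihilator R M) (self_module R)"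

definition depth :: "('a, 'r) ring_scheme \<Rightarrow> ('a, 'b, 'm) module_scheme \<Rightarrow> enat" where
  "depth R M = max_regular_length R (max_ideal R) M"

definition module_dim :: "('a, 'r) ring_scheme \<Rightarrow> ('a, 'b, 'm) module_scheme \<Rightarrow> enat" where
  "module_dim R M = krull_dim (R Quot (annihilator R M))"

definition cohen_macaulay :: "('a, 'r) ring_scheme \<Rightarrow> ('a, 'b, 'm) module_scheme \<Rightarrow> bool" where
  "cohen_macaulay R M \<longleftrightarrow> finitely_generated R M \<and>
     (carrier M = {\<zero>\<^bsub>M\<^esub>} \<or> depth R M = module_dim R M)"


section \<open>Projective resolutions, projective dimension, Ext\<close>

text \<open>A module is projective if it is a direct summand of a free module. It is enough to consider
  index sets \<open>X\<close> in the type of the elements of \<open>P\<close>: any projective \<open>P\<close> is a direct summand of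
  the free module on its own carrier.\<close>

definition projective_module :: "('a, 'r) ring_scheme \<Rightarrow> ('a, 'p, 'm) module_scheme \<Rightarrow> bool" where
  "projective_module R P \<longleftrightarrow> module R P \<and>
     (\<exists>X :: 'p set. \<exists>s \<in> module_hom R P (free_module R X). \<exists>q \<in> module_hom R (free_module R X) P.
        \<forall>x \<in> carrier P. q (s x) = x)"

text \<open>Exactness of \<open>\<dots> \<rightarrow> P 2 \<rightarrow> P 1 \<rightarrow> P 0 \<rightarrow> M \<rightarrow> 0\<close> with \<open>d n : P (n + 1) \<rightarrow> P n\<close> and
  augmentation \<open>\<epsilon>\<close>.\<close>

definition projective_resolution ::
  "('a, 'r) ring_scheme \<Rightarrow> ('a, 'b, 'm) module_scheme \<Rightarrow> (nat \<Rightarrow> ('a, 'p) module)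
    \<Rightarrow> (nat \<Rightarrow> 'p \<Rightarrow> 'p) \<Rightarrow> ('p \<Rightarrow> 'b) \<Rightarrow> bool" where
  "projective_resolution R M P d \<epsilon> \<longleftrightarrow>
     (\<forall>n. projective_module R (P n)) \<and>
     \<epsilon> \<in> module_hom R (P 0) M \<and> (\<forall>n. d n \<in> module_hom R (P (Suc n)) (P n)) \<and>
     \<epsilon> ` carrier (P 0) = carrier M \<and>
     d 0 ` carrier (P 1) = {x \<in> carrier (P 0). \<epsilon> x = \<zero>\<^bsub>M\<^esub>} \<and>
     (\<forall>n. d (Suc n) ` carrier (P (Suc (Suc n))) = {x \<in> carrier (P (Suc n)). d n x = \<zero>\<^bsub>P n\<^esub>})"

text \<open>The next two definitions are meant for finitely generated modules over Noetherian rings, and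
  there it is no restriction that the elements of the modules in a resolution have type
  \<open>nat \<Rightarrow> 'a\<close>: such a module has a resolution by modules \<open>R\<^sup>n\<close>, which are the free modules on
  \<open>{..<n}\<close>. If moreover its projective dimension is finite, then one can stop at a syzygy that is
  projective, and a syzygy is a submodule of some \<open>R\<^sup>n\<close>.\<close>

definition finite_proj_dim :: "('a, 'r) ring_scheme \<Rightarrow> ('a, 'b, 'm) module_scheme \<Rightarrow> bool" where
  "finite_proj_dim R M \<longleftrightarrow>
     (\<exists>(P :: nat \<Rightarrow> ('a, nat \<Rightarrow> 'a) module) d \<epsilon> k.
        projective_resolution R M P d \<epsilon> \<and> (\<forall>n>k. carrier (P n) = {\<zero>\<^bsub>P n\<^esub>}))"

definition cocycles ::
  "('a, 'r) ring_scheme \<Rightarrow> (nat \<Rightarrow> ('a, 'p) module) \<Rightarrow> (nat \<Rightarrow> 'p \<Rightarrow> 'p)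
    \<Rightarrow> ('a, 'c, 'n) module_scheme \<Rightarrow> nat \<Rightarrow> ('p \<Rightarrow> 'c) set" where
  "cocycles R P d N n = {h \<in> carrier (hom_module R (P n) N).
     \<forall>x \<in> carrier (P (Suc n)). h (d n x) = \<zero>\<^bsub>N\<^esub>}"

primrec coboundaries ::
  "('a, 'r) ring_scheme \<Rightarrow> (nat \<Rightarrow> ('a, 'p) module) \<Rightarrow> (nat \<Rightarrow> 'p \<Rightarrow> 'p)
    \<Rightarrow> ('a, 'c, 'n) module_scheme \<Rightarrow> nat \<Rightarrow> ('p \<Rightarrow> 'c) set" where
  "coboundaries R P d N 0 = {\<zero>\<^bsub>hom_module R (P 0) N\<^esub>}"
| "coboundaries R P d N (Suc n) =
     (\<lambda>g. \<lambda>x\<in>carrier (P (Suc n)). g (d n x)) ` carrier (hom_module R (P n) N)"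

definition hom_cohomology ::
  "('a, 'r) ring_scheme \<Rightarrow> (nat \<Rightarrow> ('a, 'p) module) \<Rightarrow> (nat \<Rightarrow> 'p \<Rightarrow> 'p)
    \<Rightarrow> ('a, 'c, 'n) module_scheme \<Rightarrow> nat \<Rightarrow> ('a, ('p \<Rightarrow> 'c) set) module" where
  "hom_cohomology R P d N n =
     quot_module ((hom_module R (P n) N)\<lparr>carrier := cocycles R P d N n\<rparr>) (coboundaries R P d N n)"

text \<open>\<open>Ext\<^sup>n\<close> of \<open>M\<close> and \<open>N\<close>, computed from a chosen projective resolution of \<open>M\<close>; another choice
  gives an isomorphic module.\<close>

definition Ext_module ::
  "('a, 'r) ring_scheme \<Rightarrow> nat \<Rightarrow> ('a, 'b, 'm) module_scheme \<Rightarrow> ('a, 'c, 'n) module_scheme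
    \<Rightarrow> ('a, ((nat \<Rightarrow> 'a) \<Rightarrow> 'c) set) module" where
  "Ext_module R n M N =
     (case (SOME (P :: nat \<Rightarrow> ('a, nat \<Rightarrow> 'a) module, d). \<exists>\<epsilon>. projective_resolution R M P d \<epsilon>)
      of (P, d) \<Rightarrow> hom_cohomology R P d N n)"


definition CM_with_tensor_Ext ::
  "('a, 'r) ring_scheme \<Rightarrow> nat \<Rightarrow> ('a, 'b, 'm) module_scheme \<Rightarrow> bool" where
  "CM_with_tensor_Ext R c M \<longleftrightarrow>
     (let T = tensor_module R M (Ext_module R (c - 1) M (self_module R)) in
       cohen_macaulay R M \<and> cohen_macaulay R T \<and>
       grade R M = enat (c - 1) \<and> grade R T = enat (c - 1))"

text \<open>HOL cannot quantify over all types within a formula, so a fixed type of elements is needed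
  to speak of all finitely generated modules over a ring with elements in \<open>'a\<close>. The type
  \<open>(nat \<Rightarrow> 'a) set\<close> suffices: each such module is isomorphic to some \<open>R\<^sup>n / N\<close>, whose elements are
  cosets in \<open>R\<^sup>n\<close>, and all notions here are invariant under isomorphism.\<close>

type_synonym 'a coset_module = "('a, (nat \<Rightarrow> 'a) set) module"

end

theory Submission
  imports Defs
begin

text \<open>If \<open>R = S/(f)\<close> is not regular, the residue field \<open>k\<close> is a module as required. It and the module
  \<open>k \<otimes> Ext(k, R)\<close> are finitely generated and killed by the maximal ideal. Hence they are
  Cohen--Macaulay, and their grade is the depth of \<open>R\<close>; for the tensor product this needs no computation
  of \<open>Ext\<close>, since the grade of the zero module, with annihilator \<open>R\<close>, is also the depth of \<open>R\<close>.
  The depth of \<open>R\<close> is its dimension: by Krull's principal ideal theorem, \<open>S\<close> modulo part of a system of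
  parameters is a domain, and one can choose parameters \<open>y\<close> one after the other such that \<open>f\<close> remains
  nonzero modulo them.

  If \<open>f\<close> is not in the square of the maximal ideal of \<open>S\<close>, it is part of a system of parameters and
  \<open>R\<close> is regular. Otherwise \<open>f\<close> is a sum of products \<open>a x\<close> with all \<open>a\<close> and \<open>x\<close> in the maximal ideal, and
  the Koszul matrix factorization is an operator \<open>D\<close> with entries in the maximal ideal and \<open>D\<^sup>2 = f\<close>.
  Over \<open>R\<close> its kernel equals its image on free modules, thus on projective modules, thus on all modules of
  finite projective dimension. But on \<open>k\<close> it is zero.\<close>

section \<open>Noetherian rings\<close>

text \<open>Localizations and quotient rings are expressed inside one ring: ideals of the
  localization at \<open>Q\<close> are ideals saturated with respect to the complement of
  \<open>Q\<close>, and ideals of the quotient by \<open>I\<close> are ideals that contain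
  \<open>I\<close>. So an induction can vary \<open>I\<close> or \<open>Q\<close> while the ring and
  its element type stay fixed. Over \<open>R\<close> the relation D^2 = f becomes D^2 = 0, and D
  defines a 2-periodic complex on families of elements of any module. On free modules it is exact
  because D v = 0 over \<open>R\<close> lifts to D y = f w over \<open>S\<close>; applying D gives f
  y = f D w, and f can be cancelled in the domain \<open>S\<close>. A short exact sequence of
  modules induces one of these complexes, so exactness on a syzygy and on a projective module passes
  to their quotient; a bounded resolution starts this at a zero module. The number c is the
  dimension of \<open>S\<close>, and c - 1 that of \<open>R\<close>.\<close>

locale noetherian_cring = noetherian_ring + cring

definition adj_ideal :: "('a, 'b) ring_scheme \<Rightarrow> 'a set \<Rightarrow> 'a \<Rightarrow> 'a set" where
  "adj_ideal R I x = I <+>\<^bsub>R\<^esub> (PIdl\<^bsub>R\<^esub> x)"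

text \<open>\<open>sat_ideal\<close> singles out the contractions to \<open>R\<close> of the ideals
  of the localization at \<open>Q\<close>, and \<open>saturation\<close> is extension followed by
  contraction. With \<open>Q\<close> the maximal ideal of a local ring every ideal is
  saturated.\<close>

definition sat_ideal :: "('a, 'b) ring_scheme \<Rightarrow> 'a set \<Rightarrow> 'a set \<Rightarrow> bool" where
  "sat_ideal R Q N \<longleftrightarrow> ideal N R \<and>
     (\<forall>s \<in> carrier R - Q. \<forall>a \<in> carrier R. s \<otimes>\<^bsub>R\<^esub> a \<in> N \<longrightarrow> a \<in> N)"

definition saturation :: "('a, 'b) ring_scheme \<Rightarrow> 'a set \<Rightarrow> 'a set \<Rightarrow> 'a set" where
  "saturation R Q A = {a \<in> carrier R. \<exists>s \<in> carrier R - Q. s \<otimes>\<^bsub>R\<^esub> a \<in> A}"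

lemma adj_ideal_iff:
  "z \<in> adj_ideal R I x \<longleftrightarrow> (\<exists>i \<in> I. \<exists>r \<in> carrier R. z = i \<oplus>\<^bsub>R\<^esub> r \<otimes>\<^bsub>R\<^esub> x)"
  unfolding adj_ideal_def set_add_def' cgenideal_def by blast

lemma ideal_subset_carrier: "ideal I R \<Longrightarrow> I \<subseteq> carrier R"
  by (rule subsetI) (rule ideal.Icarr)

lemmas ideal_add_closed = additive_subgroup.a_closed[OF ideal.axioms(1)]
lemmas ideal_zero_closed = additive_subgroup.zero_closed[OF ideal.axioms(1)]

lemma (in cring) ideal_minus_closed: "ideal I R \<Longrightarrow> a \<in> I \<Longrightarrow> b \<in> I \<Longrightarrow> a \<ominus> b \<in> I"
  by (metis a_minus_def additive_subgroup.a_closed additive_subgroup.a_inv_closed ideal_def)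

lemma (in cring) adj_ideal_ideal: "ideal I R \<Longrightarrow> x \<in> carrier R \<Longrightarrow> ideal (adj_ideal R I x) R"
  unfolding adj_ideal_def by (simp add: add_ideals cgenideal_ideal)

lemma (in cring) adj_ideal_superset: "ideal I R \<Longrightarrow> x \<in> carrier R \<Longrightarrow> I \<subseteq> adj_ideal R I x"
proof
  fix i assume "ideal I R" "x \<in> carrier R" "i \<in> I"
  then show "i \<in> adj_ideal R I x"
    unfolding adj_ideal_iff by (intro bexI[of _ i] bexI[of _ \<zero>]) (auto dest: ideal.Icarr)
qed

lemma (in cring) adj_ideal_self: "ideal I R \<Longrightarrow> x \<in> carrier R \<Longrightarrow> x \<in> adj_ideal R I x"
  unfolding adj_ideal_iff by (intro bexI[of _ \<zero>] bexI[of _ \<one>]) (auto dest: ideal_zero_closed)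

lemma (in cring) adj_ideal_minimal:
  assumes "ideal J R" "I \<subseteq> J" "x \<in> J" shows "adj_ideal R I x \<subseteq> J"
proof
  fix z assume "z \<in> adj_ideal R I x"
  then obtain i r where "i \<in> I" "r \<in> carrier R" "z = i \<oplus> r \<otimes> x" unfolding adj_ideal_iff by blast
  then show "z \<in> J" using assms by (auto intro!: ideal_add_closed ideal.I_l_closed)
qed

lemma (in cring) adj_ideal_commute:
  assumes "ideal I R" "x \<in> carrier R" "y \<in> carrier R"
  shows "adj_ideal R (adj_ideal R I x) y = adj_ideal R (adj_ideal R I y) x"
proof -
  have "adj_ideal R (adj_ideal R I x) y \<subseteq> adj_ideal R (adj_ideal R I y) x"
    if "x \<in> carrier R" "y \<in> carrier R" for x y
    using that assms(1) adj_ideal_superset[of "adj_ideal R I y" x] adj_ideal_superset[of I y]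
    by (intro adj_ideal_minimal)
       (auto intro: adj_ideal_ideal adj_ideal_self
         dest: adj_ideal_self[of I])
  then show ?thesis using assms by blast
qed

text \<open>A nonempty chain of ideals in a Noetherian ring contains its union, so Zorn's lemma
  applies. Noetherian induction takes this form below.\<close>

lemma (in noetherian_cring) maximal_in_family:
  assumes "I0 \<in> F" "\<And>I. I \<in> F \<Longrightarrow> ideal I R"
  obtains M where "M \<in> F" "\<And>I. I \<in> F \<Longrightarrow> M \<subseteq> I \<Longrightarrow> I = M"
proof -
  have "\<exists>M \<in> F. \<forall>I \<in> F. M \<subseteq> I \<longrightarrow> I = M"
  proof (rule subset_Zorn_nonempty)
    show "F \<noteq> {}" using assms(1) by blast
    fix C assume "C \<noteq> {}" "subset.chain F C"
    then have "\<Union>C \<in> C" using assms(2)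
      by (intro ideal_chain_is_trivial) (auto simp: pred_on.chain_def)
    then show "\<Union>C \<in> F" using \<open>subset.chain F C\<close> by (auto simp: pred_on.chain_def)
  qed
  then show thesis using that by blast
qed

section \<open>Saturation at a prime ideal\<close>

lemma (in cring) prime_Compl_mult:
  "primeideal Q R \<Longrightarrow> s \<in> carrier R - Q \<Longrightarrow> t \<in> carrier R - Q \<Longrightarrow> s \<otimes> t \<in> carrier R - Q"
  using primeideal.I_prime by fastforce

lemma (in cring) prime_Compl_one: "primeideal Q R \<Longrightarrow> \<one> \<in> carrier R - Q"
  by (metis DiffI ideal.one_imp_carrier one_closed primeideal.I_notcarr primeideal_def)

lemma (in cring) saturation_sat:
  assumes Q: "primeideal Q R" and A: "ideal A R"
  shows "sat_ideal R Q (saturation R Q A)" "A \<subseteq> saturation R Q A"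
proof -
  let ?S = "saturation R Q A"
  have mem: "s \<otimes> a \<in> A \<Longrightarrow> s \<in> carrier R - Q \<Longrightarrow> a \<in> carrier R \<Longrightarrow> a \<in> ?S" for s a
    unfolding saturation_def by blast
  show sub: "A \<subseteq> ?S"
  proof
    fix a assume "a \<in> A" then show "a \<in> ?S"
      using A prime_Compl_one[OF Q] by (intro mem[of \<one>]) (auto dest: ideal.Icarr)
  qed
  have "ideal ?S R"
  proof (rule idealI)
    show "ring R" by (rule ring_axioms)
    have carr: "?S \<subseteq> carrier R" unfolding saturation_def by blast
    show "subgroup ?S (add_monoid R)"
    proof (rule add.subgroupI)
      show "?S \<subseteq> carrier R" by (rule carr)
      show "?S \<noteq> {}" using sub ideal_zero_closed[OF A] by blast
      show "\<ominus> a \<in> ?S" if "a \<in> ?S" for a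
      proof -
        from that obtain s where s: "s \<in> carrier R - Q" "s \<otimes> a \<in> A" "a \<in> carrier R"
          unfolding saturation_def by blast
        then have "s \<otimes> (\<ominus> a) = \<ominus> (s \<otimes> a)" by (simp add: r_minus)
        then have "s \<otimes> (\<ominus> a) \<in> A"
          using s(2) A by (simp add: additive_subgroup.a_inv_closed ideal.axioms(1))
        then show ?thesis using s mem[of s "\<ominus> a"] by simp
      qed
      show "a \<oplus> b \<in> ?S" if "a \<in> ?S" "b \<in> ?S" for a b
      proof -
        from that obtain s t where s: "s \<in> carrier R - Q" "s \<otimes> a \<in> A" "a \<in> carrier R"
          and t: "t \<in> carrier R - Q" "t \<otimes> b \<in> A" "b \<in> carrier R"
          unfolding saturation_def by blast
        have c: "s \<in> carrier R" "t \<in> carrier R" using s t by auto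
        \<comment> \<open>The product of the two denominators clears both.\<close>
        have "(s \<otimes> t) \<otimes> (a \<oplus> b) = t \<otimes> (s \<otimes> a) \<oplus> s \<otimes> (t \<otimes> b)"
          using c s(3) t(3) by algebra
        also have "\<dots> \<in> A"
          using ideal.I_l_closed[OF A s(2) c(2)] ideal.I_l_closed[OF A t(2) c(1)]
          by (rule ideal_add_closed[OF A])
        finally show ?thesis
          using s t prime_Compl_mult[OF Q, of s t] mem[of "s \<otimes> t" "a \<oplus> b"] by simp
      qed
    qed
    show "x \<otimes> a \<in> ?S" if "a \<in> ?S" "x \<in> carrier R" for a x
    proof -
      from that obtain s where s: "s \<in> carrier R - Q" "s \<otimes> a \<in> A" "a \<in> carrier R"
        unfolding saturation_def by blast
      then have "s \<otimes> (x \<otimes> a) = x \<otimes> (s \<otimes> a)" using that(2) by (simp add: m_lcomm)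
      also have "\<dots> \<in> A" by (rule ideal.I_l_closed[OF A s(2) that(2)])
      finally show ?thesis using s that mem by simp
    qed
    then show "a \<otimes> x \<in> ?S" if "a \<in> ?S" "x \<in> carrier R" for a x
      using that carr m_comm[of a x] by auto
  qed
  moreover have "a \<in> ?S" if st: "s \<in> carrier R - Q" "a \<in> carrier R" "s \<otimes> a \<in> ?S" for s a
  proof -
    from st obtain t where t: "t \<in> carrier R - Q" "t \<otimes> (s \<otimes> a) \<in> A"
      unfolding saturation_def by blast
    then have "(t \<otimes> s) \<otimes> a \<in> A" using st by (simp add: m_assoc)
    then show ?thesis using prime_Compl_mult[OF Q t(1) st(1)] mem st by blast
  qed
  ultimately show "sat_ideal R Q ?S" unfolding sat_ideal_def by blast
qed

lemma (in cring) saturation_adjE: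
  assumes "a \<in> saturation R Q (adj_ideal R I x)"
  obtains s i r where "s \<in> carrier R - Q" "i \<in> I" "r \<in> carrier R" "s \<otimes> a = i \<oplus> r \<otimes> x" "a \<in> carrier R"
  using assms unfolding saturation_def adj_ideal_iff by blast

lemma (in cring) sat_ideal_mono_prime:
  "P \<subseteq> Q \<Longrightarrow> sat_ideal R P N \<Longrightarrow> sat_ideal R Q N"
  unfolding sat_ideal_def by blast

lemma (in cring) sat_ideal_self: "primeideal P R \<Longrightarrow> sat_ideal R P P"
  unfolding sat_ideal_def by (meson DiffD1 DiffD2 primeideal.I_prime primeideal_def)

text \<open>Nakayama's lemma for the localization at \<open>Q\<close>: a saturated ideal \<open>N \<supseteq> I\<close> that is maximal
  among those not containing \<open>J\<close> contains \<open>Q J\<close>.\<close>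

lemma (in noetherian_cring) nakayama:
  assumes Q: "primeideal Q R" and I: "sat_ideal R Q I" and J: "J \<subseteq> carrier R"
    and step: "\<And>N. sat_ideal R Q N \<Longrightarrow> I \<subseteq> N \<Longrightarrow> (\<And>q g. q \<in> Q \<Longrightarrow> g \<in> J \<Longrightarrow> q \<otimes> g \<in> N) \<Longrightarrow> J \<subseteq> N"
  shows "J \<subseteq> I"
proof (rule ccontr)
  assume "\<not> J \<subseteq> I"
  define F where "F = {N. sat_ideal R Q N \<and> I \<subseteq> N \<and> \<not> J \<subseteq> N}"
  have "I \<in> F" unfolding F_def using I \<open>\<not> J \<subseteq> I\<close> by blast
  have Fi: "\<And>I. I \<in> F \<Longrightarrow> ideal I R" unfolding F_def sat_ideal_def by blast
  obtain N where N: "N \<in> F" "\<And>K. K \<in> F \<Longrightarrow> N \<subseteq> K \<Longrightarrow> K = N"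
    using maximal_in_family[OF \<open>I \<in> F\<close> Fi] by metis
  have Ni: "ideal N R" using N(1) Fi by blast
  have Qi: "ideal Q R" using Q primeideal.axioms(1) by blast
  have "q \<otimes> g \<in> N" if q: "q \<in> Q" and g: "g \<in> J" for q g
  proof (rule ccontr)
    assume n: "q \<otimes> g \<notin> N"
    have qc: "q \<in> carrier R" "g \<in> carrier R" using q g J ideal.Icarr[OF Qi] by auto
    let ?K = "saturation R Q (adj_ideal R N (q \<otimes> g))"
    have adj: "ideal (adj_ideal R N (q \<otimes> g)) R" using Ni qc by (intro adj_ideal_ideal) auto
    note K = saturation_sat[OF Q adj]
    have "N \<subseteq> ?K" using K(2) adj_ideal_superset[OF Ni, of "q \<otimes> g"] qc by auto
    moreover have "q \<otimes> g \<in> ?K" using K(2) adj_ideal_self[OF Ni, of "q \<otimes> g"] qc by auto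
    \<comment> \<open>\<open>?K\<close> is saturated and strictly larger than \<open>N\<close>, so
      by maximality it contains \<open>J\<close>, in particular \<open>g\<close>.\<close>
    ultimately have "?K \<notin> F" using N(2)[of ?K] n by blast
    then have "J \<subseteq> ?K" using K(1) \<open>N \<subseteq> ?K\<close> N(1) unfolding F_def by blast
    then have "g \<in> ?K" using g by blast
    then obtain s i r where s: "s \<in> carrier R - Q" "i \<in> N" "r \<in> carrier R"
      "s \<otimes> g = i \<oplus> r \<otimes> (q \<otimes> g)" by (elim saturation_adjE)
    have ic: "i \<in> carrier R" using s(2) ideal.Icarr[OF Ni] by auto
    have sc: "s \<in> carrier R" using s(1) by auto
    have "(s \<ominus> r \<otimes> q) \<otimes> g = s \<otimes> g \<ominus> r \<otimes> (q \<otimes> g)"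
      using sc s(3) qc by algebra
    also have "\<dots> = i" unfolding s(4) using s(3) qc ic by algebra
    finally have e: "(s \<ominus> r \<otimes> q) \<otimes> g \<in> N" using s by simp
    \<comment> \<open>A unit of the localization: \<open>s\<close> lies outside \<open>Q\<close> and
      \<open>r \<otimes> q\<close> inside. Hence its product with \<open>g\<close> lies in
      \<open>N\<close> only if \<open>g\<close> does.\<close>
    have "s \<ominus> r \<otimes> q \<notin> Q"
    proof
      assume a: "s \<ominus> r \<otimes> q \<in> Q"
      have "(s \<ominus> r \<otimes> q) \<oplus> r \<otimes> q \<in> Q"
        by (rule ideal_add_closed[OF Qi a ideal.I_l_closed[OF Qi q s(3)]])
      moreover have "(s \<ominus> r \<otimes> q) \<oplus> r \<otimes> q = s" using sc s(3) qc by algebra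
      ultimately show False using s(1) by simp
    qed
    then have "g \<in> N" using e N(1) s(1,3) qc unfolding F_def sat_ideal_def by blast
    then show False using n qc Ni by (simp add: ideal.I_l_closed)
  qed
  then show False using N(1) step[of N] unfolding F_def by blast
qed

lemma (in cring) saturation_minimal:
  "sat_ideal R Q N \<Longrightarrow> A \<subseteq> N \<Longrightarrow> saturation R Q A \<subseteq> N"
  unfolding sat_ideal_def saturation_def by blast

text \<open>The descending chain condition for the localization at \<open>Q\<close> modulo \<open>I\<close>, by Noetherian
  induction: for \<open>B\<close> maximal without the chain condition above it, pick \<open>b \<notin> B\<close> with \<open>(B : b)\<close>
  prime, hence equal to \<open>Q\<close>; the chain condition then passes from \<open>B + (b)\<close> down to \<open>B\<close>.\<close>

lemma (in noetherian_cring) dcc_over_minimal_prime: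
  assumes Q: "primeideal Q R" and I: "ideal I R" "I \<subseteq> Q"
    and min: "\<And>P. primeideal P R \<Longrightarrow> I \<subseteq> P \<Longrightarrow> P \<subseteq> Q \<Longrightarrow> P = Q"
    and J: "\<And>n. sat_ideal R Q (J n)" "\<And>n. I \<subseteq> J n" "\<And>n. J (Suc n) \<subseteq> J n"
  shows "\<exists>n0. \<forall>n\<ge>n0. J n = J n0"
proof -
  define good where "good B \<longleftrightarrow> (\<forall>J :: nat \<Rightarrow> 'a set. (\<forall>n. sat_ideal R Q (J n) \<and> B \<subseteq> J n \<and> J (Suc n) \<subseteq> J n)
      \<longrightarrow> (\<exists>n0. \<forall>n\<ge>n0. J n = J n0))" for B
  have goodD: "\<exists>n0. \<forall>n\<ge>n0. J n = J n0"
    if "good B" "\<And>n. sat_ideal R Q (J n)" "\<And>n. B \<subseteq> J n" "\<And>n. J (Suc n) \<subseteq> J n" for B J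
    using that(1)[unfolded good_def, rule_format, of J] that(2-4) by simp
  define F where "F = {B. ideal B R \<and> I \<subseteq> B \<and> \<not> good B}"
  have "good I"
  proof (rule ccontr)
    assume "\<not> good I"
    then have "I \<in> F" unfolding F_def using I by simp
    have Fi: "\<And>I. I \<in> F \<Longrightarrow> ideal I R" unfolding F_def by blast
    obtain B where B: "B \<in> F" "\<And>K. K \<in> F \<Longrightarrow> B \<subseteq> K \<Longrightarrow> K = B"
      using maximal_in_family[OF \<open>I \<in> F\<close> Fi] by metis
    have Bi: "ideal B R" "I \<subseteq> B" "\<not> good B" using B(1) unfolding F_def by auto
    have goodI: "good K" if "ideal K R" "B \<subset> K" for K
      using that B(2)[of K] Bi unfolding F_def by blast
    \<comment> \<open>All members of the chains considered are saturated, so a chain above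
      \<open>B\<close> also lies above its saturation; by maximality of \<open>B\<close> the two
      coincide.\<close>
    have "saturation R Q B = B"
    proof (rule ccontr)
      note sB = saturation_sat[OF Q Bi(1)]
      assume "saturation R Q B \<noteq> B"
      then have "good (saturation R Q B)"
        using sB by (intro goodI) (auto simp: sat_ideal_def)
      then have "good B" unfolding good_def by (simp add: goodD saturation_minimal)
      then show False using Bi by blast
    qed
    then have Bs: "sat_ideal R Q B" using saturation_sat[OF Q Bi(1)] by simp
    obtain J :: "nat \<Rightarrow> 'a set" where J: "\<And>n. sat_ideal R Q (J n)" "\<And>n. B \<subseteq> J n" "\<And>n. J (Suc n) \<subseteq> J n"
      and nst: "\<not> (\<exists>n0. \<forall>n\<ge>n0. J n = J n0)" using Bi(3) unfolding good_def by auto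
    have anti: "J n \<subseteq> J m" if "m \<le> n" for m n
      using that by (induction rule: dec_induct) (use J(3) in blast)+
    have Ji: "ideal (J n) R" for n using J(1) unfolding sat_ideal_def by blast
    \<comment> \<open>The colon ideals (B : b) with b outside \<open>B\<close>. A maximal one is
      prime: for d outside (B : b), the colon ideal (B : bd) contains (B : b) and hence equals
      it.\<close>
    define G where "G = {{c \<in> carrier R. b \<otimes> c \<in> B} | b. b \<in> carrier R \<and> b \<notin> B}"
    have Gi: "ideal K R" if "K \<in> G" for K
      using that ideal.helper_max_prime[OF Bi(1) is_cring] unfolding G_def by blast
    have "B \<noteq> carrier R"
    proof
      assume "B = carrier R"
      then have "J n = carrier R" for n using J(2)[of n] ideal_subset_carrier[OF Ji[of n]] by blast
      then show False using nst by blast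
    qed
    then obtain P0 where "P0 \<in> G" unfolding G_def using ideal_subset_carrier[OF Bi(1)] by blast
    then obtain P where P: "P \<in> G" "\<And>K. K \<in> G \<Longrightarrow> P \<subseteq> K \<Longrightarrow> K = P"
      using maximal_in_family[OF _ Gi, of P0] by metis
    then obtain b where b: "b \<in> carrier R" "b \<notin> B" and Pd: "P = {c \<in> carrier R. b \<otimes> c \<in> B}"
      unfolding G_def by blast
    have BP: "B \<subseteq> P" unfolding Pd using ideal.I_l_closed[OF Bi(1)] b ideal_subset_carrier[OF Bi(1)] by blast
    have "primeideal P R"
    proof (rule primeidealI)
      show "ideal P R" by (rule Gi[OF P(1)])
      show "cring R" by (rule is_cring)
      show "carrier R \<noteq> P" unfolding Pd using b by (metis (no_types, lifting) mem_Collect_eq one_closed r_one)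
      fix c d assume cd: "c \<in> carrier R" "d \<in> carrier R" "c \<otimes> d \<in> P"
      show "c \<in> P \<or> d \<in> P"
      proof (rule disjCI)
        assume "d \<notin> P"
        then have bd: "b \<otimes> d \<notin> B" unfolding Pd using cd by blast
        let ?K = "{e \<in> carrier R. (b \<otimes> d) \<otimes> e \<in> B}"
        have "P \<subseteq> ?K"
        proof
          fix e assume e: "e \<in> P"
          then have "d \<otimes> (b \<otimes> e) \<in> B" unfolding Pd using cd ideal.I_l_closed[OF Bi(1)] by blast
          moreover have "d \<otimes> (b \<otimes> e) = (b \<otimes> d) \<otimes> e" using e b cd unfolding Pd
            by (simp add: m_assoc m_lcomm)
          ultimately show "e \<in> ?K" using e unfolding Pd by simp
        qed
        moreover have "?K \<in> G" unfolding G_def using bd b cd by blast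
        ultimately have "?K = P" using P(2) by blast
        moreover have "(b \<otimes> d) \<otimes> c = b \<otimes> (c \<otimes> d)" using cd b by algebra
        then have "c \<in> ?K" using cd unfolding Pd by simp
        ultimately show "c \<in> P" by blast
      qed
    qed
    \<comment> \<open>An element of (B : b) outside \<open>Q\<close> would bring b into the
      saturated ideal \<open>B\<close>.\<close>
    moreover have "P \<subseteq> Q" unfolding Pd using Bs b unfolding sat_ideal_def
      by (smt (verit) DiffI m_comm mem_Collect_eq subsetI)
    ultimately have "P = Q" using min BP Bi by blast
    have adj: "ideal (adj_ideal R A b) R" if "ideal A R" for A using that b by (intro adj_ideal_ideal)
    \<comment> \<open>The chain modulo b. It lies above B + (b), which is good by maximality of
      \<open>B\<close>, and so becomes stationary.\<close>
    define K where "K n = saturation R Q (adj_ideal R (J n) b)" for n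
    have Kanti: "K (Suc n) \<subseteq> K n" for n
      unfolding K_def saturation_def adj_ideal_iff using J(3) by blast
    have "B \<subset> adj_ideal R B b"
      using adj_ideal_superset[OF Bi(1) b(1)] adj_ideal_self[OF Bi(1) b(1)] b(2) by blast
    then have "good (adj_ideal R B b)" using adj Bi(1) by (intro goodI)
    moreover have "adj_ideal R B b \<subseteq> K n" for n
      unfolding K_def using J(2) saturation_sat(2)[OF Q adj[OF Ji]] unfolding adj_ideal_iff subset_iff by blast
    moreover have "sat_ideal R Q (K n)" for n unfolding K_def by (intro saturation_sat Q adj Ji)
    ultimately obtain n1 where n1: "\<And>n. n \<ge> n1 \<Longrightarrow> K n = K n1"
      using goodD[of _ K] Kanti by metis
    \<comment> \<open>If all \<open>J n\<close> contained \<open>b\<close>, this chain too would lie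
      above B + (b) and become stationary.\<close>
    have bJ: "\<not> (\<forall>n. b \<in> J n)"
    proof
      assume a: "\<forall>n. b \<in> J n"
      have "adj_ideal R B b \<subseteq> J n" for n using a J(2) Ji by (intro adj_ideal_minimal) auto
      then show False using goodD[OF \<open>good (adj_ideal R B b)\<close>, of J] J nst by simp
    qed
    then obtain n2 where n2: "b \<notin> J n2" by blast
    define n0 where "n0 = max n1 n2"
    have "J n = J n0" if n: "n \<ge> n0" for n
    proof
      show "J n \<subseteq> J n0" by (rule anti[OF n])
      show "J n0 \<subseteq> J n"
      proof
        fix a assume a: "a \<in> J n0"
        have "a \<in> K n0" unfolding K_def
          using a saturation_sat(2)[OF Q adj[OF Ji[of n0]]] adj_ideal_superset[OF Ji[of n0] b(1)] by blast
        then have "a \<in> K n" using n1[of n0] n1[of n] n unfolding n0_def by simp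
        then obtain s j r where s: "s \<in> carrier R - Q" "j \<in> J n" "r \<in> carrier R"
            "s \<otimes> a = j \<oplus> r \<otimes> b" "a \<in> carrier R"
          unfolding K_def by (elim saturation_adjE)
        have jc: "j \<in> carrier R" "s \<in> carrier R" using s ideal.Icarr[OF Ji] by auto
        \<comment> \<open>Otherwise saturation of \<open>J n0\<close> would give
          \<open>b \<in> J n0\<close>. Since \<open>Q\<close> is (B : b), it follows that
          \<open>r \<otimes> b\<close> lies in \<open>B\<close>, hence in
          \<open>J n\<close>.\<close>
        have "r \<in> Q"
        proof (rule ccontr)
          assume "r \<notin> Q"
          have "r \<otimes> b = s \<otimes> a \<ominus> j" unfolding s(4) using jc s(3) b(1) by algebra
          also have "\<dots> \<in> J n0" using ideal.I_l_closed[OF Ji a jc(2)] s(2) anti[OF n]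
            by (intro ideal_minus_closed Ji) auto
          finally have "b \<in> J n0" using \<open>r \<notin> Q\<close> s(3) b(1) J(1)[of n0] unfolding sat_ideal_def by blast
          then show False using n2 anti[of n2 n0] unfolding n0_def by auto
        qed
        then have "r \<otimes> b \<in> B" using \<open>P = Q\<close> s(3) b(1) unfolding Pd by (auto simp: m_comm)
        then have "s \<otimes> a \<in> J n" unfolding s(4) using s(2) J(2) Ji by (intro ideal_add_closed) auto
        then show "a \<in> J n" using s(1,5) J(1)[of n] unfolding sat_ideal_def by blast
      qed
    qed
    then show False using nst by blast
  qed
  then show ?thesis using goodD J by simp
qed

lemma (in cring) sat_ideal_Inter:
  assumes "F \<noteq> {}" "\<And>N. N \<in> F \<Longrightarrow> sat_ideal R Q N"
  shows "sat_ideal R Q (\<Inter>F)"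
proof -
  have "ideal (\<Inter>F) R" using assms unfolding sat_ideal_def by (intro i_Intersect) auto
  then show ?thesis using assms(2) unfolding sat_ideal_def by blast
qed

section \<open>Chains of primes\<close>

text \<open>Krull's principal ideal theorem for chains of three primes. In the proof \<open>L n\<close> plays the role
  of the symbolic powers of \<open>P1\<close>; if \<open>P2\<close> were minimal over \<open>P0 + (x)\<close>, the ideals \<open>L n\<close> would become
  stationary by the chain condition and Nakayama's lemma at \<open>P2\<close>, and then fall into \<open>P0\<close> by
  Nakayama's lemma at \<open>P1\<close>.\<close>

lemma (in noetherian_cring) principal_ideal_theorem:
  assumes P: "primeideal P0 R" "primeideal P1 R" "primeideal P2 R"
    and lt: "P0 \<subset> P1" "P1 \<subset> P2" and x: "x \<in> P2"
  shows "\<exists>q. primeideal q R \<and> P0 \<subset> q \<and> q \<subset> P2 \<and> x \<in> q"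
proof (rule ccontr)
  assume no: "\<not> ?thesis"
  have Pi: "ideal P0 R" "ideal P1 R" "ideal P2 R" using P primeideal.axioms(1) by auto
  have xc: "x \<in> carrier R" using x ideal.Icarr[OF Pi(3)] by blast
  have x1: "x \<notin> P1" using no P(2) lt by blast
  then have x0: "x \<notin> P0" using lt by blast
  note aP = adj_ideal_ideal[OF Pi(1) xc] adj_ideal_superset[OF Pi(1) xc] adj_ideal_self[OF Pi(1) xc]
  \<comment> \<open>\<open>L (Suc n)\<close> is the least member of \<open>fam (L n)\<close>: the
    saturation at \<open>P1\<close> of P0 + P1 L(n). Modulo \<open>P0\<close> these are the symbolic
    powers of \<open>P1\<close>.\<close>
  define fam where "fam X = {N. sat_ideal R P1 N \<and> P0 \<subseteq> N \<and> (\<forall>q\<in>P1. \<forall>g\<in>X. q \<otimes> g \<in> N)}" for X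
  define L where "L = rec_nat (carrier R) (\<lambda>_ X. \<Inter>(fam X))"
  have L0: "L 0 = carrier R" and LS: "L (Suc n) = \<Inter>(fam (L n))" for n unfolding L_def by auto
  have carr: "sat_ideal R P1 (carrier R)" unfolding sat_ideal_def using oneideal by blast
  have Lprop: "sat_ideal R P1 (L n) \<and> P0 \<subseteq> L n" for n
  proof (induction n)
    case 0 show ?case unfolding L0 using carr ideal_subset_carrier[OF Pi(1)] by blast
  next
    case (Suc n)
    have "carrier R \<in> fam (L n)"
      using carr ideal_subset_carrier[OF Pi(1)] ideal_subset_carrier[OF Pi(2)]
        ideal_subset_carrier[of "L n" R] Suc unfolding fam_def sat_ideal_def by blast
    then have "sat_ideal R P1 (\<Inter>(fam (L n)))"
      by (intro sat_ideal_Inter) (auto simp: fam_def)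
    then show ?case unfolding LS fam_def by blast
  qed
  have Li: "ideal (L n) R" for n using Lprop unfolding sat_ideal_def by blast
  have Ldec: "L (Suc n) \<subseteq> L n" for n
  proof -
    have "L n \<in> fam (L n)" unfolding fam_def using Lprop ideal.I_l_closed[OF Li] ideal.Icarr[OF Pi(2)] by auto
    then show ?thesis unfolding LS by blast
  qed
  define J where "J n = saturation R P2 (adj_ideal R (L n) x)" for n
  note aL = adj_ideal_ideal[OF Li xc] adj_ideal_superset[OF Li xc] adj_ideal_self[OF Li xc]
  have "\<exists>n0. \<forall>n\<ge>n0. J n = J n0"
  proof (rule dcc_over_minimal_prime[OF P(3) aP(1)])
    show "adj_ideal R P0 x \<subseteq> P2" using lt x by (intro adj_ideal_minimal Pi) auto
    \<comment> \<open>Negating the claim makes \<open>P2\<close> minimal over P0 + (x): a smaller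
      prime over this ideal contains \<open>x\<close>, and so differs from
      \<open>P0\<close>.\<close>
    show "P = P2" if "primeideal P R" "adj_ideal R P0 x \<subseteq> P" "P \<subseteq> P2" for P
      using no that aP(2,3) x0 by blast
    show "sat_ideal R P2 (J n)" for n unfolding J_def by (rule saturation_sat[OF P(3) aL(1)])
    show "adj_ideal R P0 x \<subseteq> J n" for n
    proof -
      have "adj_ideal R P0 x \<subseteq> adj_ideal R (L n) x"
        using Lprop aL(2,3) by (intro adj_ideal_minimal aL(1)) blast+
      then show ?thesis unfolding J_def using saturation_sat(2)[OF P(3) aL(1)] by blast
    qed
    show "J (Suc n) \<subseteq> J n" for n
      using Ldec[of n] unfolding J_def saturation_def adj_ideal_iff by blast
  qed
  then obtain n where n: "J n = J (Suc n)" by (metis le_Suc_eq order_refl)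
  have "L n \<subseteq> L (Suc n)"
  proof (rule nakayama[OF P(3)])
    show "sat_ideal R P2 (L (Suc n))" using Lprop sat_ideal_mono_prime lt(2) by blast
    show "L n \<subseteq> carrier R" by (rule ideal_subset_carrier[OF Li])
    fix N assume N: "sat_ideal R P2 N" "L (Suc n) \<subseteq> N"
      and PN: "\<And>q g. q \<in> P2 \<Longrightarrow> g \<in> L n \<Longrightarrow> q \<otimes> g \<in> N"
    have Ni: "ideal N R" using N unfolding sat_ideal_def by blast
    show "L n \<subseteq> N"
    proof
      fix a assume a: "a \<in> L n"
      then have "a \<in> adj_ideal R (L n) x" using aL(2)[of n] by blast
      then have "a \<in> J n" unfolding J_def using saturation_sat(2)[OF P(3) aL(1)[of n]] by blast
      then have "a \<in> J (Suc n)" using n by simp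
      then obtain s i r where s: "s \<in> carrier R - P2" "i \<in> L (Suc n)" "r \<in> carrier R"
          "s \<otimes> a = i \<oplus> r \<otimes> x" "a \<in> carrier R" unfolding J_def by (elim saturation_adjE)
      have c: "s \<in> carrier R" "i \<in> carrier R" using s ideal.Icarr[OF Li] by auto
      \<comment> \<open>As \<open>L n\<close> is saturated at \<open>P1\<close> and \<open>x\<close>
        lies outside \<open>P1\<close>, the coefficient \<open>r\<close> lies in \<open>L n\<close>.
        Locally at \<open>P2\<close> this says L(n) \<subseteq> L(n+1) + x L(n), which is what
        Nakayama's lemma asks for.\<close>
      have "x \<otimes> r = s \<otimes> a \<ominus> i" unfolding s(4) using c s(3) xc by algebra
      also have "\<dots> \<in> L n"
        using ideal.I_l_closed[OF Li a c(1)] s(2) Ldec by (intro ideal_minus_closed Li) auto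
      finally have "r \<in> L n" using x1 xc s(3) Lprop[of n] unfolding sat_ideal_def by blast
      then have "r \<otimes> x \<in> N" using PN[OF x, of r] m_comm[OF s(3) xc] by simp
      then have "s \<otimes> a \<in> N" unfolding s(4) using s(2) N(2) by (intro ideal_add_closed Ni) auto
      then show "a \<in> N" using s(1,5) N(1) unfolding sat_ideal_def by blast
    qed
  qed
  \<comment> \<open>Now \<open>L n\<close> lies in every member of \<open>fam (L n)\<close>, and
    Nakayama's lemma at \<open>P1\<close> applies over \<open>P0\<close>.\<close>
  have "L n \<subseteq> P0"
  proof (rule nakayama[OF P(2)])
    show "sat_ideal R P1 P0" using sat_ideal_self[OF P(1)] sat_ideal_mono_prime lt(1) by blast
    show "L n \<subseteq> carrier R" by (rule ideal_subset_carrier[OF Li])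
    fix N assume "sat_ideal R P1 N" "P0 \<subseteq> N" "\<And>q g. q \<in> P1 \<Longrightarrow> g \<in> L n \<Longrightarrow> q \<otimes> g \<in> N"
    then have "N \<in> fam (L n)" unfolding fam_def by blast
    then show "L n \<subseteq> N" using \<open>L n \<subseteq> L (Suc n)\<close> unfolding LS by blast
  qed
  \<comment> \<open>Since \<open>P0\<close> is prime and \<open>P1\<close> is not contained in it,
    products of elements outside \<open>P0\<close> carry this from \<open>L n\<close> to
    \<open>L (Suc n)\<close>.\<close>
  moreover have "\<not> L n \<subseteq> P0" for n
  proof (induction n)
    case 0 then show ?case unfolding L0
      using primeideal.I_notcarr[OF P(1)] ideal_subset_carrier[OF Pi(1)] by blast
  next
    case (Suc n)
    then obtain q g where q: "q \<in> P1" "q \<notin> P0" "g \<in> L n" "g \<notin> P0" using lt(1) by blast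
    have "q \<otimes> g \<in> L (Suc n)" unfolding LS fam_def using q by blast
    moreover have "q \<otimes> g \<notin> P0"
      using q primeideal.I_prime[OF P(1)] ideal.Icarr[OF Pi(2)] ideal.Icarr[OF Li] by blast
    ultimately show ?case by blast
  qed
  ultimately show False by blast
qed

text \<open>Both ends of the chain are parameters because the arguments below keep the top fixed,
  mostly at the maximal ideal, and track what the bottom contains. The recursion adds primes at the
  top, where \<open>pchain_shift\<close> applies the principal ideal theorem.\<close>

primrec pchain :: "('a, 'b) ring_scheme \<Rightarrow> nat \<Rightarrow> 'a set \<Rightarrow> 'a set \<Rightarrow> bool" where
  "pchain R 0 P Q \<longleftrightarrow> P = Q \<and> primeideal Q R"
| "pchain R (Suc n) P Q \<longleftrightarrow> (\<exists>P'. pchain R n P P' \<and> P' \<subset> Q \<and> primeideal Q R)"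

lemma pchain_prime: "pchain R n P Q \<Longrightarrow> primeideal P R \<and> primeideal Q R \<and> P \<subseteq> Q"
  by (induction n arbitrary: Q) fastforce+

lemma pchain_Cons:
  "pchain R n P' Q \<Longrightarrow> primeideal P R \<Longrightarrow> P \<subset> P' \<Longrightarrow> pchain R (Suc n) P Q"
proof (induction n arbitrary: Q)
  case (Suc n)
  then obtain Q' where "pchain R n P' Q'" "Q' \<subset> Q" "primeideal Q R" by auto
  then show ?case using Suc.IH[of Q'] Suc.prems by (metis pchain.simps(2))
qed auto

text \<open>Length 0 is excluded because there the bottom would have to move together with the
  top.\<close>

lemma pchain_raise_top:
  "pchain R n P Q \<Longrightarrow> Q \<subseteq> Q' \<Longrightarrow> primeideal Q' R \<Longrightarrow> n \<noteq> 0 \<Longrightarrow> pchain R n P Q'"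
proof (cases n)
  case (Suc k)
  assume "pchain R n P Q" "Q \<subseteq> Q'" "primeideal Q' R"
  then obtain P' where P': "pchain R k P P'" "P' \<subset> Q" using Suc by (simp only: pchain.simps) blast
  then have "P' \<subset> Q'" using \<open>Q \<subseteq> Q'\<close> by blast
  then show ?thesis using Suc \<open>primeideal Q' R\<close> P'(1) by (simp only: pchain.simps) blast
qed simp

text \<open>The principal ideal theorem, applied to the three topmost primes, puts \<open>x\<close>
  into the last prime below the top; the induction then works downwards. The price is one step of
  the chain, and the bottom grows strictly.\<close>

lemma (in noetherian_cring) pchain_shift:
  assumes "pchain R (Suc n) P Q" "x \<in> Q"
  shows "\<exists>P'. pchain R n P' Q \<and> P \<subset> P' \<and> x \<in> P'"
  using assms
proof (induction n arbitrary: Q)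
  case 0
  then show ?case by auto
next
  case (Suc n)
  then obtain P1 P0 where c: "pchain R n P P0" "P0 \<subset> P1" "primeideal P1 R" "P1 \<subset> Q" "primeideal Q R"
    by auto
  then obtain q where q: "primeideal q R" "P0 \<subset> q" "q \<subset> Q" "x \<in> q"
    using principal_ideal_theorem[of P0 P1 Q x] pchain_prime[OF c(1)] Suc.prems(2) by blast
  then have "pchain R (Suc n) P q" using c(1) by auto
  then obtain P' where "pchain R n P' q" "P \<subset> P'" "x \<in> P'" using Suc.IH q(4) by blast
  then show ?case using q(3) c(5) by auto
qed

section \<open>Regular local rings\<close>

locale local_noetherian_cring = noetherian_cring +
  fixes \<mm> :: "'a set"
  assumes maximal: "maximalideal \<mm> R"
    and unique_maximal: "maximalideal J R \<Longrightarrow> J = \<mm>"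
begin

lemma mm_ideal: "ideal \<mm> R" using maximal maximalideal.axioms(1) by blast
lemma mm_prime: "primeideal \<mm> R" by (rule maximalideal_prime[OF maximal])
lemma mm_neq: "\<mm> \<noteq> carrier R" using maximal maximalideal.I_notcarr by blast

lemma proper_ideal_le_mm:
  assumes "ideal I R" "I \<noteq> carrier R" shows "I \<subseteq> \<mm>"
proof -
  define F where "F = {J. ideal J R \<and> I \<subseteq> J \<and> J \<noteq> carrier R}"
  have F: "I \<in> F" "\<And>J. J \<in> F \<Longrightarrow> ideal J R" unfolding F_def using assms by auto
  obtain J where J: "J \<in> F" "\<And>K. K \<in> F \<Longrightarrow> J \<subseteq> K \<Longrightarrow> K = J" using maximal_in_family[OF F] by metis
  have "maximalideal J R"
  proof (rule maximalidealI)
    show "ideal J R" "carrier R \<noteq> J" using J(1) unfolding F_def by auto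
    show "K = J \<or> K = carrier R" if "ideal K R" "J \<subseteq> K" "K \<subseteq> carrier R" for K
      using J(2)[of K] J(1) that unfolding F_def by auto
  qed
  then show ?thesis using unique_maximal J(1) unfolding F_def by blast
qed

lemma one_notin_mm: "\<one> \<notin> \<mm>"
  using prime_Compl_one[OF mm_prime] by blast

text \<open>Elements outside \<mm> are units; cancelling them modulo an ideal is the form used when
  working modulo \<open>I\<close>.\<close>

lemma unit_cancel:
  assumes "s \<in> carrier R - \<mm>" "a \<in> carrier R" "ideal I R" "s \<otimes> a \<in> I" shows "a \<in> I"
proof -
  have s: "s \<in> carrier R" "s \<notin> \<mm>" using assms by auto
  have "PIdl s = carrier R"
    using proper_ideal_le_mm[OF cgenideal_ideal[OF s(1)]] cgenideal_self[OF s(1)] s(2) by blast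
  then have "\<one> \<in> PIdl s" by simp
  then obtain t where t: "t \<in> carrier R" "\<one> = t \<otimes> s" unfolding cgenideal_def by blast
  have "a = t \<otimes> (s \<otimes> a)" using m_assoc[OF t(1) s(1) assms(2)] t(2)[symmetric] assms(2) by simp
  then show ?thesis using ideal.I_l_closed[OF assms(3,4) t(1)] by simp
qed

lemma sat_ideal_mm: "ideal I R \<Longrightarrow> sat_ideal R \<mm> I"
  unfolding sat_ideal_def using unit_cancel by blast

lemma one_minus_notin_mm: "r \<in> \<mm> \<Longrightarrow> \<one> \<ominus> r \<in> carrier R - \<mm>"
proof -
  assume r: "r \<in> \<mm>"
  have rc: "r \<in> carrier R" using r ideal.Icarr[OF mm_ideal] by blast
  have "(\<one> \<ominus> r) \<oplus> r = \<one>" using rc by algebra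
  then show ?thesis using ideal_add_closed[OF mm_ideal _ r, of "\<one> \<ominus> r"] one_notin_mm rc by auto
qed

lemma pchain_raise_mm:
  assumes "pchain R n P Q" shows "\<exists>P'. pchain R n P' \<mm> \<and> P \<subseteq> P'"
proof -
  have Q: "Q \<subseteq> \<mm>" "P \<subseteq> Q" using pchain_prime[OF assms] primeideal.I_notcarr[of Q R]
      proper_ideal_le_mm[of Q] primeideal.axioms(1)[of Q R] by auto
  show ?thesis
  proof (cases "n = 0")
    case True then show ?thesis using Q mm_prime by auto
  next
    case False then show ?thesis using pchain_raise_top[OF assms Q(1) mm_prime] by blast
  qed
qed

lemma Idl_adj:
  assumes "ideal I R" "A \<subseteq> carrier R" "x \<in> carrier R"
  shows "Idl (adj_ideal R I x \<union> A) = Idl (I \<union> insert x A)"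
proof
  note a = adj_ideal_ideal[OF assms(1,3)] adj_ideal_superset[OF assms(1,3)] adj_ideal_self[OF assms(1,3)]
  have c: "I \<union> insert x A \<subseteq> carrier R" "adj_ideal R I x \<union> A \<subseteq> carrier R"
    using assms ideal_subset_carrier a(1) by blast+
  note s = genideal_ideal[OF c(1)] genideal_self[OF c(1)] genideal_ideal[OF c(2)] genideal_self[OF c(2)]
  have "adj_ideal R I x \<subseteq> Idl (I \<union> insert x A)" using s by (intro adj_ideal_minimal) auto
  then show "Idl (adj_ideal R I x \<union> A) \<subseteq> Idl (I \<union> insert x A)"
    using s(2) by (intro genideal_minimal s(1)) auto
  show "Idl (I \<union> insert x A) \<subseteq> Idl (adj_ideal R I x \<union> A)"
    using s(4) a by (intro genideal_minimal s(3)) auto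
qed

lemma Idl_ideal: "ideal I R \<Longrightarrow> Idl I = I"
  by (meson genideal_minimal genideal_self ideal_subset_carrier order_refl subset_antisym)

text \<open>Krull's height bound. Moving a generator into \<open>I\<close> shortens the chain by one
  step through \<open>pchain_shift\<close>; with no generator left, \<open>I\<close> is \<mm> and
  the chain is trivial.\<close>

lemma chain_length_le_gens:
  assumes "finite A" "ideal I R" "A \<subseteq> carrier R" "Idl (I \<union> A) = \<mm>" "pchain R k P \<mm>" "I \<subseteq> P"
  shows "k \<le> card A"
  using assms
proof (induction A arbitrary: I k P rule: finite_induct)
  case empty
  then have "I = \<mm>" using Idl_ideal by simp
  then have "P = \<mm>" using empty.prems pchain_prime[of R k P \<mm>] by blast
  then show ?case using empty.prems(4) pchain_prime by (cases k) (auto, blast)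
next
  case (insert x A)
  have x: "x \<in> carrier R" "A \<subseteq> carrier R" using insert.prems by auto
  show ?case
  proof (cases k)
    case (Suc k')
    have "I \<union> insert x A \<subseteq> carrier R" using insert.prems ideal_subset_carrier by blast
    then have "x \<in> \<mm>" using insert.prems(3) genideal_self by blast
    then obtain P' where P': "pchain R k' P' \<mm>" "P \<subset> P'" "x \<in> P'"
      using pchain_shift[of k' P \<mm> x] insert.prems(4) Suc by blast
    have "ideal P' R" using pchain_prime[OF P'(1)] primeideal.axioms(1) by blast
    then have "k' \<le> card A"
      using insert.prems P' x
      by (intro insert.IH[of "adj_ideal R I x" k' P'])
         (auto simp: Idl_adj intro: adj_ideal_ideal dest!: adj_ideal_minimal[of P' I x, THEN subsetD, rotated 3])
    then show ?thesis using Suc insert.hyps by simp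
  qed simp
qed

text \<open>The ring modulo \<open>I\<close> is regular of dimension \<open>card A\<close>, with \<open>A\<close> as a system of parameters.\<close>

definition regular_system :: "'a set \<Rightarrow> 'a set \<Rightarrow> bool" where
  "regular_system I A \<longleftrightarrow> ideal I R \<and> finite A \<and> A \<subseteq> carrier R \<and> Idl (I \<union> A) = \<mm> \<and>
     (\<exists>P. I \<subseteq> P \<and> pchain R (card A) P \<mm>)"

lemma regular_systemD:
  assumes "regular_system I A"
  shows "ideal I R" "finite A" "A \<subseteq> carrier R" "Idl (I \<union> A) = \<mm>"
  using assms unfolding regular_system_def by simp_all

lemma regular_system_mem_mm:
  assumes "regular_system I A" shows "A \<subseteq> \<mm>" "I \<subseteq> \<mm>"
proof -
  have "I \<union> A \<subseteq> carrier R" using assms ideal_subset_carrier unfolding regular_system_def by blast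
  then show "A \<subseteq> \<mm>" "I \<subseteq> \<mm>" using assms genideal_self[of "I \<union> A"] unfolding regular_system_def by auto
qed

text \<open>Pick \<open>x \<in> A - P\<close>. By induction
  both \<open>I + (x)\<close> and \<open>P + (x)\<close> equal the bottom of a chain of length \<open>card A - 1\<close>,
  so \<open>P \<subseteq> I + x P\<close>.\<close>

lemma regular_system_chain_bottom:
  assumes "regular_system I A" "I \<subseteq> P" "pchain R (card A) P \<mm>"
  shows "P = I"
  using assms
proof (induction "card A" arbitrary: A I P)
  case 0
  then have "A = {}" "ideal I R" unfolding regular_system_def by auto
  then show ?case using 0 Idl_ideal[of I] unfolding regular_system_def by simp
next
  case (Suc n)
  have I: "ideal I R" "finite A" "A \<subseteq> carrier R" "Idl (I \<union> A) = \<mm>"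
    using Suc.prems(1) unfolding regular_system_def by auto
  have chain: "pchain R (Suc n) P \<mm>" using Suc.prems(3) Suc.hyps(2) by simp
  have P: "primeideal P R" "ideal P R" using pchain_prime[OF chain] primeideal.axioms(1) by auto
  have "P \<noteq> \<mm>" using chain pchain_prime by (auto, blast)
  moreover have "P \<subseteq> \<mm>" using pchain_prime[OF chain] by blast
  \<comment> \<open>Otherwise \<open>P\<close> would contain the generators of \<mm> and hence equal
    it, although a chain of positive length leads from \<open>P\<close> to \<mm>.\<close>
  ultimately have "\<not> A \<subseteq> P" using I(4) genideal_minimal[of P "I \<union> A"] P Suc.prems(2) by blast
  then obtain x where x: "x \<in> A" "x \<notin> P" by blast
  have xc: "x \<in> carrier R" "x \<in> \<mm>" using x I(3) regular_system_mem_mm[OF Suc.prems(1)] by auto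
  then obtain P' where P': "pchain R n P' \<mm>" "P \<subset> P'" "x \<in> P'" using pchain_shift[OF chain] by blast
  have P'i: "ideal P' R" using pchain_prime[OF P'(1)] primeideal.axioms(1) by blast
  let ?A = "A - {x}"
  have cA: "card ?A = n" using x(1) I(2) Suc.hyps(2) by simp
  have ins: "insert x ?A = A" using x(1) by blast
  have eq: "P' = adj_ideal R K x" if K: "ideal K R" "I \<subseteq> K" "K \<subseteq> P" for K
  proof (rule Suc.hyps(1))
    have sub: "adj_ideal R K x \<subseteq> P'" using K P' by (intro adj_ideal_minimal P'i) auto
    show "n = card ?A" using cA by simp
    show "adj_ideal R K x \<subseteq> P'" by (rule sub)
    show "pchain R (card ?A) P' \<mm>" using cA P' by simp
    have "Idl (K \<union> A) = \<mm>"
    proof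
      have "K \<subseteq> \<mm>" using K(3) \<open>P \<subseteq> \<mm>\<close> by blast
      then show "Idl (K \<union> A) \<subseteq> \<mm>" using regular_system_mem_mm(1)[OF Suc.prems(1)]
        by (intro genideal_minimal mm_ideal) auto
      show "\<mm> \<subseteq> Idl (K \<union> A)" unfolding I(4)[symmetric]
        using K I(3) ideal_subset_carrier[OF K(1)] by (intro subset_Idl_subset) auto
    qed
    then have "Idl (adj_ideal R K x \<union> ?A) = \<mm>" using Idl_adj[OF K(1) _ xc(1), of ?A] I(3) unfolding ins by auto
    then show "regular_system (adj_ideal R K x) ?A"
      unfolding regular_system_def using I sub P'(1) cA adj_ideal_ideal[OF K(1) xc(1)] by auto
  qed
  have "P \<subseteq> adj_ideal R I x" using eq[OF I(1)] P'(2) Suc.prems(2) by blast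
  have "P \<subseteq> I"
  proof (rule nakayama[OF mm_prime])
    show "sat_ideal R \<mm> I" by (rule sat_ideal_mm[OF I(1)])
    show "P \<subseteq> carrier R" by (rule ideal_subset_carrier[OF P(2)])
    fix N assume N: "sat_ideal R \<mm> N" "I \<subseteq> N" "\<And>q g. q \<in> \<mm> \<Longrightarrow> g \<in> P \<Longrightarrow> q \<otimes> g \<in> N"
    have Ni: "ideal N R" using N unfolding sat_ideal_def by blast
    show "P \<subseteq> N"
    proof
      fix a assume a: "a \<in> P"
      then have "a \<in> adj_ideal R I x" using \<open>P \<subseteq> adj_ideal R I x\<close> by blast
      then obtain i b where ib: "i \<in> I" "b \<in> carrier R" "a = i \<oplus> b \<otimes> x"
        unfolding adj_ideal_iff by blast
      have ic: "i \<in> carrier R" using ideal.Icarr[OF I(1) ib(1)] .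
      have "b \<otimes> x = a \<ominus> i" unfolding ib(3) using ic ib(2) xc(1) by algebra
      also have "\<dots> \<in> P" using a ib(1) Suc.prems(2) by (intro ideal_minus_closed P) auto
      finally have "b \<in> P" using primeideal.I_prime[OF P(1) ib(2) xc(1)] x(2) by blast
      then have "b \<otimes> x \<in> N" using N(3)[OF xc(2), of b] m_comm[OF ib(2) xc(1)] by simp
      then show "a \<in> N" unfolding ib(3) using ib(1) N(2) by (intro ideal_add_closed Ni) auto
    qed
  qed
  then show ?case using Suc.prems(2) by blast
qed

lemma regular_system_chain: "regular_system I A \<Longrightarrow> pchain R (card A) I \<mm>"
  using regular_system_chain_bottom unfolding regular_system_def by blast

text \<open>A regular local ring, here the quotient by \<open>I\<close>, is a domain:
  \<open>I\<close> is itself the bottom of a chain of primes.\<close>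

lemma regular_system_prime: "regular_system I A \<Longrightarrow> primeideal I R"
  using regular_system_chain pchain_prime by blast

text \<open>Passing to the quotient by a parameter leaves one generator less and, by
  \<open>pchain_shift\<close>, a chain that is one step shorter.\<close>

lemma regular_system_adj:
  assumes "regular_system I (insert y A)" "y \<notin> A"
  shows "regular_system (adj_ideal R I y) A"
proof -
  have I: "ideal I R" "finite A" "A \<subseteq> carrier R" "y \<in> carrier R" "Idl (I \<union> insert y A) = \<mm>"
    using assms(1) unfolding regular_system_def by auto
  have ym: "y \<in> \<mm>" using regular_system_mem_mm[OF assms(1)] by blast
  have "pchain R (Suc (card A)) I \<mm>" using regular_system_chain[OF assms(1)] assms(2) I(2) by simp
  from pchain_shift[OF this ym]
  obtain P' where P': "pchain R (card A) P' \<mm>" "I \<subset> P'" "y \<in> P'" by blast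
  have "ideal P' R" using pchain_prime[OF P'(1)] primeideal.axioms(1) by blast
  then have "adj_ideal R I y \<subseteq> P'" using P' by (intro adj_ideal_minimal) auto
  then show ?thesis unfolding regular_system_def
    using I P'(1) adj_ideal_ideal[OF I(1,4)] Idl_adj[OF I(1,3,4)] by auto
qed

lemma regular_system_card_le:
  assumes "regular_system I A" "finite B" "B \<subseteq> carrier R" "Idl (I \<union> B) = \<mm>"
  shows "card A \<le> card B"
proof -
  from chain_length_le_gens[OF assms(2) regular_systemD(1)[OF assms(1)] assms(3,4)
      regular_system_chain[OF assms(1)]]
  show ?thesis by simp
qed

text \<open>A parameter in \<open>I\<close> could be dropped from the generators, leaving fewer of
  them than the chain has steps.\<close>

lemma regular_system_notin:
  assumes "regular_system I (insert y A)" "y \<notin> A" shows "y \<notin> I"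
proof
  assume y: "y \<in> I"
  note I = regular_systemD[OF assms(1)]
  have fin: "finite A" "A \<subseteq> carrier R" using I(2,3) by simp_all
  have "I \<union> insert y A = I \<union> A" using y by blast
  then have "Idl (I \<union> A) = \<mm>" using I(4) by (simp only:)
  from regular_system_card_le[OF assms(1) fin this] show False using fin(1) assms(2) by simp
qed

text \<open>Steinitz exchange. \<open>y\<close> can replace \<open>x\<close> among the generators,
  and as no generating set has fewer than \<open>card (insert x A)\<close> elements,
  \<open>y\<close> is not already in \<open>A\<close>.\<close>

lemma regular_system_exchange:
  assumes "regular_system I (insert x A)" "x \<notin> A" "y \<in> \<mm>" "x \<in> Idl (I \<union> insert y A)"
  shows "regular_system I (insert y A)" "y \<notin> A"
proof -
  have I: "ideal I R" "finite A" "A \<subseteq> carrier R" "x \<in> carrier R" "Idl (I \<union> insert x A) = \<mm>"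
    using assms(1) unfolding regular_system_def by auto
  have yc: "y \<in> carrier R" using assms(3) ideal.Icarr[OF mm_ideal] by blast
  have c: "I \<union> insert y A \<subseteq> carrier R" using I yc ideal_subset_carrier by blast
  have gen: "Idl (I \<union> insert y A) = \<mm>"
  proof
    show "Idl (I \<union> insert y A) \<subseteq> \<mm>"
      using regular_system_mem_mm[OF assms(1)] assms(3) by (intro genideal_minimal mm_ideal) auto
    show "\<mm> \<subseteq> Idl (I \<union> insert y A)" unfolding I(5)[symmetric]
      using assms(4) genideal_self[OF c] by (intro genideal_minimal genideal_ideal c) auto
  qed
  have "card (insert x A) \<le> card (insert y A)"
    using regular_system_card_le[OF assms(1)] gen I c by auto
  then show "y \<notin> A" using assms(2) I(2) by (auto simp: insert_absorb)
  then have "card (insert y A) = card (insert x A)" using assms(2) I(2) by simp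
  then show "regular_system I (insert y A)"
    unfolding regular_system_def using I gen c regular_system_chain[OF assms(1)] by auto
qed

text \<open>With \<open>y\<close> of the form \<open>x1 - x2^k\<close>: these elements generate distinct primes modulo \<open>I\<close>. If all of
  these primes contained \<open>f\<close>, dividing \<open>f\<close> successively by the \<open>x1 - x2^k\<close> would give a strictly
  ascending chain of ideals.\<close>

lemma regular_system_cut:
  assumes A: "regular_system I A" "card A \<ge> 2" and f: "f \<in> \<mm>" "f \<notin> I"
  shows "\<exists>y B. regular_system I (insert y B) \<and> y \<notin> B \<and> card (insert y B) = card A \<and>
    f \<notin> adj_ideal R I y"
proof -
  have I: "ideal I R" "finite A" "A \<subseteq> carrier R" using A(1) unfolding regular_system_def by auto
  have fc: "f \<in> carrier R" using f ideal.Icarr[OF mm_ideal] by blast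
  have "A \<noteq> {}" using A(2) by auto
  then obtain x1 A1 where x1: "A = insert x1 A1" "x1 \<notin> A1" by (meson mk_disjoint_insert ex_in_conv)
  then have "A1 \<noteq> {}" using A(2) by auto
  then obtain x2 B where x2: "A1 = insert x2 B" "x2 \<notin> B" by (meson mk_disjoint_insert ex_in_conv)
  have xc: "x1 \<in> carrier R" "x2 \<in> carrier R" "B \<subseteq> carrier R" using I(3) x1 x2 by auto
  have xm: "x1 \<in> \<mm>" "x2 \<in> \<mm>" using regular_system_mem_mm[OF A(1)] x1 x2 by auto
  \<comment> \<open>The exponent is \<open>Suc k\<close> so that the power lies in \<mm> for every
    \<open>k\<close>.\<close>
  define y where "y k = x1 \<ominus> x2 [^] Suc k" for k
  have pw: "x2 [^] Suc k \<in> \<mm>" for k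
    using ideal.I_l_closed[OF mm_ideal xm(2), of "x2 [^] k"] xc by (simp add: nat_pow_Suc)
  have ym: "y k \<in> \<mm>" for k unfolding y_def using xm(1) pw by (intro ideal_minus_closed mm_ideal)
  have yc: "y k \<in> carrier R" for k using ym ideal.Icarr[OF mm_ideal] by blast
  have ex: "regular_system I (insert (y k) A1)" "y k \<notin> A1" for k
  proof -
    have c: "I \<union> insert (y k) A1 \<subseteq> carrier R"
      using yc[of k] I(3) x1(1) ideal_subset_carrier[OF I(1)] by simp
    note g = genideal_ideal[OF c] genideal_self[OF c]
    \<comment> \<open>\<open>x1\<close> is recovered from \<open>y k\<close> and \<open>x2\<close>,
      so \<open>y k\<close> may be exchanged for it.\<close>
    have "x2 \<in> Idl (I \<union> insert (y k) A1)" using g(2) x2 by blast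
    then have "x2 [^] k \<otimes> x2 \<in> Idl (I \<union> insert (y k) A1)"
      using xc by (intro ideal.I_l_closed[OF g(1)]) auto
    moreover have "y k \<in> Idl (I \<union> insert (y k) A1)" using g(2) by blast
    ultimately have "y k \<oplus> x2 [^] k \<otimes> x2 \<in> Idl (I \<union> insert (y k) A1)"
      by (intro ideal_add_closed g(1))
    moreover have "y k \<oplus> x2 [^] k \<otimes> x2 = x1"
    proof -
      have "x2 [^] k \<otimes> x2 \<in> carrier R" using xc by simp
      then show ?thesis unfolding y_def nat_pow_Suc using xc(1) by algebra
    qed
    ultimately have "x1 \<in> Idl (I \<union> insert (y k) A1)" by simp
    then show "regular_system I (insert (y k) A1)" "y k \<notin> A1"
      using regular_system_exchange[OF A(1)[unfolded x1(1)] x1(2) ym] by auto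
  qed
  have card: "card (insert (y k) A1) = card A" for k using ex(2) x1 I(2) by simp
  let ?P = "\<lambda>k. adj_ideal R I (y k)"
  have Ps: "regular_system (?P k) A1" for k by (rule regular_system_adj[OF ex])
  have Pp: "primeideal (?P k) R" "ideal (?P k) R" for k
    using regular_system_prime[OF Ps] primeideal.axioms(1) by auto
  have x2P: "x2 \<notin> ?P k" for k using regular_system_notin[of "?P k" x2 B] Ps x2 by auto
  have powP: "x2 [^] j \<notin> ?P k" for j k :: nat
  proof (induction j)
    case 0 show ?case using prime_Compl_one[OF Pp(1)] by simp
  next
    case (Suc j) then show ?case
      using primeideal.I_prime[OF Pp(1)[of k], of "x2 [^] j" x2] x2P xc by auto
  qed
  \<comment> \<open>The difference of two of these elements is a unit times a power of
    \<open>x2\<close>, and \<open>x2\<close> lies in none of the primes.\<close>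
  have yP: "y k \<notin> ?P b" if kb: "k < b" for k b
  proof
    assume "y k \<in> ?P b"
    moreover have "y b \<in> ?P b" by (rule adj_ideal_self[OF I(1) yc])
    ultimately have m: "y b \<ominus> y k \<in> ?P b" by (intro ideal_minus_closed Pp)
    obtain e where e: "b = k + Suc e" using kb less_iff_Suc_add by auto
    have "Suc b = Suc k + Suc e" using e by simp
    then have pb: "x2 [^] Suc b = x2 [^] Suc k \<otimes> x2 [^] Suc e"
      using nat_pow_mult[OF xc(2), of "Suc k" "Suc e"] by simp
    have "y b \<ominus> y k = (\<one> \<ominus> x2 [^] Suc e) \<otimes> x2 [^] Suc k"
    proof -
      have "x2 [^] Suc k \<in> carrier R" "x2 [^] Suc e \<in> carrier R" using xc by auto
      then show ?thesis unfolding y_def pb using xc(1) by algebra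
    qed
    then have "x2 [^] Suc k \<in> ?P b"
      using m unit_cancel[OF one_minus_notin_mm[OF pw[of e]] _ Pp(2)[of b]] xc by auto
    then show False using powP by blast
  qed
  show ?thesis
  proof (rule ccontr)
    assume no: "\<not> ?thesis"
    have fP: "f \<in> ?P k" for k using no ex[of k] card[of k] by blast
    \<comment> \<open>What remains of \<open>f\<close> after division by the first \<open>n\<close>
      elements \<open>y k\<close>: nonzero modulo \<open>I\<close>, and still in all the later
      primes.\<close>
    define good where "good n g \<longleftrightarrow> g \<in> carrier R \<and> g \<notin> I \<and> (\<forall>b\<ge>n. g \<in> ?P b)" for n :: nat and g
    have "good 0 f" unfolding good_def using fc f fP by blast
    moreover have "\<exists>h. good (Suc n) h \<and> (\<exists>i\<in>I. g = i \<oplus> h \<otimes> y n)" if g: "good n g" for n g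
    proof -
      have "g \<in> ?P n" using g unfolding good_def by blast
      then obtain i h where ih: "i \<in> I" "h \<in> carrier R" "g = i \<oplus> h \<otimes> y n"
        unfolding adj_ideal_iff by blast
      have ic: "i \<in> carrier R" using ideal.Icarr[OF I(1) ih(1)] .
      have "h \<notin> I"
      proof
        assume "h \<in> I"
        then have "h \<otimes> y n \<in> I" using ideal.I_r_closed[OF I(1)] yc by blast
        then have "g \<in> I" unfolding ih(3) using ih(1) by (intro ideal_add_closed I)
        then show False using g unfolding good_def by blast
      qed
      moreover have "h \<in> ?P b" if b: "b \<ge> Suc n" for b
      proof -
        have "h \<otimes> y n = g \<ominus> i" unfolding ih(3) using ic ih(2) yc[of n] by algebra
        also have "\<dots> \<in> ?P b"
          using g b ih(1) adj_ideal_superset[OF I(1) yc] unfolding good_def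
          by (intro ideal_minus_closed Pp) auto
        finally show ?thesis using primeideal.I_prime[OF Pp(1) ih(2) yc] yP[of n b] b by auto
      qed
      ultimately show ?thesis unfolding good_def using ih by blast
    qed
    ultimately obtain g where g: "\<And>n. good n (g n)" "\<And>n. \<exists>i\<in>I. g n = i \<oplus> g (Suc n) \<otimes> y n"
      using dependent_nat_choice[of good "\<lambda>n g h. \<exists>i\<in>I. g = i \<oplus> h \<otimes> y n"] by metis
    have gc: "g n \<in> carrier R" "g n \<notin> I" for n using g(1) unfolding good_def by auto
    note ga = adj_ideal_ideal[OF I(1) gc(1)] adj_ideal_superset[OF I(1) gc(1)] adj_ideal_self[OF I(1) gc(1)]
    \<comment> \<open>As \<open>g n\<close> lies in I + (g (n+1)), these ideals ascend and become
      stationary. Then g (n+1) is, modulo \<open>I\<close>, a multiple of itself by an element of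
      \<mm>, and so it vanishes there.\<close>
    let ?F = "range (\<lambda>n. adj_ideal R I (g n))"
    have F: "adj_ideal R I (g 0) \<in> ?F" "\<And>K. K \<in> ?F \<Longrightarrow> ideal K R" using ga(1) by auto
    obtain M where M: "M \<in> ?F" "\<And>K. K \<in> ?F \<Longrightarrow> M \<subseteq> K \<Longrightarrow> K = M"
      using maximal_in_family[OF F] by metis
    obtain n where n: "M = adj_ideal R I (g n)" using M(1) by blast
    obtain i where i: "i \<in> I" "g n = i \<oplus> g (Suc n) \<otimes> y n" using g(2) by blast
    have ic: "i \<in> carrier R" using ideal.Icarr[OF I(1) i(1)] .
    have "g n \<in> adj_ideal R I (g (Suc n))"
      unfolding adj_ideal_iff using i(1) m_comm[OF gc(1)[of "Suc n"] yc[of n]] i(2) yc by metis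
    then have "M \<subseteq> adj_ideal R I (g (Suc n))" unfolding n using ga(2) by (intro adj_ideal_minimal ga(1))
    then have "g (Suc n) \<in> adj_ideal R I (g n)" using M(2) ga(3)[of "Suc n"] n by blast
    then obtain j r where j: "j \<in> I" "r \<in> carrier R" "g (Suc n) = j \<oplus> r \<otimes> g n"
      unfolding adj_ideal_iff by blast
    have jc: "j \<in> carrier R" using ideal.Icarr[OF I(1) j(1)] .
    have "g (Suc n) = j \<oplus> r \<otimes> (i \<oplus> g (Suc n) \<otimes> y n)" using j(3) unfolding i(2) .
    moreover have "j \<oplus> r \<otimes> (i \<oplus> g (Suc n) \<otimes> y n) = j \<oplus> r \<otimes> i \<oplus> (r \<otimes> y n) \<otimes> g (Suc n)"
      using jc ic j(2) yc[of n] gc(1)[of "Suc n"] by algebra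
    ultimately have "g (Suc n) = j \<oplus> r \<otimes> i \<oplus> (r \<otimes> y n) \<otimes> g (Suc n)" by (rule trans)
    then have "(\<one> \<ominus> r \<otimes> y n) \<otimes> g (Suc n) = j \<oplus> r \<otimes> i"
    proof -
      assume a: "g (Suc n) = j \<oplus> r \<otimes> i \<oplus> (r \<otimes> y n) \<otimes> g (Suc n)"
      have "(\<one> \<ominus> r \<otimes> y n) \<otimes> g (Suc n) = g (Suc n) \<ominus> (r \<otimes> y n) \<otimes> g (Suc n)"
        using j(2) yc[of n] gc(1)[of "Suc n"] by algebra
      also have "\<dots> = (j \<oplus> r \<otimes> i \<oplus> (r \<otimes> y n) \<otimes> g (Suc n)) \<ominus> (r \<otimes> y n) \<otimes> g (Suc n)"
        using a by simp
      also have "\<dots> = j \<oplus> r \<otimes> i" using jc ic j(2) yc[of n] gc(1)[of "Suc n"] by algebra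
      finally show ?thesis .
    qed
    also have "\<dots> \<in> I" using i(1) j(1,2) by (intro ideal_add_closed I ideal.I_l_closed[OF I(1)])
    finally have "g (Suc n) \<in> I"
      using unit_cancel[OF one_minus_notin_mm[of "r \<otimes> y n"] gc(1) I(1)]
        ideal.I_l_closed[OF mm_ideal ym j(2)] by blast
    then show False using gc(2) by blast
  qed
qed

end

text \<open>Regular sequences on the quotient by \<open>I\<close>, expressed in the ring itself. The
  recursion only changes \<open>I\<close>; the base case demands that the final quotient be
  nonzero.\<close>

primrec reg_mod :: "('a, 'b) ring_scheme \<Rightarrow> 'a set \<Rightarrow> 'a list \<Rightarrow> bool" where
  "reg_mod R I [] \<longleftrightarrow> I \<noteq> carrier R"
| "reg_mod R I (y # ys) \<longleftrightarrow> y \<in> carrier R \<and> (\<forall>b \<in> carrier R. y \<otimes>\<^bsub>R\<^esub> b \<in> I \<longrightarrow> b \<in> I) \<and>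
     reg_mod R (adj_ideal R I y) ys"

text \<open>The parameter \<open>y\<close> given by \<open>regular_system_cut\<close> is a
  nonzerodivisor modulo I + (f): if y b = i + g f, then g f lies in the prime I + (y), which does
  not contain f, so g = j + h y; now y (b - h f) lies in the prime \<open>I\<close>, and b lies in I
  + (f). Each step uses up one parameter; the last one is spent on \<open>f\<close>.\<close>

lemma (in local_noetherian_cring) regular_system_depth:
  assumes "regular_system I A" "f \<in> \<mm>" "f \<notin> I"
  shows "\<exists>ys. Suc (length ys) = card A \<and> reg_mod R (adj_ideal R I f) ys"
  using assms
proof (induction "card A" arbitrary: A I)
  case 0
  then have "A = {}" "ideal I R" unfolding regular_system_def by auto
  then show ?case using 0 Idl_ideal[of I] unfolding regular_system_def by simp
next
  case (Suc n)
  have I: "ideal I R" "finite A" "A \<subseteq> carrier R" using Suc.prems(1) unfolding regular_system_def by auto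
  have Im: "I \<subseteq> \<mm>" by (rule regular_system_mem_mm(2)[OF Suc.prems(1)])
  have fc: "f \<in> carrier R" using Suc.prems(2) ideal.Icarr[OF mm_ideal] by blast
  show ?case
  proof (cases "n = 0")
    \<comment> \<open>\<open>regular_system_cut\<close> starts from two parameters; with a single
      one the empty sequence has the required length.\<close>
    case True
    have "adj_ideal R I f \<subseteq> \<mm>" using Im Suc.prems(2) by (intro adj_ideal_minimal mm_ideal)
    then have "reg_mod R (adj_ideal R I f) []" using one_notin_mm by auto
    then show ?thesis using True Suc.hyps(2) by (intro exI[of _ "[]"]) simp
  next
    case False
    then have "card A \<ge> 2" using Suc.hyps(2) by simp
    then obtain y B where y: "regular_system I (insert y B)" "y \<notin> B" "card (insert y B) = card A"
        "f \<notin> adj_ideal R I y" using regular_system_cut[OF Suc.prems(1) _ Suc.prems(2,3)] by blast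
    have yc: "y \<in> carrier R" and fB: "finite B" using y(1) unfolding regular_system_def by auto
    have cB: "card B = n" using y(2,3) fB Suc.hyps(2) by simp
    have P: "regular_system (adj_ideal R I y) B" by (rule regular_system_adj[OF y(1,2)])
    then obtain ys where ys: "Suc (length ys) = card B" "reg_mod R (adj_ideal R (adj_ideal R I y) f) ys"
      using Suc.hyps(1)[of B "adj_ideal R I y"] cB Suc.prems(2) y(4) by blast
    have "b \<in> adj_ideal R I f" if b: "b \<in> carrier R" "y \<otimes> b \<in> adj_ideal R I f" for b
    proof -
      obtain i g where ig: "i \<in> I" "g \<in> carrier R" "y \<otimes> b = i \<oplus> g \<otimes> f"
        using b(2) unfolding adj_ideal_iff by blast
      have ic: "i \<in> carrier R" using ideal.Icarr[OF I(1) ig(1)] .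
      have yP: "y \<in> adj_ideal R I y" "I \<subseteq> adj_ideal R I y" "ideal (adj_ideal R I y) R"
        using adj_ideal_self[OF I(1) yc] adj_ideal_superset[OF I(1) yc] adj_ideal_ideal[OF I(1) yc] by auto
      have "g \<otimes> f = y \<otimes> b \<ominus> i" unfolding ig(3) using ic ig(2) fc by algebra
      also have "\<dots> \<in> adj_ideal R I y"
        using yP ig(1) b(1) ideal.I_r_closed[OF yP(3,1) b(1)] by (intro ideal_minus_closed) auto
      finally have "g \<in> adj_ideal R I y"
        using primeideal.I_prime[OF regular_system_prime[OF P] ig(2) fc] y(4) by blast
      then obtain j h where jh: "j \<in> I" "h \<in> carrier R" "g = j \<oplus> h \<otimes> y"
        unfolding adj_ideal_iff by blast
      have jc: "j \<in> carrier R" using ideal.Icarr[OF I(1) jh(1)] .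
      have "y \<otimes> (b \<ominus> h \<otimes> f) = y \<otimes> b \<ominus> y \<otimes> (h \<otimes> f)"
        using yc b(1) jh(2) fc by algebra
      also have "\<dots> = i \<oplus> f \<otimes> j" unfolding ig(3) jh(3) using ic jc jh(2) yc fc by algebra
      also have "\<dots> \<in> I" using ig(1) jh(1) fc by (intro ideal_add_closed I ideal.I_l_closed[OF I(1)])
      finally have "b \<ominus> h \<otimes> f \<in> I"
        using primeideal.I_prime[OF regular_system_prime[OF y(1)] yc, of "b \<ominus> h \<otimes> f"]
          regular_system_notin[OF y(1,2)] b(1) jh(2) fc by simp
      moreover have "b = (b \<ominus> h \<otimes> f) \<oplus> h \<otimes> f" using b(1) jh(2) fc by algebra
      ultimately show ?thesis unfolding adj_ideal_iff using jh(2) by blast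
    qed
    then have "reg_mod R (adj_ideal R I f) (y # ys)"
      using ys(2) yc adj_ideal_commute[OF I(1) yc fc] by simp
    moreover have "Suc (length (y # ys)) = card A" using ys(1) cB Suc.hyps(2) by simp
    ultimately show ?thesis by blast
  qed
qed

section \<open>Dimension and depth\<close>

text \<open>An ideal that is maximal among those containing \<open>I\<close> and avoiding the
  multiplicative set \<open>U\<close> is prime.\<close>

lemma (in noetherian_cring) prime_disjoint_from:
  assumes I: "ideal I R" and U: "\<one> \<in> U" "U \<subseteq> carrier R" "\<And>u v. u \<in> U \<Longrightarrow> v \<in> U \<Longrightarrow> u \<otimes> v \<in> U"
    and IU: "I \<inter> U = {}"
  shows "\<exists>Q. primeideal Q R \<and> I \<subseteq> Q \<and> Q \<inter> U = {}"
proof -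
  define F where "F = {J. ideal J R \<and> I \<subseteq> J \<and> J \<inter> U = {}}"
  have F: "I \<in> F" "\<And>J. J \<in> F \<Longrightarrow> ideal J R" unfolding F_def using I IU by auto
  obtain M where M: "M \<in> F" "\<And>K. K \<in> F \<Longrightarrow> M \<subseteq> K \<Longrightarrow> K = M" using maximal_in_family[OF F] by metis
  have Mi: "ideal M R" "I \<subseteq> M" "M \<inter> U = {}" using M(1) unfolding F_def by auto
  have meets: "\<exists>m\<in>M. \<exists>r\<in>carrier R. m \<oplus> r \<otimes> a \<in> U" if a: "a \<in> carrier R" "a \<notin> M" for a
  proof (rule ccontr)
    assume "\<not> ?thesis"
    then have "adj_ideal R M a \<inter> U = {}" by (auto simp: adj_ideal_iff)
    then have "adj_ideal R M a \<in> F" unfolding F_def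
      using adj_ideal_ideal[OF Mi(1) a(1)] adj_ideal_superset[OF Mi(1) a(1)] Mi(2) by auto
    then show False using M(2) adj_ideal_superset[OF Mi(1) a(1)] adj_ideal_self[OF Mi(1) a(1)] a(2) by blast
  qed
  have "primeideal M R"
  proof (rule primeidealI[OF Mi(1) is_cring])
    show "carrier R \<noteq> M" using U(1,2) Mi(3) by blast
    fix a b assume ab: "a \<in> carrier R" "b \<in> carrier R" "a \<otimes> b \<in> M"
    show "a \<in> M \<or> b \<in> M"
    proof (rule ccontr)
      assume "\<not> (a \<in> M \<or> b \<in> M)"
      then obtain m r n s where m: "m \<in> M" "r \<in> carrier R" "m \<oplus> r \<otimes> a \<in> U"
          and n: "n \<in> M" "s \<in> carrier R" "n \<oplus> s \<otimes> b \<in> U" using meets[OF ab(1)] meets[OF ab(2)] by blast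
      have c: "m \<in> carrier R" "n \<in> carrier R" using m n ideal.Icarr[OF Mi(1)] by auto
      have "(m \<oplus> r \<otimes> a) \<otimes> (n \<oplus> s \<otimes> b) = (n \<oplus> s \<otimes> b) \<otimes> m \<oplus> ((r \<otimes> a) \<otimes> n \<oplus> (r \<otimes> s) \<otimes> (a \<otimes> b))"
        using c m(2) n(2) ab(1,2) by algebra
      also have "\<dots> \<in> M"
        using c m(2) n(2) ab(1,2)
        by (intro ideal_add_closed[OF Mi(1)] ideal.I_l_closed[OF Mi(1) m(1)]
            ideal.I_l_closed[OF Mi(1) n(1)] ideal.I_l_closed[OF Mi(1) ab(3)])
          (auto intro: m_closed)
      finally show False using U(3)[OF m(3) n(3)] Mi(3) by blast
    qed
  qed
  then show ?thesis using Mi by blast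
qed

text \<open>Depth is at most dimension. If \<open>P\<close> contains I + (y) and \<open>y\<close> is
  a nonzerodivisor modulo \<open>I\<close>, no y^j s with s outside \<open>P\<close> lies in
  \<open>I\<close>; a prime over \<open>I\<close> that avoids all of these lies inside
  \<open>P\<close> and misses \<open>y\<close>, and so extends the chain downwards.\<close>

lemma (in noetherian_cring) pchain_of_reg_mod:
  assumes "ideal I R" "reg_mod R I ys"
  shows "\<exists>P Q. pchain R (length ys) P Q \<and> I \<subseteq> P"
  using assms
proof (induction ys arbitrary: I)
  case Nil
  have "I \<inter> {\<one>} = {}" using Nil ideal.one_imp_carrier by auto
  then obtain Q where "primeideal Q R" "I \<subseteq> Q" using prime_disjoint_from[OF Nil(1), of "{\<one>}"] by auto
  then show ?case by auto
next
  case (Cons y ys)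
  have y: "y \<in> carrier R" "\<And>b. b \<in> carrier R \<Longrightarrow> y \<otimes> b \<in> I \<Longrightarrow> b \<in> I" "reg_mod R (adj_ideal R I y) ys"
    using Cons.prems(2) by auto
  obtain P Q where P: "pchain R (length ys) P Q" "adj_ideal R I y \<subseteq> P"
    using Cons.IH[OF adj_ideal_ideal[OF Cons.prems(1) y(1)] y(3)] by blast
  have Pp: "primeideal P R" using pchain_prime[OF P(1)] by blast
  have yP: "y \<in> P" "I \<subseteq> P"
    using P(2) adj_ideal_self[OF Cons.prems(1) y(1)] adj_ideal_superset[OF Cons.prems(1) y(1)] by blast+
  define U where "U = {u. \<exists>s \<in> carrier R - P. \<exists>j :: nat. u = y [^] j \<otimes> s}"
  have powreg: "y [^] j \<otimes> s \<in> I \<Longrightarrow> s \<in> carrier R \<Longrightarrow> s \<in> I" for j :: nat and s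
  proof (induction j)
    case (Suc j)
    have "y [^] Suc j \<otimes> s = y \<otimes> (y [^] j \<otimes> s)" using y(1) Suc.prems(2) by (simp add: m_ac)
    then have "y [^] j \<otimes> s \<in> I" using Suc.prems y(1) y(2)[of "y [^] j \<otimes> s"] by (metis m_closed nat_pow_closed)
    then show ?case using Suc.IH Suc.prems(2) by blast
  qed simp
  have "\<exists>q. primeideal q R \<and> I \<subseteq> q \<and> q \<inter> U = {}"
  proof (rule prime_disjoint_from[OF Cons.prems(1)])
    show "\<one> \<in> U" unfolding U_def using prime_Compl_one[OF Pp] by (auto intro!: bexI[of _ \<one>] exI[of _ 0])
    show "U \<subseteq> carrier R" unfolding U_def using y(1) by auto
    show "u \<otimes> v \<in> U" if "u \<in> U" "v \<in> U" for u v
    proof -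
      from that obtain s j t k where s: "s \<in> carrier R - P" "u = y [^] (j :: nat) \<otimes> s"
        and t: "t \<in> carrier R - P" "v = y [^] (k :: nat) \<otimes> t" unfolding U_def by blast
      have c: "s \<in> carrier R" "t \<in> carrier R" using s t by auto
      have "y [^] (j + k) = y [^] j \<otimes> y [^] k" using nat_pow_mult[OF y(1)] by simp
      then have "u \<otimes> v = y [^] (j + k) \<otimes> (s \<otimes> t)" using s(2) t(2) c y(1) by (simp add: m_ac)
      then show ?thesis unfolding U_def using prime_Compl_mult[OF Pp s(1) t(1)] by blast
    qed
    show "I \<inter> U = {}" unfolding U_def using powreg yP(2) by blast
  qed
  then obtain q where q: "primeideal q R" "I \<subseteq> q" "q \<inter> U = {}" by blast
  have qc: "q \<subseteq> carrier R" using q(1) primeideal.axioms(1) ideal_subset_carrier by blast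
  have inU: "y [^] (j :: nat) \<otimes> s \<in> U" if "s \<in> carrier R - P" for j s unfolding U_def using that by blast
  have "q \<subseteq> P"
  proof
    fix s assume s: "s \<in> q"
    then have "y [^] (0::nat) \<otimes> s = s" using qc by auto
    then show "s \<in> P" using inU[of s 0] s q(3) qc by auto
  qed
  moreover have "y \<notin> q"
  proof -
    have "y [^] (1::nat) \<otimes> \<one> = y" using y(1) by simp
    then show ?thesis using inU[OF prime_Compl_one[OF Pp], of 1] q(3) by auto
  qed
  ultimately have "pchain R (Suc (length ys)) q Q" using yP q(1) by (intro pchain_Cons[OF P(1)]) auto
  then show ?case using q(2) unfolding length_Cons by blast
qed

section \<open>Krull dimension in terms of chains with given ends\<close>

lemma pchain_iff:
  "pchain R n P Q \<longleftrightarrow> (\<exists>p. p 0 = P \<and> p n = Q \<and> (\<forall>i\<le>n. primeideal (p i) R) \<and> (\<forall>i<n. p i \<subset> p (Suc i)))"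
proof (induction n arbitrary: Q)
  case 0 then show ?case by auto
next
  case (Suc n)
  show ?case
  proof
    assume "pchain R (Suc n) P Q"
    then obtain P' p where p: "p 0 = P" "p n = P'" "\<forall>i\<le>n. primeideal (p i) R" "\<forall>i<n. p i \<subset> p (Suc i)"
        "P' \<subset> Q" "primeideal Q R" unfolding pchain.simps Suc.IH by blast
    show "\<exists>p. p 0 = P \<and> p (Suc n) = Q \<and> (\<forall>i\<le>Suc n. primeideal (p i) R) \<and> (\<forall>i<Suc n. p i \<subset> p (Suc i))"
      by (rule exI[of _ "p(Suc n := Q)"]) (use p in \<open>auto simp: le_Suc_eq less_Suc_eq\<close>)
  next
    assume "\<exists>p. p 0 = P \<and> p (Suc n) = Q \<and> (\<forall>i\<le>Suc n. primeideal (p i) R) \<and> (\<forall>i<Suc n. p i \<subset> p (Suc i))"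
    then obtain p where p: "p 0 = P" "p (Suc n) = Q" "\<forall>i\<le>Suc n. primeideal (p i) R"
      "\<forall>i<Suc n. p i \<subset> p (Suc i)" by blast
    then have "pchain R n P (p n)" unfolding Suc.IH by (intro exI[of _ p]) auto
    moreover have "p n \<subset> Q" "primeideal Q R" using p(2-4) by auto
    ultimately show "pchain R (Suc n) P Q" by (simp only: pchain.simps) blast
  qed
qed

lemma krull_dim_pchain: "krull_dim R = Sup {enat n | n. \<exists>P Q. pchain R n P Q}"
  unfolding krull_dim_def pchain_iff by (intro arg_cong[where f = Sup]) blast

lemma pchain_le_krull_dim: "pchain R n P Q \<Longrightarrow> enat n \<le> krull_dim R"
  unfolding krull_dim_pchain by (intro Sup_upper) blast

text \<open>A finite supremum of natural numbers is attained, provided that there is a chain at all.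
  The prime \<open>P0\<close> guarantees this: the supremum of the empty set is 0 as well.\<close>

lemma krull_dim_attained:
  assumes "krull_dim R = enat d" "primeideal P0 R"
  shows "\<exists>P Q. pchain R d P Q"
proof -
  let ?A = "{enat n | n. \<exists>P Q. pchain R n P Q}"
  have "enat 0 \<in> ?A" using assms(2) by (auto intro!: exI[of _ P0])
  then have ne: "?A \<noteq> {}" by blast
  have eq: "Sup ?A = (if finite ?A then Max ?A else \<infinity>)" using ne by (simp only: Sup_enat_def if_False)
  then have "finite ?A" using assms(1) unfolding krull_dim_pchain by (metis enat.distinct(1))
  then have "Max ?A = enat d" using eq assms(1) unfolding krull_dim_pchain by (simp only: if_True)
  then have "enat d \<in> ?A" using Max_in[OF \<open>finite ?A\<close> ne] by (simp only:)
  then show ?thesis by blast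
qed

section \<open>The ring as a module over itself and its regular sequences\<close>

lemma self_module_simps:
  "carrier (self_module R) = carrier R" "\<zero>\<^bsub>self_module R\<^esub> = \<zero>\<^bsub>R\<^esub>"
  "x \<oplus>\<^bsub>self_module R\<^esub> y = x \<oplus>\<^bsub>R\<^esub> y" "a \<odot>\<^bsub>self_module R\<^esub> x = a \<otimes>\<^bsub>R\<^esub> x"
  "\<ominus>\<^bsub>self_module R\<^esub> x = \<ominus>\<^bsub>R\<^esub> x"
  by (simp_all add: self_module_def a_inv_def m_inv_def)

lemma (in cring) self_module_module: "module R (self_module R)"
proof (rule moduleI)
  show "abelian_group (self_module R)"
    by (rule abelian_groupI) (auto simp: self_module_simps a_ac intro: bexI[of _ "\<ominus> x" for x] l_neg)
qed (auto simp: self_module_simps l_distr r_distr m_assoc is_cring)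

lemma (in cring) submodule_self_iff: "submodule N R (self_module R) \<longleftrightarrow> ideal N R"
proof
  assume N: "submodule N R (self_module R)"
  note E = module.submoduleE[OF self_module_module N, unfolded self_module_simps]
  show "ideal N R"
  proof (rule idealI[OF ring_axioms])
    show "subgroup N (add_monoid R)" using E by (intro add.subgroupI) auto
    show "x \<otimes> a \<in> N" if "a \<in> N" "x \<in> carrier R" for a x by (rule E(4)[OF that(2,1)])
    then show "a \<otimes> x \<in> N" if "a \<in> N" "x \<in> carrier R" for a x
      using that E(1) m_comm[of a x] by auto
  qed
next
  assume N: "ideal N R"
  show "submodule N R (self_module R)"
    using ideal_subset_carrier[OF N] ideal_zero_closed[OF N] ideal_add_closed[OF N] ideal.I_l_closed[OF N]
      additive_subgroup.a_inv_closed[OF ideal.axioms(1)[OF N]]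
    by (intro module.submoduleI[OF self_module_module]) (auto simp: self_module_simps)
qed

lemma (in cring) foldl_adj_ideal:
  assumes "ideal I R" "set ys \<subseteq> carrier R"
  shows "ideal (foldl (adj_ideal R) I ys) R" "I \<subseteq> foldl (adj_ideal R) I ys" "set ys \<subseteq> foldl (adj_ideal R) I ys"
proof -
  have "ideal (foldl (adj_ideal R) I ys) R \<and> I \<subseteq> foldl (adj_ideal R) I ys \<and> set ys \<subseteq> foldl (adj_ideal R) I ys"
    using assms
  proof (induction ys arbitrary: I)
    case (Cons y ys)
    have y: "y \<in> carrier R" using Cons.prems by simp
    show ?case using Cons.IH[OF adj_ideal_ideal[OF Cons.prems(1) y]] Cons.prems(2)
        adj_ideal_self[OF Cons.prems(1) y] adj_ideal_superset[OF Cons.prems(1) y] by auto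
  qed simp
  then show "ideal (foldl (adj_ideal R) I ys) R" "I \<subseteq> foldl (adj_ideal R) I ys"
    "set ys \<subseteq> foldl (adj_ideal R) I ys" by auto
qed

lemma (in cring) foldl_adj_minimal:
  "ideal J R \<Longrightarrow> I \<subseteq> J \<Longrightarrow> set ys \<subseteq> J \<Longrightarrow> foldl (adj_ideal R) I ys \<subseteq> J"
  by (induction ys arbitrary: I) (auto simp: adj_ideal_minimal)

lemma (in cring) ideal_smult_self:
  assumes "set ys \<subseteq> carrier R"
  shows "ideal_smult R (self_module R) (set ys) = foldl (adj_ideal R) {\<zero>} ys" (is "?L = ?F")
proof -
  note f = foldl_adj_ideal[OF zeroideal assms]
  have eq: "?L = \<Inter>{N. ideal N R \<and> {a \<otimes> x |a x. a \<in> set ys \<and> x \<in> carrier R} \<subseteq> N}"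
    unfolding ideal_smult_def gen_submodule_def submodule_self_iff by (simp add: self_module_def)
  have ge: "?F \<subseteq> N" if N: "ideal N R" "{a \<otimes> x |a x. a \<in> set ys \<and> x \<in> carrier R} \<subseteq> N" for N
  proof (rule foldl_adj_minimal[OF N(1)])
    show "{\<zero>} \<subseteq> N" using ideal_zero_closed[OF N(1)] by simp
    show "set ys \<subseteq> N"
    proof
      fix y assume y: "y \<in> set ys"
      then have "y \<otimes> \<one> \<in> N" using N(2) by blast
      then show "y \<in> N" using y assms by auto
    qed
  qed
  have le: "{a \<otimes> x |a x. a \<in> set ys \<and> x \<in> carrier R} \<subseteq> ?F"
    using f(3) ideal.I_r_closed[OF f(1)] by blast
  show ?thesis unfolding eq using ge le f(1) by (intro equalityI Inter_lower Inter_greatest) auto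
qed

lemma (in cring) reg_mod_iff:
  assumes "ideal I R"
  shows "reg_mod R I ys \<longleftrightarrow> set ys \<subseteq> carrier R \<and>
    (\<forall>i < length ys. \<forall>b \<in> carrier R. ys ! i \<otimes> b \<in> foldl (adj_ideal R) I (take i ys) \<longrightarrow>
        b \<in> foldl (adj_ideal R) I (take i ys)) \<and> foldl (adj_ideal R) I ys \<noteq> carrier R"
  using assms
proof (induction ys arbitrary: I)
  case (Cons y ys)
  show ?case
  proof (cases "y \<in> carrier R")
    case True
    show ?thesis unfolding reg_mod.simps Cons.IH[OF adj_ideal_ideal[OF Cons.prems True]]
      using True by (auto simp: All_less_Suc2)
  qed simp
qed simp

text \<open>Connects the regular sequences in the definition of grade with \<open>reg_mod\<close>,
  for which depth and dimension are estimated.\<close>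

lemma (in cring) regular_seq_self_iff:
  "regular_seq R (self_module R) ys \<longleftrightarrow> reg_mod R {\<zero>} ys"
proof (cases "set ys \<subseteq> carrier R")
  case True
  then have "set (take i ys) \<subseteq> carrier R" for i using set_take_subset by fast
  then have "ideal_smult R (self_module R) (set (take i ys)) = foldl (adj_ideal R) {\<zero>} (take i ys)" for i
    by (rule ideal_smult_self)
  moreover have "ideal_smult R (self_module R) (set ys) = foldl (adj_ideal R) {\<zero>} ys"
    using True by (rule ideal_smult_self)
  ultimately show ?thesis
    unfolding regular_seq_def reg_mod_iff[OF zeroideal] using True by (simp add: self_module_def)
next
  case False
  then show ?thesis unfolding regular_seq_def reg_mod_iff[OF zeroideal] by simp
qed

section \<open>Hypersurfaces\<close>

locale surj_cring_hom = S: cring S + R: cring R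
  for S :: "('s, 't) ring_scheme" and R :: "('a, 'r) ring_scheme" +
  fixes h :: "'s \<Rightarrow> 'a"
  assumes hom: "h \<in> ring_hom S R" and surj: "h ` carrier S = carrier R"
begin

abbreviation ker where "ker \<equiv> {s \<in> carrier S. h s = \<zero>\<^bsub>R\<^esub>}"
abbreviation pre where "pre J \<equiv> {s \<in> carrier S. h s \<in> J}"

lemma rhr: "ring_hom_ring S R h"
  using hom by (intro ring_hom_ringI2 S.ring_axioms R.ring_axioms)

lemma h_simps:
  "x \<in> carrier S \<Longrightarrow> h x \<in> carrier R"
  "x \<in> carrier S \<Longrightarrow> y \<in> carrier S \<Longrightarrow> h (x \<oplus>\<^bsub>S\<^esub> y) = h x \<oplus>\<^bsub>R\<^esub> h y"
  "x \<in> carrier S \<Longrightarrow> y \<in> carrier S \<Longrightarrow> h (x \<otimes>\<^bsub>S\<^esub> y) = h x \<otimes>\<^bsub>R\<^esub> h y"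
  "h \<one>\<^bsub>S\<^esub> = \<one>\<^bsub>R\<^esub>" "h \<zero>\<^bsub>S\<^esub> = \<zero>\<^bsub>R\<^esub>"
  "x \<in> carrier S \<Longrightarrow> h (\<ominus>\<^bsub>S\<^esub> x) = \<ominus>\<^bsub>R\<^esub> h x"
  "x \<in> carrier S \<Longrightarrow> y \<in> carrier S \<Longrightarrow> h (x \<ominus>\<^bsub>S\<^esub> y) = h x \<ominus>\<^bsub>R\<^esub> h y"
proof -
  interpret ring_hom_ring S R h by (rule rhr)
  show "x \<in> carrier S \<Longrightarrow> h x \<in> carrier R"
  "x \<in> carrier S \<Longrightarrow> y \<in> carrier S \<Longrightarrow> h (x \<oplus>\<^bsub>S\<^esub> y) = h x \<oplus>\<^bsub>R\<^esub> h y"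
  "x \<in> carrier S \<Longrightarrow> y \<in> carrier S \<Longrightarrow> h (x \<otimes>\<^bsub>S\<^esub> y) = h x \<otimes>\<^bsub>R\<^esub> h y"
  "h \<one>\<^bsub>S\<^esub> = \<one>\<^bsub>R\<^esub>" "h \<zero>\<^bsub>S\<^esub> = \<zero>\<^bsub>R\<^esub>"
  "x \<in> carrier S \<Longrightarrow> h (\<ominus>\<^bsub>S\<^esub> x) = \<ominus>\<^bsub>R\<^esub> h x" by simp_all
  show "x \<in> carrier S \<Longrightarrow> y \<in> carrier S \<Longrightarrow> h (x \<ominus>\<^bsub>S\<^esub> y) = h x \<ominus>\<^bsub>R\<^esub> h y"
    unfolding a_minus_def by simp
qed

lemma lift: "r \<in> carrier R \<Longrightarrow> \<exists>s \<in> carrier S. h s = r"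
  using surj by (metis imageE)

lemma pre_ideal: "ideal J R \<Longrightarrow> ideal (pre J) S"
  using ring_hom_ring.ideal_vimage[OF rhr] by blast

lemma image_pre: "J \<subseteq> carrier R \<Longrightarrow> h ` pre J = J"
  using lift by (auto simp: image_iff)

lemma image_ideal:
  assumes "ideal I S" shows "ideal (h ` I) R"
proof (rule idealI[OF R.ring_axioms])
  show "subgroup (h ` I) (add_monoid R)"
    using ring_hom_ring.img_is_add_subgroup[OF rhr] assms additive_subgroup.a_subgroup ideal.axioms(1) by blast
  show *: "x \<otimes>\<^bsub>R\<^esub> a \<in> h ` I" if "a \<in> h ` I" "x \<in> carrier R" for a x
  proof -
    from that lift obtain i s where "i \<in> I" "a = h i" "s \<in> carrier S" "h s = x" by blast
    moreover have "s \<otimes>\<^bsub>S\<^esub> i \<in> I" by (rule ideal.I_l_closed[OF assms \<open>i \<in> I\<close> \<open>s \<in> carrier S\<close>])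
    moreover have "h (s \<otimes>\<^bsub>S\<^esub> i) = h s \<otimes>\<^bsub>R\<^esub> h i"
      using \<open>i \<in> I\<close> \<open>s \<in> carrier S\<close> ideal.Icarr[OF assms] by (intro h_simps) auto
    ultimately show ?thesis by (metis imageI)
  qed
  show "a \<otimes>\<^bsub>R\<^esub> x \<in> h ` I" if "a \<in> h ` I" "x \<in> carrier R" for a x
  proof -
    have "a \<in> carrier R" using that(1) ideal.Icarr[OF assms] h_simps(1) by blast
    then show ?thesis using *[OF that] R.m_comm[OF _ that(2)] by simp
  qed
qed

lemma pre_image:
  assumes "ideal I S" "ker \<subseteq> I" shows "pre (h ` I) = I"
proof
  show "I \<subseteq> pre (h ` I)" using ideal.Icarr[OF assms(1)] by auto
  show "pre (h ` I) \<subseteq> I"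
  proof
    fix s assume "s \<in> pre (h ` I)"
    then obtain i where s: "s \<in> carrier S" "i \<in> I" "h s = h i" by blast
    have ic: "i \<in> carrier S" using ideal.Icarr[OF assms(1) s(2)] .
    have "h (s \<ominus>\<^bsub>S\<^esub> i) = \<zero>\<^bsub>R\<^esub>" using s ic by (simp add: h_simps)
    then have "s \<ominus>\<^bsub>S\<^esub> i \<in> I" using assms(2) s ic by auto
    then have "(s \<ominus>\<^bsub>S\<^esub> i) \<oplus>\<^bsub>S\<^esub> i \<in> I" by (intro ideal_add_closed[OF assms(1)] s)
    moreover have "(s \<ominus>\<^bsub>S\<^esub> i) \<oplus>\<^bsub>S\<^esub> i = s" using s(1) ic by algebra
    ultimately show "s \<in> I" by simp
  qed
qed

lemma pre_prime:
  assumes "primeideal P R" shows "primeideal (pre P) S"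
proof (rule primeidealI)
  show "ideal (pre P) S" using assms by (intro pre_ideal primeideal.axioms(1))
  show "cring S" by (rule S.is_cring)
  have "\<one>\<^bsub>S\<^esub> \<notin> pre P" using R.prime_Compl_one[OF assms] by (simp add: h_simps)
  then show "carrier S \<noteq> pre P" by blast
  show "a \<in> pre P \<or> b \<in> pre P" if "a \<in> carrier S" "b \<in> carrier S" "a \<otimes>\<^bsub>S\<^esub> b \<in> pre P" for a b
    using that primeideal.I_prime[OF assms, of "h a" "h b"] by (auto simp: h_simps)
qed

lemma image_prime:
  assumes "primeideal P S" "ker \<subseteq> P" shows "primeideal (h ` P) R"
proof (rule primeidealI)
  have Pi: "ideal P S" using assms primeideal.axioms(1) by blast
  show "ideal (h ` P) R" by (rule image_ideal[OF Pi])
  show "cring R" by (rule R.is_cring)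
  note pi = pre_image[OF Pi assms(2)]
  have "\<one>\<^bsub>S\<^esub> \<notin> pre (h ` P)" unfolding pi using S.prime_Compl_one[OF assms(1)] by blast
  then show "carrier R \<noteq> h ` P" using R.one_closed by (auto simp: h_simps)
  fix a b assume ab: "a \<in> carrier R" "b \<in> carrier R" "a \<otimes>\<^bsub>R\<^esub> b \<in> h ` P"
  obtain s t where s: "s \<in> carrier S" "h s = a" and t: "t \<in> carrier S" "h t = b" using lift ab by blast
  have "s \<otimes>\<^bsub>S\<^esub> t \<in> pre (h ` P)" using s t ab by (simp add: h_simps)
  then show "a \<in> h ` P \<or> b \<in> h ` P"
    unfolding pi using primeideal.I_prime[OF assms(1) s(1) t(1)] s t by blast
qed

lemma pre_strict: "J \<subseteq> carrier R \<Longrightarrow> K \<subseteq> carrier R \<Longrightarrow> J \<subset> K \<Longrightarrow> pre J \<subset> pre K"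
proof (rule psubsetI)
  assume J: "J \<subseteq> carrier R" "K \<subseteq> carrier R" "J \<subset> K"
  show "pre J \<subseteq> pre K" using J(3) by auto
  show "pre J \<noteq> pre K" using image_pre[OF J(1)] image_pre[OF J(2)] J(3) by (metis order_less_irrefl)
qed

lemma pre_pchain: "pchain R n P Q \<Longrightarrow> pchain S n (pre P) (pre Q)"
proof (induction n arbitrary: Q)
  case 0 then show ?case using pre_prime by auto
next
  case (Suc n)
  then obtain P' where P': "pchain R n P P'" "P' \<subset> Q" "primeideal Q R" by auto
  have "P' \<subseteq> carrier R" "Q \<subseteq> carrier R"
    using P' pchain_prime[OF P'(1)] primeideal.axioms(1) ideal_subset_carrier by metis+
  then have "pre P' \<subset> pre Q" using P'(2) by (intro pre_strict)
  then show ?case using Suc.IH[OF P'(1)] pre_prime[OF P'(3)] by (metis (no_types, lifting) pchain.simps(2))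
qed

lemma image_pchain: "pchain S n P Q \<Longrightarrow> ker \<subseteq> P \<Longrightarrow> pchain R n (h ` P) (h ` Q)"
proof (induction n arbitrary: Q)
  case 0 then show ?case using image_prime by auto
next
  case (Suc n)
  then obtain P' where P': "pchain S n P P'" "P' \<subset> Q" "primeideal Q S" by auto
  have k: "ker \<subseteq> P'" using pchain_prime[OF P'(1)] Suc.prems(2) by blast
  then have "ker \<subseteq> Q" using P'(2) by blast
  have i: "ideal P' S" "ideal Q S" using P' pchain_prime[OF P'(1)] primeideal.axioms(1) by auto
  have "h ` P' \<noteq> h ` Q" using pre_image[OF i(1) k] pre_image[OF i(2) \<open>ker \<subseteq> Q\<close>] P'(2)
    by (metis order_less_irrefl)
  moreover have "h ` P' \<subseteq> h ` Q" using P'(2) by (intro image_mono) simp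
  ultimately have "h ` P' \<subset> h ` Q" by (intro psubsetI)
  then show ?case using Suc.IH[OF P'(1) Suc.prems(2)] image_prime[OF P'(3) \<open>ker \<subseteq> Q\<close>] by (metis pchain.simps(2))
qed

lemma image_adj_ideal:
  assumes "ideal I S" "x \<in> carrier S" shows "h ` adj_ideal S I x = adj_ideal R (h ` I) (h x)"
proof -
  have "h (i \<oplus>\<^bsub>S\<^esub> r \<otimes>\<^bsub>S\<^esub> x) = h i \<oplus>\<^bsub>R\<^esub> h r \<otimes>\<^bsub>R\<^esub> h x" if "i \<in> I" "r \<in> carrier S" for i r
    using that assms(2) ideal.Icarr[OF assms(1)] by (simp add: h_simps)
  note eq = this
  show ?thesis
  proof (intro equalityI subsetI)
    fix z assume "z \<in> h ` adj_ideal S I x"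
    then obtain i r where "i \<in> I" "r \<in> carrier S" "z = h (i \<oplus>\<^bsub>S\<^esub> r \<otimes>\<^bsub>S\<^esub> x)"
      unfolding image_iff Bex_def adj_ideal_iff by blast
    then show "z \<in> adj_ideal R (h ` I) (h x)"
      unfolding adj_ideal_iff using eq h_simps(1) by blast
  next
    fix z assume "z \<in> adj_ideal R (h ` I) (h x)"
    then obtain i r where ir: "i \<in> I" "r \<in> carrier R" "z = h i \<oplus>\<^bsub>R\<^esub> r \<otimes>\<^bsub>R\<^esub> h x"
      unfolding adj_ideal_iff by blast
    then obtain s where "s \<in> carrier S" "h s = r" using lift by blast
    then have "z = h (i \<oplus>\<^bsub>S\<^esub> s \<otimes>\<^bsub>S\<^esub> x)" "i \<oplus>\<^bsub>S\<^esub> s \<otimes>\<^bsub>S\<^esub> x \<in> adj_ideal S I x"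
      using ir eq unfolding adj_ideal_iff by auto
    then show "z \<in> h ` adj_ideal S I x" by blast
  qed
qed

text \<open>As \<open>I\<close> contains the kernel, the quotient of \<open>S\<close> by
  \<open>I\<close> is also the quotient of \<open>R\<close> by the image of
  \<open>I\<close>.\<close>

lemma image_reg_mod:
  assumes "ideal I S" "ker \<subseteq> I" "reg_mod S I ys" shows "reg_mod R (h ` I) (map h ys)"
  using assms
proof (induction ys arbitrary: I)
  case Nil
  then have "h ` I \<noteq> carrier R" using pre_image[OF Nil(1,2)] h_simps(1) by auto
  then show ?case by simp
next
  case (Cons y ys)
  have y: "y \<in> carrier S" "\<And>b. b \<in> carrier S \<Longrightarrow> y \<otimes>\<^bsub>S\<^esub> b \<in> I \<Longrightarrow> b \<in> I" "reg_mod S (adj_ideal S I y) ys"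
    using Cons.prems(3) by auto
  have "b \<in> h ` I" if b: "b \<in> carrier R" "h y \<otimes>\<^bsub>R\<^esub> b \<in> h ` I" for b
  proof -
    obtain s where s: "s \<in> carrier S" "h s = b" using lift b by blast
    then have "y \<otimes>\<^bsub>S\<^esub> s \<in> pre (h ` I)" using b y(1) by (simp add: h_simps)
    then have "s \<in> I" unfolding pre_image[OF Cons.prems(1,2)] using y(2) s(1) by blast
    then show ?thesis using s(2) by blast
  qed
  moreover have "reg_mod R (h ` adj_ideal S I y) (map h ys)"
    using S.adj_ideal_ideal[OF Cons.prems(1) y(1)] S.adj_ideal_superset[OF Cons.prems(1) y(1)]
      Cons.prems(2) y(3) by (intro Cons.IH) auto
  ultimately show ?case using y(1) by (simp add: h_simps(1) image_adj_ideal[OF Cons.prems(1)])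
qed

lemma image_Idl:
  assumes "A \<subseteq> carrier S" "ideal I S" "ker = I"
  shows "h ` (Idl\<^bsub>S\<^esub> (I \<union> A)) = Idl\<^bsub>R\<^esub> (h ` A)"
proof
  have c: "I \<union> A \<subseteq> carrier S" using assms ideal_subset_carrier by blast
  have hc: "h ` A \<subseteq> carrier R" using assms(1) h_simps(1) by blast
  have "Idl\<^bsub>S\<^esub> (I \<union> A) \<subseteq> pre (Idl\<^bsub>R\<^esub> (h ` A))"
  proof (rule S.genideal_minimal)
    show "ideal (pre (Idl\<^bsub>R\<^esub> (h ` A))) S" by (intro pre_ideal R.genideal_ideal hc)
    show "I \<union> A \<subseteq> pre (Idl\<^bsub>R\<^esub> (h ` A))"
      using c R.genideal_self[OF hc] assms(3) ideal_zero_closed[OF R.genideal_ideal[OF hc]] by auto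
  qed
  then show "h ` (Idl\<^bsub>S\<^esub> (I \<union> A)) \<subseteq> Idl\<^bsub>R\<^esub> (h ` A)" by blast
  show "Idl\<^bsub>R\<^esub> (h ` A) \<subseteq> h ` (Idl\<^bsub>S\<^esub> (I \<union> A))"
    using S.genideal_self[OF c] by (intro R.genideal_minimal image_ideal S.genideal_ideal c) auto
qed

lemma image_noetherian:
  assumes "noetherian_ring S" shows "noetherian_ring R"
proof (rule R.noetherian_ringI)
  fix J assume J: "ideal J R"
  obtain A where A: "A \<subseteq> carrier S" "finite A" "pre J = Idl\<^bsub>S\<^esub> A"
    using noetherian_ring.finetely_gen[OF assms pre_ideal[OF J]] by blast
  have hc: "h ` A \<subseteq> carrier R" using A(1) h_simps(1) by blast
  have "A \<subseteq> pre J" unfolding A(3) by (rule S.genideal_self[OF A(1)])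
  have "J = Idl\<^bsub>R\<^esub> (h ` A)"
  proof
    show "Idl\<^bsub>R\<^esub> (h ` A) \<subseteq> J" using \<open>A \<subseteq> pre J\<close> by (intro R.genideal_minimal J) auto
    have "pre J \<subseteq> pre (Idl\<^bsub>R\<^esub> (h ` A))" unfolding A(3)
      using R.genideal_self[OF hc] A(1) by (intro S.genideal_minimal pre_ideal R.genideal_ideal hc) auto
    then have "h ` pre J \<subseteq> Idl\<^bsub>R\<^esub> (h ` A)" by (auto simp: subset_iff)
    then show "J \<subseteq> Idl\<^bsub>R\<^esub> (h ` A)" using image_pre[OF ideal_subset_carrier[OF J]] by simp
  qed
  then show "\<exists>A\<subseteq>carrier R. finite A \<and> J = Idl\<^bsub>R\<^esub> A" using hc A(2) by blast
qed

end

text \<open>Sums of products are kept as lists of pairs because the matrix factorization is built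
  from both factors of each product.\<close>

primrec lincomb :: "('a, 'b) ring_scheme \<Rightarrow> ('a \<times> 'a) list \<Rightarrow> 'a" where
  "lincomb R [] = \<zero>\<^bsub>R\<^esub>"
| "lincomb R (p # ps) = fst p \<otimes>\<^bsub>R\<^esub> snd p \<oplus>\<^bsub>R\<^esub> lincomb R ps"

lemma (in cring) lincomb_in_ideal:
  assumes "ideal J R" "\<And>x. c x \<in> carrier R" "set xs \<subseteq> J"
  shows "lincomb R (map (\<lambda>x. (c x, x)) xs) \<in> J"
  using assms(3)
proof (induction xs)
  case Nil then show ?case using ideal_zero_closed[OF assms(1)] by simp
next
  case (Cons x xs)
  then have "x \<in> J" by simp
  then show ?case using Cons ideal_add_closed[OF assms(1) ideal.I_l_closed[OF assms(1) _ assms(2)]] by simp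
qed

text \<open>The combinations with coefficients in \<open>R\<close> form an ideal that contains the
  generators.\<close>

lemma (in cring) Idl_lincomb:
  assumes "set xs \<subseteq> carrier R" "distinct xs" "z \<in> Idl (set xs)"
  shows "\<exists>c. (\<forall>x. c x \<in> carrier R) \<and> z = lincomb R (map (\<lambda>x. (c x, x)) xs)"
proof -
  let ?l = "\<lambda>c. lincomb R (map (\<lambda>x. (c x, x)) xs)"
  let ?L = "{?l c | c. \<forall>x. c x \<in> carrier R}"
  have carr: "lincomb R (map (\<lambda>x. (c x, x)) ys) \<in> carrier R" if "\<forall>x. c x \<in> carrier R" "set ys \<subseteq> carrier R" for c ys
    using lincomb_in_ideal[OF oneideal, of c ys] that by auto
  have add: "lincomb R (map (\<lambda>x. (c x, x)) ys) \<oplus> lincomb R (map (\<lambda>x. (e x, x)) ys)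
      = lincomb R (map (\<lambda>x. (c x \<oplus> e x, x)) ys)"
    if "\<forall>x. c x \<in> carrier R" "\<forall>x. e x \<in> carrier R" "set ys \<subseteq> carrier R" for c e ys
    using that(3)
  proof (induction ys)
    case (Cons y ys)
    have c: "c y \<in> carrier R" "e y \<in> carrier R" "y \<in> carrier R"
      "lincomb R (map (\<lambda>x. (c x, x)) ys) \<in> carrier R" "lincomb R (map (\<lambda>x. (e x, x)) ys) \<in> carrier R"
      using that(1,2) Cons.prems carr[of c ys] carr[of e ys] by auto
    have "(a \<otimes> y \<oplus> u) \<oplus> (b \<otimes> y \<oplus> v) = (a \<oplus> b) \<otimes> y \<oplus> (u \<oplus> v)"
      if "a \<in> carrier R" "b \<in> carrier R" "u \<in> carrier R" "v \<in> carrier R" for a b u v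
      using that c(3) by algebra
    from this[OF c(1,2,4,5)] show ?case using Cons by simp
  qed simp
  have smul: "r \<otimes> lincomb R (map (\<lambda>x. (c x, x)) ys) = lincomb R (map (\<lambda>x. (r \<otimes> c x, x)) ys)"
    if "\<forall>x. c x \<in> carrier R" "r \<in> carrier R" "set ys \<subseteq> carrier R" for c r ys
    using that(3)
  proof (induction ys)
    case (Cons y ys)
    have c: "c y \<in> carrier R" "y \<in> carrier R" "lincomb R (map (\<lambda>x. (c x, x)) ys) \<in> carrier R"
      using that(1) Cons.prems carr[of c ys] by auto
    show ?case using Cons c that(2) by (simp add: r_distr m_assoc)
  qed (use that(2) in simp)
  have smulL: "r \<otimes> w \<in> ?L" if "w \<in> ?L" "r \<in> carrier R" for r w
  proof -
    from that obtain c where c: "\<forall>x. c x \<in> carrier R" "w = ?l c" by blast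
    then have "r \<otimes> w = ?l (\<lambda>x. r \<otimes> c x)" using smul[OF c(1) that(2) assms(1)] by simp
    then show ?thesis using c(1) that(2) by (intro CollectI exI[of _ "\<lambda>x. r \<otimes> c x"]) simp
  qed
  have Lc: "?L \<subseteq> carrier R" using carr assms(1) by blast
  have "ideal ?L R"
  proof (rule idealI[OF ring_axioms])
    show "subgroup ?L (add_monoid R)"
    proof (rule add.subgroupI)
      show "?L \<subseteq> carrier R" by (rule Lc)
      show "?L \<noteq> {}" by (auto intro: exI[of _ "\<lambda>_. \<zero>"])
      show "\<ominus> w \<in> ?L" if "w \<in> ?L" for w
      proof -
        have "w \<in> carrier R" using that Lc by blast
        then have "\<ominus> w = (\<ominus> \<one>) \<otimes> w" by (simp add: l_minus)
        then show ?thesis using smulL[OF that, of "\<ominus> \<one>"] by simp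
      qed
      show "w \<oplus> w' \<in> ?L" if "w \<in> ?L" "w' \<in> ?L" for w w'
      proof -
        from that obtain c e where c: "\<forall>x. c x \<in> carrier R" "w = ?l c" and e: "\<forall>x. e x \<in> carrier R" "w' = ?l e"
          by blast
        then have "w \<oplus> w' = ?l (\<lambda>x. c x \<oplus> e x)" using add[OF c(1) e(1) assms(1)] by simp
        then show ?thesis using c(1) e(1) by (intro CollectI exI[of _ "\<lambda>x. c x \<oplus> e x"]) simp
      qed
    qed
    show "r \<otimes> w \<in> ?L" if "w \<in> ?L" "r \<in> carrier R" for r w by (rule smulL[OF that])
    show "w \<otimes> r \<in> ?L" if "w \<in> ?L" "r \<in> carrier R" for r w
      unfolding m_comm[OF subsetD[OF Lc that(1)] that(2)] by (rule smulL[OF that])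
  qed
  moreover have "set xs \<subseteq> ?L"
  proof
    fix x assume x: "x \<in> set xs"
    \<comment> \<open>Coefficients depend on the element and not on its position, so distinctness of
      the list makes \<open>x\<close> count once.\<close>
    let ?c = "\<lambda>y. if y = x then \<one> else \<zero>"
    have z: "lincomb R (map (\<lambda>y. (?c y, y)) ys) = (if x \<in> set ys then x else \<zero>)"
      if "distinct ys" "set ys \<subseteq> carrier R" for ys using that by (induction ys) auto
    have "x = ?l ?c" using z[OF assms(2,1)] x by simp
    then show "x \<in> ?L" by (intro CollectI exI[of _ ?c]) simp
  qed
  ultimately have "Idl (set xs) \<subseteq> ?L" by (rule genideal_minimal)
  then show ?thesis using assms(3) by blast
qed

text \<open>Isolates one generator, so that it can be solved for when its coefficient is a
  unit.\<close>

lemma (in cring) lincomb_split: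
  assumes "ideal J R" "\<And>x. c x \<in> carrier R" "set xs - {x0} \<subseteq> J" "distinct xs" "x0 \<in> set xs" "x0 \<in> carrier R"
  shows "\<exists>w \<in> J. lincomb R (map (\<lambda>x. (c x, x)) xs) = c x0 \<otimes> x0 \<oplus> w"
  using assms(3-5)
proof (induction xs)
  case (Cons y ys)
  show ?case
  proof (cases "y = x0")
    case True
    then have "set ys \<subseteq> J" using Cons.prems by auto
    then show ?thesis using True lincomb_in_ideal[OF assms(1,2)] by auto
  next
    case False
    then obtain w where w: "w \<in> J" "lincomb R (map (\<lambda>x. (c x, x)) ys) = c x0 \<otimes> x0 \<oplus> w"
      using Cons by auto
    have y: "y \<in> J" using Cons.prems False by auto
    have cc: "y \<in> carrier R" "w \<in> carrier R" using y w ideal.Icarr[OF assms(1)] by auto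
    have "lincomb R (map (\<lambda>x. (c x, x)) (y # ys)) = c x0 \<otimes> x0 \<oplus> (c y \<otimes> y \<oplus> w)"
      using w(2) cc assms(2,6) by (simp add: a_ac)
    moreover have "c y \<otimes> y \<oplus> w \<in> J"
      by (intro ideal_add_closed[OF assms(1)] ideal.I_l_closed[OF assms(1) y] assms(2) w)
    ultimately show ?thesis by blast
  qed
qed simp

section \<open>The hypersurface ring: dimension, depth, regularity\<close>

locale regular_hypersurface = surj_cring_hom S R h + S: local_noetherian_cring S \<mm>
  for S :: "('s, 't) ring_scheme" and R :: "('a, 'r) ring_scheme" and h \<mm> +
  fixes f :: 's and A :: "'s set" and d :: nat
  assumes A: "S.regular_system {\<zero>\<^bsub>S\<^esub>} A" and f: "f \<in> \<mm>" "f \<noteq> \<zero>\<^bsub>S\<^esub>"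
    and ker_eq: "{s \<in> carrier S. h s = \<zero>\<^bsub>R\<^esub>} = PIdl\<^bsub>S\<^esub> f"
    and dim: "krull_dim R = enat d"
begin

lemma f_carr: "f \<in> carrier S" using f ideal.Icarr[OF S.mm_ideal] by blast

lemma ker_adj: "ker = adj_ideal S {\<zero>\<^bsub>S\<^esub>} f"
proof -
  have "adj_ideal S {\<zero>\<^bsub>S\<^esub>} f = PIdl\<^bsub>S\<^esub> f"
    using f_carr unfolding set_eq_iff adj_ideal_iff cgenideal_def by auto
  then show ?thesis using ker_eq by simp
qed

lemma ker_ideal: "ideal ker S" unfolding ker_eq by (rule S.cgenideal_ideal[OF f_carr])

lemma ker_le_mm: "ker \<subseteq> \<mm>" unfolding ker_eq by (rule S.cgenideal_minimal[OF S.mm_ideal f(1)])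

lemma zero_prime: "primeideal {\<zero>\<^bsub>S\<^esub>} S" by (rule S.regular_system_prime[OF A])

lemma f_cancel: "a \<in> carrier S \<Longrightarrow> f \<otimes>\<^bsub>S\<^esub> a = \<zero>\<^bsub>S\<^esub> \<Longrightarrow> a = \<zero>\<^bsub>S\<^esub>"
  using primeideal.I_prime[OF zero_prime f_carr, of a] f(2) by auto

abbreviation nn where "nn \<equiv> h ` \<mm>"

lemma pre_nn: "pre nn = \<mm>" by (rule pre_image[OF S.mm_ideal ker_le_mm])

lemma nn_maximal: "maximalideal nn R"
proof (rule maximalidealI)
  show "ideal nn R" by (rule image_ideal[OF S.mm_ideal])
  show "carrier R \<noteq> nn" using pre_nn S.mm_neq h_simps(1) by auto
  fix K assume K: "ideal K R" "nn \<subseteq> K" "K \<subseteq> carrier R"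
  have "\<mm> \<subseteq> pre K" using K(2) ideal_subset_carrier[OF S.mm_ideal] by auto
  then have "pre K = \<mm> \<or> pre K = carrier S"
    using S.proper_ideal_le_mm[OF pre_ideal[OF K(1)]] by auto
  then show "K = nn \<or> K = carrier R" using image_pre[OF K(3)] surj by metis
qed

lemma nn_unique: "maximalideal J R \<Longrightarrow> J = nn"
proof -
  assume J: "maximalideal J R"
  have Ji: "ideal J R" using J maximalideal.axioms(1) by blast
  have Jc: "J \<subseteq> carrier R" by (rule ideal_subset_carrier[OF Ji])
  have "\<one>\<^bsub>R\<^esub> \<notin> J" using maximalideal.I_notcarr[OF J] ideal.one_imp_carrier[OF Ji] by auto
  then have "\<one>\<^bsub>S\<^esub> \<notin> pre J" by (simp add: h_simps)
  then have "pre J \<noteq> carrier S" by blast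
  then have "pre J \<subseteq> \<mm>" using S.proper_ideal_le_mm[OF pre_ideal[OF Ji]] by blast
  then have "h ` pre J \<subseteq> nn" by (rule image_mono)
  then have "J \<subseteq> nn" using image_pre[OF Jc] by simp
  have nni: "ideal nn R" "carrier R \<noteq> nn"
    using nn_maximal maximalideal.axioms(1) maximalideal.I_notcarr by blast+
  then show "J = nn"
    using maximalideal.I_maximal[OF J nni(1) \<open>J \<subseteq> nn\<close> ideal_subset_carrier[OF nni(1)]] by auto
qed

lemma R_noetherian: "noetherian_ring R"
  by (rule image_noetherian[OF S.noetherian_ring_axioms])

sublocale R: local_noetherian_cring R nn
  by (intro local_noetherian_cring.intro noetherian_cring.intro R_noetherian R.is_cring
      local_noetherian_cring_axioms.intro nn_maximal nn_unique)

lemma R_local: "local_ring R" "max_ideal R = nn"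
proof -
  show "local_ring R" unfolding local_ring_def using R.is_cring nn_maximal nn_unique by blast
  show "max_ideal R = nn" unfolding max_ideal_def using nn_maximal nn_unique by (rule the_equality)
qed

text \<open>The dimension of \<open>S\<close> exceeds that of \<open>R\<close> by one. A longest
  chain in \<open>S\<close> can be shifted to start at a prime containing \<open>f\<close>, which
  costs one step, and then maps to \<open>R\<close>. Conversely the preimages of a chain in
  \<open>R\<close> are primes containing \<open>f\<close>, and the zero ideal can be put below
  them.\<close>

lemma card_A: "card A = Suc d"
proof (rule antisym)
  have ch: "pchain S (card A) {\<zero>\<^bsub>S\<^esub>} \<mm>" by (rule S.regular_system_chain[OF A])
  show "card A \<le> Suc d"
  proof (cases "card A")
    case (Suc n)
    obtain P' where P': "pchain S n P' \<mm>" "f \<in> P'" using S.pchain_shift[of n _ \<mm> f] ch f(1) Suc by metis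
    have P'i: "ideal P' S" using pchain_prime[OF P'(1)] primeideal.axioms(1) by blast
    have "ker \<subseteq> P'" unfolding ker_eq by (rule S.cgenideal_minimal[OF P'i P'(2)])
    from pchain_le_krull_dim[OF image_pchain[OF P'(1) this]] show ?thesis using Suc dim by simp
  qed simp
  obtain P Q where "pchain R d P Q" using krull_dim_attained[OF dim R.mm_prime] by blast
  note c = pre_pchain[OF this]
  have P: "ideal P R" using \<open>pchain R d P Q\<close> pchain_prime primeideal.axioms(1) by blast
  have "f \<in> ker" unfolding ker_eq by (rule S.cgenideal_self[OF f_carr])
  then have "f \<in> pre P" using ideal_zero_closed[OF P] by simp
  moreover have "\<zero>\<^bsub>S\<^esub> \<in> pre P" using ideal_zero_closed[OF P] by (simp add: h_simps)
  ultimately have "pchain S (Suc d) {\<zero>\<^bsub>S\<^esub>} (pre Q)" using f(2) by (intro pchain_Cons[OF c zero_prime]) auto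
  then obtain P' where P': "pchain S (Suc d) P' \<mm>" "{\<zero>\<^bsub>S\<^esub>} \<subseteq> P'" using S.pchain_raise_mm by blast
  show "Suc d \<le> card A"
    using S.chain_length_le_gens[OF S.regular_systemD(2,1,3,4) P', OF A A A A] .
qed

text \<open>A regular sequence on S/(f), one shorter than the dimension of \<open>S\<close>, is
  carried over to \<open>R\<close>. Together with \<open>reg_seq_length\<close> this gives
  \<open>R\<close> the depth \<open>d\<close>.\<close>

lemma ex_reg_seq: "\<exists>zs. length zs = d \<and> reg_mod R {\<zero>\<^bsub>R\<^esub>} zs"
proof -
  obtain ys where ys: "Suc (length ys) = card A" "reg_mod S (adj_ideal S {\<zero>\<^bsub>S\<^esub>} f) ys"
    using S.regular_system_depth[OF A f(1)] f(2) by blast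
  then have "reg_mod R (h ` ker) (map h ys)"
    using ker_adj by (intro image_reg_mod ker_ideal) auto
  moreover have "h ` ker = {\<zero>\<^bsub>R\<^esub>}" using ideal_zero_closed[OF ker_ideal] by auto
  ultimately show ?thesis using ys(1) card_A by (intro exI[of _ "map h ys"]) simp
qed

lemma reg_seq_length: "reg_mod R {\<zero>\<^bsub>R\<^esub>} zs \<Longrightarrow> length zs \<le> d"
  using R.pchain_of_reg_mod[OF R.zeroideal] pchain_le_krull_dim dim by (metis enat_ord_simps(1))

text \<open>Expand \<open>f\<close> in a system of parameters. If all coefficients lie in \<mm>,
  this is the second alternative. If the coefficient of \<open>x0\<close> is a unit,
  \<open>f\<close> can be exchanged for \<open>x0\<close>, and the remaining parameters generate the
  maximal ideal of \<open>R\<close>.\<close>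

lemma regular_or_quadratic:
  "regular_local_ring R \<or> (\<exists>ps. set ps \<subseteq> \<mm> \<times> \<mm> \<and> f = lincomb S ps)"
proof -
  note Ad = S.regular_systemD[OF A]
  obtain xs where xs: "set xs = A" "distinct xs" using finite_distinct_list[OF Ad(2)] by blast
  have Am: "A \<subseteq> \<mm>" by (rule S.regular_system_mem_mm[OF A])
  have "Idl\<^bsub>S\<^esub> ({\<zero>\<^bsub>S\<^esub>} \<union> A) \<subseteq> Idl\<^bsub>S\<^esub> A"
    using S.genideal_self[OF Ad(3)] ideal_zero_closed[OF S.genideal_ideal[OF Ad(3)]]
    by (intro S.genideal_minimal S.genideal_ideal[OF Ad(3)]) auto
  then have "f \<in> Idl\<^bsub>S\<^esub> (set xs)" using f(1) Ad(4) xs(1) by auto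
  then obtain c where c: "\<forall>x. c x \<in> carrier S" "f = lincomb S (map (\<lambda>x. (c x, x)) xs)"
    using S.Idl_lincomb[of xs f] xs Ad(3) by blast
  show ?thesis
  proof (cases "\<forall>x \<in> A. c x \<in> \<mm>")
    case True
    then have "set (map (\<lambda>x. (c x, x)) xs) \<subseteq> \<mm> \<times> \<mm>" using xs Am by auto
    then show ?thesis using c(2) by blast
  next
    case False
    then obtain x0 where x0: "x0 \<in> A" "c x0 \<notin> \<mm>" by blast
    let ?B = "A - {x0}"
    have x0c: "x0 \<in> carrier S" using x0 Ad(3) by blast
    have A_eq: "insert x0 ?B = A" using x0 by blast
    have Bc: "{\<zero>\<^bsub>S\<^esub>} \<union> insert f ?B \<subseteq> carrier S" using Ad(3) f_carr by auto
    let ?J = "Idl\<^bsub>S\<^esub> ({\<zero>\<^bsub>S\<^esub>} \<union> insert f ?B)"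
    have Ji: "ideal ?J S" and Js: "{\<zero>\<^bsub>S\<^esub>} \<union> insert f ?B \<subseteq> ?J"
      by (rule S.genideal_ideal[OF Bc], rule S.genideal_self[OF Bc])
    obtain w where w: "w \<in> ?J" "f = c x0 \<otimes>\<^bsub>S\<^esub> x0 \<oplus>\<^bsub>S\<^esub> w"
      using S.lincomb_split[OF Ji, of c xs x0] c Js xs x0 x0c by auto
    have wc: "w \<in> carrier S" using ideal.Icarr[OF Ji w(1)] .
    have c0: "c x0 \<in> carrier S" using c by blast
    have "c x0 \<otimes>\<^bsub>S\<^esub> x0 = (c x0 \<otimes>\<^bsub>S\<^esub> x0 \<oplus>\<^bsub>S\<^esub> w) \<ominus>\<^bsub>S\<^esub> w" using c0 x0c wc by algebra
    also have "\<dots> = f \<ominus>\<^bsub>S\<^esub> w" using w(2) by simp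
    also have "\<dots> \<in> ?J" using Js w(1) by (intro S.ideal_minus_closed[OF Ji]) auto
    finally have "x0 \<in> ?J" using S.unit_cancel[OF _ x0c Ji, of "c x0"] x0(2) c0 by blast
    then have ex: "S.regular_system {\<zero>\<^bsub>S\<^esub>} (insert f ?B)" "f \<notin> ?B"
      using S.regular_system_exchange[of "{\<zero>\<^bsub>S\<^esub>}" x0 ?B f] A f(1) unfolding A_eq by auto
    have "S.regular_system ker ?B" unfolding ker_adj by (rule S.regular_system_adj[OF ex])
    note B = S.regular_systemD[OF this]
    have gen: "nn = Idl\<^bsub>R\<^esub> (h ` ?B)"
      using image_Idl[OF B(3) ker_ideal refl] unfolding B(4) .
    have hB: "h ` ?B \<subseteq> carrier R" using B(3) h_simps(1) by blast
    \<comment> \<open>\<open>h\<close> might identify parameters, but fewer than \<open>d\<close>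
      generators are impossible by the length of a longest chain in \<open>R\<close>.\<close>
    have "card (h ` ?B) = d"
    proof (rule antisym)
      have "card ?B = d" using card_A x0 Ad(2) by simp
      then show "card (h ` ?B) \<le> d" using card_image_le[OF B(2), of h] by simp
      obtain P Q where "pchain R d P Q" using krull_dim_attained[OF dim R.mm_prime] by blast
      then obtain P' where P': "pchain R d P' nn" using R.pchain_raise_mm by blast
      have "ideal P' R" using pchain_prime[OF P'] primeideal.axioms(1) by blast
      then have "{\<zero>\<^bsub>R\<^esub>} \<subseteq> P'" using ideal_zero_closed by auto
      moreover have "Idl\<^bsub>R\<^esub> ({\<zero>\<^bsub>R\<^esub>} \<union> h ` ?B) = nn"
      proof
        show "Idl\<^bsub>R\<^esub> ({\<zero>\<^bsub>R\<^esub>} \<union> h ` ?B) \<subseteq> nn"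
          using R.genideal_self[OF hB] ideal_zero_closed[OF R.mm_ideal] unfolding gen[symmetric]
          by (intro R.genideal_minimal R.mm_ideal) auto
        show "nn \<subseteq> Idl\<^bsub>R\<^esub> ({\<zero>\<^bsub>R\<^esub>} \<union> h ` ?B)"
          unfolding gen using hB by (intro R.subset_Idl_subset) auto
      qed
      ultimately show "d \<le> card (h ` ?B)"
        using R.chain_length_le_gens[OF finite_imageI[OF B(2)] R.zeroideal hB _ P'] by blast
    qed
    then have "regular_local_ring R"
      unfolding regular_local_ring_def using R_noetherian R_local dim gen hB B(2) by auto
    then show ?thesis ..
  qed
qed

end

section \<open>Homomorphisms and submodules\<close>

lemma module_homI:
  assumes "\<And>x. x \<in> carrier M \<Longrightarrow> h x \<in> carrier N"
    "\<And>x y. x \<in> carrier M \<Longrightarrow> y \<in> carrier M \<Longrightarrow> h (x \<oplus>\<^bsub>M\<^esub> y) = h x \<oplus>\<^bsub>N\<^esub> h y"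
    "\<And>a x. a \<in> carrier R \<Longrightarrow> x \<in> carrier M \<Longrightarrow> h (a \<odot>\<^bsub>M\<^esub> x) = a \<odot>\<^bsub>N\<^esub> h x"
  shows "h \<in> module_hom R M N"
  using assms unfolding module_hom_def by auto

lemma module_homD:
  assumes "h \<in> module_hom R M N"
  shows "x \<in> carrier M \<Longrightarrow> h x \<in> carrier N"
    "x \<in> carrier M \<Longrightarrow> y \<in> carrier M \<Longrightarrow> h (x \<oplus>\<^bsub>M\<^esub> y) = h x \<oplus>\<^bsub>N\<^esub> h y"
    "a \<in> carrier R \<Longrightarrow> x \<in> carrier M \<Longrightarrow> h (a \<odot>\<^bsub>M\<^esub> x) = a \<odot>\<^bsub>N\<^esub> h x"
  using assms unfolding module_hom_def by auto

lemma module_abelian_group: "module R M \<Longrightarrow> abelian_group M"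
  unfolding module_def by blast

lemma module_cring: "module R M \<Longrightarrow> cring R"
  unfolding module_def by blast

lemma module_zero_closed: "module R M \<Longrightarrow> \<zero>\<^bsub>M\<^esub> \<in> carrier M"
  using abelian_monoid.zero_closed abelian_group.axioms(1) module_abelian_group by blast

lemma module_hom_zero:
  assumes "module R M" "module R N" "h \<in> module_hom R M N"
  shows "h \<zero>\<^bsub>M\<^esub> = \<zero>\<^bsub>N\<^esub>"
proof -
  interpret M: module R M by fact
  interpret N: module R N by fact
  have "h (\<zero>\<^bsub>R\<^esub> \<odot>\<^bsub>M\<^esub> \<zero>\<^bsub>M\<^esub>) = \<zero>\<^bsub>R\<^esub> \<odot>\<^bsub>N\<^esub> h \<zero>\<^bsub>M\<^esub>"
    using module_homD(3)[OF assms(3)] by blast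
  then show ?thesis using module_homD(1)[OF assms(3)] by simp
qed

lemma module_hom_uminus:
  assumes "module R M" "module R N" "h \<in> module_hom R M N" "x \<in> carrier M"
  shows "h (\<ominus>\<^bsub>M\<^esub> x) = \<ominus>\<^bsub>N\<^esub> h x"
proof -
  interpret M: module R M by fact
  interpret N: module R N by fact
  have "\<ominus>\<^bsub>M\<^esub> x = (\<ominus>\<^bsub>R\<^esub> \<one>\<^bsub>R\<^esub>) \<odot>\<^bsub>M\<^esub> x" using M.smult_l_minus[of "\<one>\<^bsub>R\<^esub>" x] assms(4) by simp
  then have "h (\<ominus>\<^bsub>M\<^esub> x) = (\<ominus>\<^bsub>R\<^esub> \<one>\<^bsub>R\<^esub>) \<odot>\<^bsub>N\<^esub> h x" using module_homD(3)[OF assms(3)] assms(4) by simp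
  then show ?thesis using N.smult_l_minus[of "\<one>\<^bsub>R\<^esub>" "h x"] module_homD(1)[OF assms(3,4)] by simp
qed

lemma module_hom_minus:
  assumes "module R M" "module R N" "h \<in> module_hom R M N" "x \<in> carrier M" "y \<in> carrier M"
  shows "h (x \<ominus>\<^bsub>M\<^esub> y) = h x \<ominus>\<^bsub>N\<^esub> h y"
proof -
  interpret M: module R M by fact
  show ?thesis unfolding a_minus_def
    using module_homD(2)[OF assms(3)] module_hom_uminus[OF assms(1-3)] assms(4,5) by simp
qed

lemma module_hom_comp:
  "h \<in> module_hom R M N \<Longrightarrow> g \<in> module_hom R N P \<Longrightarrow> (\<lambda>x. g (h x)) \<in> module_hom R M P"
  unfolding module_hom_def by (auto simp: Pi_iff)

lemma submodule_closed:
  assumes "submodule N R M"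
  shows "N \<subseteq> carrier M" "\<zero>\<^bsub>M\<^esub> \<in> N" "x \<in> N \<Longrightarrow> y \<in> N \<Longrightarrow> x \<oplus>\<^bsub>M\<^esub> y \<in> N"
    "a \<in> carrier R \<Longrightarrow> x \<in> N \<Longrightarrow> a \<odot>\<^bsub>M\<^esub> x \<in> N" "x \<in> N \<Longrightarrow> \<ominus>\<^bsub>M\<^esub> x \<in> N"
  using subgroup.subset[OF submodule.axioms(1)[OF assms]] subgroup.one_closed[OF submodule.axioms(1)[OF assms]]
    subgroup.m_closed[OF submodule.axioms(1)[OF assms]] submodule.smult_closed[OF assms]
    subgroup.m_inv_closed[OF submodule.axioms(1)[OF assms]]
  by (simp_all add: a_inv_def)

lemma submodule_minus_closed:
  assumes "submodule N R M" "x \<in> N" "y \<in> N" shows "x \<ominus>\<^bsub>M\<^esub> y \<in> N"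
  unfolding a_minus_def using assms submodule_closed(3,5) by metis

lemma submoduleI':
  assumes "module R M" "H \<subseteq> carrier M" "\<zero>\<^bsub>M\<^esub> \<in> H"
    "\<And>a b. a \<in> H \<Longrightarrow> b \<in> H \<Longrightarrow> a \<oplus>\<^bsub>M\<^esub> b \<in> H"
    "\<And>a x. a \<in> carrier R \<Longrightarrow> x \<in> H \<Longrightarrow> a \<odot>\<^bsub>M\<^esub> x \<in> H"
  shows "submodule H R M"
proof (rule module.submoduleI[OF assms(1-3)])
  interpret M: module R M by fact
  fix a assume a: "a \<in> H"
  then have "\<ominus>\<^bsub>M\<^esub> a = (\<ominus>\<^bsub>R\<^esub> \<one>\<^bsub>R\<^esub>) \<odot>\<^bsub>M\<^esub> a"
    using M.smult_l_minus[of "\<one>\<^bsub>R\<^esub>" a] assms(2) by auto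
  then show "\<ominus>\<^bsub>M\<^esub> a \<in> H" using assms(5) a by simp
qed (use assms in auto)

lemma submodule_module: "module R M \<Longrightarrow> submodule N R M \<Longrightarrow> module R (M\<lparr>carrier := N\<rparr>)"
  using submodule.submodule_is_module by blast

lemma submodule_preimage:
  assumes "module R M" "module R N" "h \<in> module_hom R M N" "submodule K R N"
  shows "submodule {x \<in> carrier M. h x \<in> K} R M"
proof -
  interpret M: module R M by fact
  show ?thesis using module_homD[OF assms(3)] submodule_closed[OF assms(4)] module_hom_zero[OF assms(1-3)]
    by (intro submoduleI'[OF assms(1)]) auto
qed

lemma submodule_image:
  assumes "module R M" "module R N" "h \<in> module_hom R M N" "submodule K R M"
  shows "submodule (h ` K) R N"
proof (rule submoduleI'[OF assms(2)])
  note K = submodule_closed[OF assms(4)] and h = module_homD[OF assms(3)]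
  show "h ` K \<subseteq> carrier N" using K h by auto
  show "\<zero>\<^bsub>N\<^esub> \<in> h ` K" using module_hom_zero[OF assms(1-3)] K(2) by (metis imageI)
  show "a \<oplus>\<^bsub>N\<^esub> b \<in> h ` K" if "a \<in> h ` K" "b \<in> h ` K" for a b
  proof -
    from that obtain x y where "x \<in> K" "y \<in> K" "a = h x" "b = h y" by blast
    moreover from this have "x \<oplus>\<^bsub>M\<^esub> y \<in> K" "h (x \<oplus>\<^bsub>M\<^esub> y) = h x \<oplus>\<^bsub>N\<^esub> h y"
      using h(2)[of x y] K(1,3) by auto
    ultimately have "a \<oplus>\<^bsub>N\<^esub> b = h (x \<oplus>\<^bsub>M\<^esub> y)" "x \<oplus>\<^bsub>M\<^esub> y \<in> K" by auto
    then show ?thesis by blast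
  qed
  show "r \<odot>\<^bsub>N\<^esub> a \<in> h ` K" if "r \<in> carrier R" "a \<in> h ` K" for r a
  proof -
    from that obtain x where "x \<in> K" "a = h x" by blast
    moreover from this have "r \<odot>\<^bsub>M\<^esub> x \<in> K" "h (r \<odot>\<^bsub>M\<^esub> x) = r \<odot>\<^bsub>N\<^esub> h x"
      using h(3)[OF that(1), of x] K(1,4) that(1) by auto
    ultimately have "r \<odot>\<^bsub>N\<^esub> a = h (r \<odot>\<^bsub>M\<^esub> x)" "r \<odot>\<^bsub>M\<^esub> x \<in> K" by auto
    then show ?thesis by blast
  qed
qed

lemma submodule_zero: "module R M \<Longrightarrow> submodule {\<zero>\<^bsub>M\<^esub>} R M"
proof -
  assume M: "module R M"
  interpret M: module R M by fact
  show ?thesis by (rule submoduleI'[OF M]) auto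
qed

lemma submodule_kernel:
  assumes "module R M" "module R N" "h \<in> module_hom R M N"
  shows "submodule {x \<in> carrier M. h x = \<zero>\<^bsub>N\<^esub>} R M"
  using submodule_preimage[OF assms submodule_zero[OF assms(2)]] by simp

text \<open>With \<open>free_module_in_submodule\<close> this shows that two homomorphisms on a free
  module agree once they agree on the basis.\<close>

lemma submodule_equalizer:
  assumes "module R M" "module R N" "h \<in> module_hom R M N" "g \<in> module_hom R M N"
  shows "submodule {x \<in> carrier M. h x = g x} R M"
proof -
  interpret M: module R M by fact
  show ?thesis using module_homD[OF assms(3)] module_homD[OF assms(4)]
      module_hom_zero[OF assms(1-3)] module_hom_zero[OF assms(1,2,4)]
    by (intro submoduleI'[OF assms(1)]) auto
qed

lemma gen_submodule_submodule:
  assumes "module R M" "A \<subseteq> carrier M"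
  shows "submodule (gen_submodule R M A) R M" "A \<subseteq> gen_submodule R M A"
proof -
  have c: "submodule (carrier M) R M" using module.carrier_is_submodule[OF assms(1)] .
  show "A \<subseteq> gen_submodule R M A" unfolding gen_submodule_def by blast
  show "submodule (gen_submodule R M A) R M"
    unfolding gen_submodule_def
  proof (rule submoduleI'[OF assms(1)])
    let ?S = "{N. submodule N R M \<and> A \<subseteq> N}"
    show "\<Inter>?S \<subseteq> carrier M" using c assms(2) by (intro Inter_lower) simp
    show "\<zero>\<^bsub>M\<^esub> \<in> \<Inter>?S" by (auto intro: submodule_closed(2))
    show "a \<oplus>\<^bsub>M\<^esub> b \<in> \<Inter>?S" if "a \<in> \<Inter>?S" "b \<in> \<Inter>?S" for a b
      using that by (auto intro: submodule_closed(3))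
    show "r \<odot>\<^bsub>M\<^esub> a \<in> \<Inter>?S" if "r \<in> carrier R" "a \<in> \<Inter>?S" for r a
      using that by (auto intro: submodule_closed(4))
  qed
qed

lemma gen_submodule_minimal: "submodule N R M \<Longrightarrow> A \<subseteq> N \<Longrightarrow> gen_submodule R M A \<subseteq> N"
  unfolding gen_submodule_def by blast

section \<open>Free modules\<close>

lemma free_module_simps:
  "\<zero>\<^bsub>free_module R X\<^esub> = (\<lambda>_. \<zero>\<^bsub>R\<^esub>)" "v \<oplus>\<^bsub>free_module R X\<^esub> w = (\<lambda>x. v x \<oplus>\<^bsub>R\<^esub> w x)"
  "a \<odot>\<^bsub>free_module R X\<^esub> v = (\<lambda>x. a \<otimes>\<^bsub>R\<^esub> v x)"
  by (simp_all add: free_module_def)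

lemma free_module_carrier:
  "v \<in> carrier (free_module R X) \<longleftrightarrow> (\<forall>x\<in>X. v x \<in> carrier R) \<and> (\<forall>x. x \<notin> X \<longrightarrow> v x = \<zero>\<^bsub>R\<^esub>) \<and>
       finite {x. v x \<noteq> \<zero>\<^bsub>R\<^esub>}"
  by (simp add: free_module_def)

lemma (in cring) free_module_val: "v \<in> carrier (free_module R X) \<Longrightarrow> v x \<in> carrier R"
  unfolding free_module_carrier by (cases "x \<in> X") auto

lemma (in cring) free_module_module: "module R (free_module R X)"
proof -
  let ?F = "free_module R X"
  note val = free_module_val[of _ X]
  have add: "v \<oplus>\<^bsub>?F\<^esub> w \<in> carrier ?F" if v: "v \<in> carrier ?F" and w: "w \<in> carrier ?F" for v w
  proof -
    have "{x. v x \<oplus> w x \<noteq> \<zero>} \<subseteq> {x. v x \<noteq> \<zero>} \<union> {x. w x \<noteq> \<zero>}" by auto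
    then have "finite {x. v x \<oplus> w x \<noteq> \<zero>}" using v w unfolding free_module_carrier
      by (meson finite_UnI finite_subset)
    then show ?thesis using v w unfolding free_module_carrier free_module_simps by auto
  qed
  have smult: "a \<odot>\<^bsub>?F\<^esub> v \<in> carrier ?F" if a: "a \<in> carrier R" and v: "v \<in> carrier ?F" for a v
  proof -
    have "{x. a \<otimes> v x \<noteq> \<zero>} \<subseteq> {x. v x \<noteq> \<zero>}" using a by auto
    then have "finite {x. a \<otimes> v x \<noteq> \<zero>}" using v unfolding free_module_carrier
      by (meson finite_subset)
    then show ?thesis using a v unfolding free_module_carrier free_module_simps by auto
  qed
  show ?thesis
  proof (rule moduleI[OF is_cring])
    show "abelian_group ?F"
    proof (rule abelian_groupI)
      show "\<zero>\<^bsub>?F\<^esub> \<in> carrier ?F" by (simp add: free_module_simps free_module_carrier)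
      fix v assume v: "v \<in> carrier ?F"
      show "\<exists>w \<in> carrier ?F. w \<oplus>\<^bsub>?F\<^esub> v = \<zero>\<^bsub>?F\<^esub>"
      proof (rule bexI)
        show "(\<ominus> \<one>) \<odot>\<^bsub>?F\<^esub> v \<in> carrier ?F" using v by (intro smult) auto
        show "(\<ominus> \<one>) \<odot>\<^bsub>?F\<^esub> v \<oplus>\<^bsub>?F\<^esub> v = \<zero>\<^bsub>?F\<^esub>"
          using val[OF v] by (simp add: free_module_simps l_minus l_neg)
      qed
    qed (use add in \<open>auto simp: free_module_simps a_ac val\<close>)
  qed (use add smult in \<open>auto simp: free_module_simps val l_distr r_distr m_assoc\<close>)
qed

lemma (in cring) basis_vec_carrier: "x \<in> X \<Longrightarrow> basis_vec R x \<in> carrier (free_module R X)"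
  unfolding free_module_carrier basis_vec_def by auto

text \<open>Induction over a finite set that contains the support of \<open>v\<close>, clearing one
  coordinate at a time.\<close>

lemma (in cring) free_module_in_submodule:
  assumes "submodule N R (free_module R X)" "\<And>x. x \<in> X \<Longrightarrow> basis_vec R x \<in> N" "v \<in> carrier (free_module R X)"
  shows "v \<in> N"
proof -
  let ?F = "free_module R X"
  have "v \<in> N" if "finite S" "{x. v x \<noteq> \<zero>} \<subseteq> S" "v \<in> carrier ?F" for S v
    using that
  proof (induction S arbitrary: v rule: finite_induct)
    case empty
    then have "v = \<zero>\<^bsub>?F\<^esub>" unfolding free_module_simps by auto
    then show ?case using submodule_closed(2)[OF assms(1)] by simp
  next
    case (insert s S)
    show ?case
    proof (cases "v s = \<zero>")
      case True
      then show ?thesis using insert by (intro insert.IH) auto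
    next
      case False
      then have s: "s \<in> X" using insert.prems unfolding free_module_carrier by blast
      let ?w = "v(s := \<zero>)"
      have "{x. ?w x \<noteq> \<zero>} \<subseteq> {x. v x \<noteq> \<zero>}" by auto
      then have "finite {x. ?w x \<noteq> \<zero>}" using insert.prems unfolding free_module_carrier by (meson finite_subset)
      then have "?w \<in> carrier ?F" using insert.prems unfolding free_module_carrier by auto
      moreover have "{x. ?w x \<noteq> \<zero>} \<subseteq> S" using insert.prems(1) by auto
      ultimately have "?w \<in> N" by (intro insert.IH)
      moreover have "v s \<odot>\<^bsub>?F\<^esub> basis_vec R s \<in> N"
        using assms(2)[OF s] free_module_val[OF insert.prems(2)] by (intro submodule_closed(4)[OF assms(1)])
      ultimately have "?w \<oplus>\<^bsub>?F\<^esub> v s \<odot>\<^bsub>?F\<^esub> basis_vec R s \<in> N" by (rule submodule_closed(3)[OF assms(1)])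
      moreover have "?w \<oplus>\<^bsub>?F\<^esub> v s \<odot>\<^bsub>?F\<^esub> basis_vec R s = v"
        using free_module_val[OF insert.prems(2)] by (auto simp: free_module_simps basis_vec_def)
      ultimately show ?thesis by simp
    qed
  qed
  then show ?thesis using assms(3) unfolding free_module_carrier by (meson order_refl)
qed

lemma (in cring) free_module_lift:
  assumes M: "module R M" and g: "\<And>x. x \<in> X \<Longrightarrow> g x \<in> carrier M"
  shows "\<exists>k \<in> module_hom R (free_module R X) M. \<forall>x \<in> X. k (basis_vec R x) = g x"
proof
  interpret M: module R M by fact
  let ?F = "free_module R X"
  define k where "k v = (\<Oplus>\<^bsub>M\<^esub>x\<in>{x. v x \<noteq> \<zero>}. v x \<odot>\<^bsub>M\<^esub> g x)" for v
  have tm: "v x \<odot>\<^bsub>M\<^esub> g x \<in> carrier M" if "v \<in> carrier ?F" "x \<in> X" for v x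
    using g[OF that(2)] free_module_val[OF that(1)] by (intro M.smult_closed)
  \<comment> \<open>The sum may run over any finite set of indices containing the support, so that
    \<open>v\<close> and \<open>w\<close> below can share one index set.\<close>
  have k: "k v = (\<Oplus>\<^bsub>M\<^esub>x\<in>S. v x \<odot>\<^bsub>M\<^esub> g x)"
    if "v \<in> carrier ?F" "finite S" "{x. v x \<noteq> \<zero>} \<subseteq> S" "S \<subseteq> X" for v S
    unfolding k_def
  proof (rule M.add.finprod_mono_neutral_cong_left[OF that(2,3)])
    show "v i \<odot>\<^bsub>M\<^esub> g i = \<zero>\<^bsub>M\<^esub>" if i: "i \<in> S - {x. v x \<noteq> \<zero>}" for i
      using i g[of i] \<open>S \<subseteq> X\<close> by auto
    show "(\<lambda>x. v x \<odot>\<^bsub>M\<^esub> g x) \<in> S \<rightarrow> carrier M" using that tm by blast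
  qed simp
  have supp: "finite {x. v x \<noteq> \<zero>}" "{x. v x \<noteq> \<zero>} \<subseteq> X" if "v \<in> carrier ?F" for v
    using that unfolding free_module_carrier by auto
  interpret F: module R ?F by (rule free_module_module)
  show "k \<in> module_hom R ?F M"
  proof (rule module_homI)
    fix v assume v: "v \<in> carrier ?F"
    show "k v \<in> carrier M" unfolding k_def using supp[OF v] tm[OF v] by (intro M.finsum_closed) auto
    fix w assume w: "w \<in> carrier ?F"
    let ?S = "{x. v x \<noteq> \<zero>} \<union> {x. w x \<noteq> \<zero>}"
    have S: "finite ?S" "?S \<subseteq> X" using supp[OF v] supp[OF w] by auto
    have "k (v \<oplus>\<^bsub>?F\<^esub> w) = (\<Oplus>\<^bsub>M\<^esub>x\<in>?S. (v \<oplus>\<^bsub>?F\<^esub> w) x \<odot>\<^bsub>M\<^esub> g x)"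
    proof (rule k[OF _ S(1) _ S(2)])
      show "v \<oplus>\<^bsub>?F\<^esub> w \<in> carrier ?F" using v w by (rule F.M.a_closed)
      show "{x. (v \<oplus>\<^bsub>?F\<^esub> w) x \<noteq> \<zero>} \<subseteq> ?S" by (auto simp: free_module_simps)
    qed
    also have "\<dots> = (\<Oplus>\<^bsub>M\<^esub>x\<in>?S. v x \<odot>\<^bsub>M\<^esub> g x \<oplus>\<^bsub>M\<^esub> w x \<odot>\<^bsub>M\<^esub> g x)"
    proof (rule M.finsum_cong')
      show "(v \<oplus>\<^bsub>?F\<^esub> w) i \<odot>\<^bsub>M\<^esub> g i = v i \<odot>\<^bsub>M\<^esub> g i \<oplus>\<^bsub>M\<^esub> w i \<odot>\<^bsub>M\<^esub> g i" if "i \<in> ?S" for i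
        using that S g free_module_val[OF v, of i] free_module_val[OF w, of i] M.smult_l_distr[of "v i" "w i" "g i"]
        by (auto simp: free_module_simps)
      show "(\<lambda>x. v x \<odot>\<^bsub>M\<^esub> g x \<oplus>\<^bsub>M\<^esub> w x \<odot>\<^bsub>M\<^esub> g x) \<in> ?S \<rightarrow> carrier M"
        using tm[OF v] tm[OF w] S(2) by blast
    qed simp
    also have "\<dots> = (\<Oplus>\<^bsub>M\<^esub>x\<in>?S. v x \<odot>\<^bsub>M\<^esub> g x) \<oplus>\<^bsub>M\<^esub> (\<Oplus>\<^bsub>M\<^esub>x\<in>?S. w x \<odot>\<^bsub>M\<^esub> g x)"
      using tm[OF v] tm[OF w] S(2) by (intro M.finsum_addf) blast+
    also have "\<dots> = k v \<oplus>\<^bsub>M\<^esub> k w" using k[OF v S(1) _ S(2)] k[OF w S(1) _ S(2)] by simp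
    finally show "k (v \<oplus>\<^bsub>?F\<^esub> w) = k v \<oplus>\<^bsub>M\<^esub> k w" .
  next
    fix a v assume a: "a \<in> carrier R" and v: "v \<in> carrier ?F"
    let ?S = "{x. v x \<noteq> \<zero>}"
    have "k (a \<odot>\<^bsub>?F\<^esub> v) = (\<Oplus>\<^bsub>M\<^esub>x\<in>?S. (a \<odot>\<^bsub>?F\<^esub> v) x \<odot>\<^bsub>M\<^esub> g x)"
    proof (rule k[OF _ supp(1)[OF v] _ supp(2)[OF v]])
      show "a \<odot>\<^bsub>?F\<^esub> v \<in> carrier ?F" using a v by (rule F.smult_closed)
      show "{x. (a \<odot>\<^bsub>?F\<^esub> v) x \<noteq> \<zero>} \<subseteq> ?S" using a by (auto simp: free_module_simps)
    qed
    also have "\<dots> = (\<Oplus>\<^bsub>M\<^esub>x\<in>?S. a \<odot>\<^bsub>M\<^esub> (v x \<odot>\<^bsub>M\<^esub> g x))"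
    proof (rule M.finsum_cong')
      show "(a \<odot>\<^bsub>?F\<^esub> v) i \<odot>\<^bsub>M\<^esub> g i = a \<odot>\<^bsub>M\<^esub> (v i \<odot>\<^bsub>M\<^esub> g i)" if "i \<in> ?S" for i
        using that supp[OF v] g a free_module_val[OF v, of i] M.smult_assoc1[of a "v i" "g i"]
        by (auto simp: free_module_simps)
      show "(\<lambda>x. a \<odot>\<^bsub>M\<^esub> (v x \<odot>\<^bsub>M\<^esub> g x)) \<in> ?S \<rightarrow> carrier M"
        using tm[OF v] supp[OF v] a by blast
    qed simp
    also have "\<dots> = a \<odot>\<^bsub>M\<^esub> k v" unfolding k_def
      using supp[OF v] tm[OF v] a by (intro M.finsum_smult_ldistr[symmetric]) auto
    finally show "k (a \<odot>\<^bsub>?F\<^esub> v) = a \<odot>\<^bsub>M\<^esub> k v" .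
  qed
  show "\<forall>x \<in> X. k (basis_vec R x) = g x"
  proof
    fix x assume x: "x \<in> X"
    have "k (basis_vec R x) = (\<Oplus>\<^bsub>M\<^esub>y\<in>{x}. basis_vec R x y \<odot>\<^bsub>M\<^esub> g y)"
      using x by (intro k basis_vec_carrier) (auto simp: basis_vec_def)
    also have "\<dots> = g x" using g[OF x] by (simp add: basis_vec_def)
    finally show "k (basis_vec R x) = g x" .
  qed
qed

section \<open>Quotient modules\<close>

lemma quot_module_simps:
  "carrier (quot_module M N) = a_rcosets\<^bsub>M\<^esub> N" "\<zero>\<^bsub>quot_module M N\<^esub> = N"
  "X \<oplus>\<^bsub>quot_module M N\<^esub> Y = X <+>\<^bsub>M\<^esub> Y"
  by (simp_all add: quot_module_def)

lemma quot_module_carrier: "X \<in> carrier (quot_module M N) \<longleftrightarrow> (\<exists>x \<in> carrier M. X = N +>\<^bsub>M\<^esub> x)"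
  unfolding quot_module_simps A_RCOSETS_def' by blast

context
  fixes R :: "('a, 'r) ring_scheme" and M :: "('a, 'b, 'm) module_scheme" and N
  assumes M: "module R M" and N: "submodule N R M"
begin

interpretation M: module R M by (rule M)
interpretation N: abelian_subgroup N M
  using submodule.axioms(1)[OF N] by (intro abelian_subgroupI3 additive_subgroup.intro M.abelian_group_axioms)

lemma quot_module_coset_mem: "x \<in> carrier M \<Longrightarrow> N +>\<^bsub>M\<^esub> x \<in> carrier (quot_module M N)"
  unfolding quot_module_carrier by blast

lemma quot_module_eq_zero_iff: "x \<in> carrier M \<Longrightarrow> N +>\<^bsub>M\<^esub> x = \<zero>\<^bsub>quot_module M N\<^esub> \<longleftrightarrow> x \<in> N"
  unfolding quot_module_simps
  using M.a_coset_join1[of N x] M.a_coset_join2[of x N] N.a_subgroup by blast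

lemma quot_module_add:
  "x \<in> carrier M \<Longrightarrow> y \<in> carrier M \<Longrightarrow>
    (N +>\<^bsub>M\<^esub> x) \<oplus>\<^bsub>quot_module M N\<^esub> (N +>\<^bsub>M\<^esub> y) = N +>\<^bsub>M\<^esub> (x \<oplus>\<^bsub>M\<^esub> y)"
  unfolding quot_module_simps by (rule N.a_rcos_sum)

lemma quot_module_coset_eq_iff:
  assumes "x \<in> carrier M" "y \<in> carrier M"
  shows "N +>\<^bsub>M\<^esub> x = N +>\<^bsub>M\<^esub> y \<longleftrightarrow> x \<ominus>\<^bsub>M\<^esub> y \<in> N"
proof -
  have "x \<ominus>\<^bsub>M\<^esub> y \<in> carrier M" using assms by simp
  then have "x \<ominus>\<^bsub>M\<^esub> y \<in> N \<longleftrightarrow> N +>\<^bsub>M\<^esub> (x \<ominus>\<^bsub>M\<^esub> y) = N"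
    using quot_module_eq_zero_iff unfolding quot_module_simps by blast
  then show ?thesis
    using M.a_coset_add_inv1[of N x y] M.a_coset_add_inv2[of N x y] assms N.a_subset
    unfolding a_minus_def by blast
qed

text \<open>The union over representatives in the definition of \<open>quot_module\<close> collapses
  because all of them give the same coset.\<close>

lemma quot_module_smult:
  assumes "a \<in> carrier R" "x \<in> carrier M"
  shows "a \<odot>\<^bsub>quot_module M N\<^esub> (N +>\<^bsub>M\<^esub> x) = N +>\<^bsub>M\<^esub> (a \<odot>\<^bsub>M\<^esub> x)"
proof -
  have "N +>\<^bsub>M\<^esub> (a \<odot>\<^bsub>M\<^esub> z) = N +>\<^bsub>M\<^esub> (a \<odot>\<^bsub>M\<^esub> x)" if z: "z \<in> N +>\<^bsub>M\<^esub> x" for z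
  proof -
    obtain n where n: "n \<in> N" "z = n \<oplus>\<^bsub>M\<^esub> x" using z unfolding a_r_coset_def' by blast
    have nc: "n \<in> carrier M" using n(1) N.a_subset by blast
    have "a \<odot>\<^bsub>M\<^esub> z = a \<odot>\<^bsub>M\<^esub> n \<oplus>\<^bsub>M\<^esub> a \<odot>\<^bsub>M\<^esub> x" unfolding n(2) using nc assms by (intro M.smult_r_distr)
    moreover have "a \<odot>\<^bsub>M\<^esub> n \<in> N" using submodule_closed(4)[OF N assms(1) n(1)] .
    ultimately have "a \<odot>\<^bsub>M\<^esub> z \<in> N +>\<^bsub>M\<^esub> (a \<odot>\<^bsub>M\<^esub> x)" unfolding a_r_coset_def' by blast
    then show ?thesis using M.a_repr_independence[of _ N "a \<odot>\<^bsub>M\<^esub> x"] N.a_subgroup assms by auto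
  qed
  moreover have "x \<in> N +>\<^bsub>M\<^esub> x" by (rule N.a_rcos_self[OF assms(2)])
  ultimately have "(\<Union>z\<in>N +>\<^bsub>M\<^esub> x. N +>\<^bsub>M\<^esub> (a \<odot>\<^bsub>M\<^esub> z)) = N +>\<^bsub>M\<^esub> (a \<odot>\<^bsub>M\<^esub> x)"
    by (intro UN_constant_eq[of x] ballI)
  then show ?thesis by (simp only: quot_module_def module.simps)
qed

lemma quot_module_module: "module R (quot_module M N)"
proof (rule moduleI[OF M.R.is_cring])
  show "abelian_group (quot_module M N)"
  proof (rule abelian_groupI)
    show z: "\<zero>\<^bsub>quot_module M N\<^esub> \<in> carrier (quot_module M N)"
      using quot_module_coset_mem[OF M.M.zero_closed] quot_module_eq_zero_iff[OF M.M.zero_closed] by simp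
    fix X assume "X \<in> carrier (quot_module M N)"
    then obtain x where x: "x \<in> carrier M" "X = N +>\<^bsub>M\<^esub> x" unfolding quot_module_carrier by blast
    have z': "\<zero>\<^bsub>quot_module M N\<^esub> = N +>\<^bsub>M\<^esub> \<zero>\<^bsub>M\<^esub>"
      using quot_module_eq_zero_iff[OF M.M.zero_closed] by simp
    show "\<zero>\<^bsub>quot_module M N\<^esub> \<oplus>\<^bsub>quot_module M N\<^esub> X = X"
      unfolding x(2) z' using x(1) by (simp add: quot_module_add)
    show "\<exists>Y \<in> carrier (quot_module M N). Y \<oplus>\<^bsub>quot_module M N\<^esub> X = \<zero>\<^bsub>quot_module M N\<^esub>"
      unfolding x(2) z' using x(1) quot_module_add[of "\<ominus>\<^bsub>M\<^esub> x" x]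
      by (intro bexI[of _ "N +>\<^bsub>M\<^esub> (\<ominus>\<^bsub>M\<^esub> x)"] quot_module_coset_mem) (auto simp: M.M.l_neg)
  qed (auto simp: quot_module_carrier quot_module_add M.M.a_ac intro!: bexI)
qed (auto simp: quot_module_carrier quot_module_add quot_module_smult M.smult_l_distr M.smult_r_distr
    M.smult_assoc1 intro!: bexI M.smult_closed)

lemma quot_module_proj: "(\<lambda>x. N +>\<^bsub>M\<^esub> x) \<in> module_hom R M (quot_module M N)"
  by (rule module_homI) (auto simp: quot_module_coset_mem quot_module_add quot_module_smult)

end

section \<open>Modules of homomorphisms\<close>

lemma hom_module_simps:
  "carrier (hom_module R M N) = module_hom R M N \<inter> extensional (carrier M)"
  "\<zero>\<^bsub>hom_module R M N\<^esub> = (\<lambda>x\<in>carrier M. \<zero>\<^bsub>N\<^esub>)"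
  "g \<oplus>\<^bsub>hom_module R M N\<^esub> h = (\<lambda>x\<in>carrier M. g x \<oplus>\<^bsub>N\<^esub> h x)"
  "a \<odot>\<^bsub>hom_module R M N\<^esub> h = (\<lambda>x\<in>carrier M. a \<odot>\<^bsub>N\<^esub> h x)"
  by (simp_all add: hom_module_def)

lemma restrict_hom:
  assumes "module R M" "h \<in> module_hom R M N"
  shows "restrict h (carrier M) \<in> carrier (hom_module R M N)"
proof -
  interpret M: module R M by fact
  show ?thesis unfolding hom_module_simps using module_homD[OF assms(2)] by (auto intro!: module_homI)
qed

lemma hom_module_module:
  assumes "module R M" "module R N" shows "module R (hom_module R M N)"
proof -
  interpret M: module R M by fact
  interpret N: module R N by fact
  let ?H = "hom_module R M N"
  have hD: "h \<in> module_hom R M N" "h \<in> extensional (carrier M)" if "h \<in> carrier ?H" for h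
    using that unfolding hom_module_simps by auto
  note h = module_homD[OF hD(1)]
  have add: "g \<oplus>\<^bsub>?H\<^esub> h \<in> carrier ?H" if "g \<in> carrier ?H" "h \<in> carrier ?H" for g h
  proof -
    have "(\<lambda>x. g x \<oplus>\<^bsub>N\<^esub> h x) \<in> module_hom R M N"
      using h[OF that(1)] h[OF that(2)] by (intro module_homI) (auto simp: N.a_ac N.smult_r_distr)
    from restrict_hom[OF assms(1) this] show ?thesis unfolding hom_module_simps(3) .
  qed
  have smult: "a \<odot>\<^bsub>?H\<^esub> h \<in> carrier ?H" if "a \<in> carrier R" "h \<in> carrier ?H" for a h
  proof -
    have "(\<lambda>x. a \<odot>\<^bsub>N\<^esub> h x) \<in> module_hom R M N"
    proof (rule module_homI)
      fix b x assume b: "b \<in> carrier R" "x \<in> carrier M"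
      then have "a \<odot>\<^bsub>N\<^esub> (b \<odot>\<^bsub>N\<^esub> h x) = (b \<otimes>\<^bsub>R\<^esub> a) \<odot>\<^bsub>N\<^esub> h x"
        using N.smult_assoc1[of a b "h x"] h(1)[OF that(2)] that(1) M.R.m_comm[of a b] by simp
      then show "a \<odot>\<^bsub>N\<^esub> h (b \<odot>\<^bsub>M\<^esub> x) = b \<odot>\<^bsub>N\<^esub> (a \<odot>\<^bsub>N\<^esub> h x)"
        using N.smult_assoc1[of b a "h x"] h(1,3)[OF that(2)] that(1) b by simp
    qed (use h[OF that(2)] that(1) in \<open>auto simp: N.smult_r_distr\<close>)
    from restrict_hom[OF assms(1) this] show ?thesis unfolding hom_module_simps(4) .
  qed
  have zero: "\<zero>\<^bsub>?H\<^esub> \<in> carrier ?H"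
    unfolding hom_module_simps(2) by (rule restrict_hom[OF assms(1)], rule module_homI) auto
  have val: "h x \<in> carrier N" if "h \<in> carrier ?H" "x \<in> carrier M" for h x using h(1)[OF that] .
  have eqI: "g = h" if "g \<in> carrier ?H" "h \<in> carrier ?H" "\<And>x. x \<in> carrier M \<Longrightarrow> g x = h x" for g h
    by (rule extensionalityI[OF hD(2)[OF that(1)] hD(2)[OF that(2)] that(3)])
  show ?thesis
  proof (rule moduleI[OF M.R.is_cring])
    show "abelian_group ?H"
    proof (rule abelian_groupI)
      fix h assume hh: "h \<in> carrier ?H"
      show "\<exists>w \<in> carrier ?H. w \<oplus>\<^bsub>?H\<^esub> h = \<zero>\<^bsub>?H\<^esub>"
      proof (rule bexI)
        show c: "(\<ominus>\<^bsub>R\<^esub> \<one>\<^bsub>R\<^esub>) \<odot>\<^bsub>?H\<^esub> h \<in> carrier ?H" using hh by (intro smult) auto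
        have "(\<ominus>\<^bsub>R\<^esub> \<one>\<^bsub>R\<^esub>) \<odot>\<^bsub>N\<^esub> h x \<oplus>\<^bsub>N\<^esub> h x = \<zero>\<^bsub>N\<^esub>" if "x \<in> carrier M" for x
          using N.smult_l_minus[of "\<one>\<^bsub>R\<^esub>" "h x"] val[OF hh that] by (simp add: N.M.l_neg)
        then show "(\<ominus>\<^bsub>R\<^esub> \<one>\<^bsub>R\<^esub>) \<odot>\<^bsub>?H\<^esub> h \<oplus>\<^bsub>?H\<^esub> h = \<zero>\<^bsub>?H\<^esub>"
          by (intro eqI add c hh zero) (simp add: hom_module_simps)
      qed
    next
      fix g h k assume "g \<in> carrier ?H" "h \<in> carrier ?H" "k \<in> carrier ?H"
      then show "g \<oplus>\<^bsub>?H\<^esub> h \<oplus>\<^bsub>?H\<^esub> k = g \<oplus>\<^bsub>?H\<^esub> (h \<oplus>\<^bsub>?H\<^esub> k)"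
        by (intro eqI add) (auto simp: hom_module_simps(3) val N.M.a_assoc)
    next
      fix g h assume "g \<in> carrier ?H" "h \<in> carrier ?H"
      then show "g \<oplus>\<^bsub>?H\<^esub> h = h \<oplus>\<^bsub>?H\<^esub> g"
        by (intro eqI add) (auto simp: hom_module_simps(3) val N.M.a_comm)
    next
      fix h assume "h \<in> carrier ?H"
      then show "\<zero>\<^bsub>?H\<^esub> \<oplus>\<^bsub>?H\<^esub> h = h"
        by (intro eqI add zero) (auto simp: hom_module_simps(2,3) val)
    qed (use add zero in auto)
    show "(a \<oplus>\<^bsub>R\<^esub> b) \<odot>\<^bsub>?H\<^esub> h = a \<odot>\<^bsub>?H\<^esub> h \<oplus>\<^bsub>?H\<^esub> b \<odot>\<^bsub>?H\<^esub> h"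
      if "a \<in> carrier R" "b \<in> carrier R" "h \<in> carrier ?H" for a b h
      using that by (intro eqI add smult) (auto simp: hom_module_simps(3,4) val N.smult_l_distr)
    show "a \<odot>\<^bsub>?H\<^esub> (g \<oplus>\<^bsub>?H\<^esub> h) = a \<odot>\<^bsub>?H\<^esub> g \<oplus>\<^bsub>?H\<^esub> a \<odot>\<^bsub>?H\<^esub> h"
      if "a \<in> carrier R" "g \<in> carrier ?H" "h \<in> carrier ?H" for a g h
      using that by (intro eqI add smult) (auto simp: hom_module_simps(3,4) val N.smult_r_distr)
    show "(a \<otimes>\<^bsub>R\<^esub> b) \<odot>\<^bsub>?H\<^esub> h = a \<odot>\<^bsub>?H\<^esub> (b \<odot>\<^bsub>?H\<^esub> h)"
      if "a \<in> carrier R" "b \<in> carrier R" "h \<in> carrier ?H" for a b h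
      using that by (intro eqI add smult) (auto simp: hom_module_simps(4) val N.smult_assoc1)
    show "\<one>\<^bsub>R\<^esub> \<odot>\<^bsub>?H\<^esub> h = h" if "h \<in> carrier ?H" for h
      using that by (intro eqI smult) (auto simp: hom_module_simps(4) val)
  qed (use smult in auto)
qed

section \<open>Finite generation\<close>

lemma gen_submodule_image:
  assumes M: "module R M" and E: "module R E" and h: "h \<in> module_hom R M E" and A: "A \<subseteq> carrier M"
  shows "h ` gen_submodule R M A = gen_submodule R E (h ` A)"
proof
  have hA: "h ` A \<subseteq> carrier E" using module_homD(1)[OF h] A by auto
  note gM = gen_submodule_submodule[OF M A] and gE = gen_submodule_submodule[OF E hA]
  have "gen_submodule R M A \<subseteq> {x \<in> carrier M. h x \<in> gen_submodule R E (h ` A)}"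
    using submodule_preimage[OF M E h gE(1)] gE(2) A by (intro gen_submodule_minimal) auto
  then show "h ` gen_submodule R M A \<subseteq> gen_submodule R E (h ` A)" by blast
  show "gen_submodule R E (h ` A) \<subseteq> h ` gen_submodule R M A"
    using gM(2) by (intro gen_submodule_minimal submodule_image[OF M E h gM(1)]) auto
qed

lemma finitely_generated_image:
  assumes "finitely_generated R M" "module R E" "h \<in> module_hom R M E" "h ` carrier M = carrier E"
  shows "finitely_generated R E"
proof -
  obtain A where A: "module R M" "A \<subseteq> carrier M" "finite A" "gen_submodule R M A = carrier M"
    using assms(1) unfolding finitely_generated_def by blast
  have "gen_submodule R E (h ` A) = carrier E"
    using gen_submodule_image[OF A(1) assms(2,3) A(2)] A(4) assms(4) by simp
  then show ?thesis unfolding finitely_generated_def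
    using A(2,3) assms(2,4) by (intro conjI exI[of _ "h ` A"]) auto
qed

lemma (in cring) submodule_free_mono:
  assumes "X \<subseteq> Y" "submodule N R (free_module R Y)"
  shows "submodule (N \<inter> carrier (free_module R X)) R (free_module R X)"
proof -
  interpret F: module R "free_module R X" by (rule free_module_module)
  have "v \<oplus>\<^bsub>free_module R X\<^esub> w \<in> N" if "v \<in> N" "w \<in> N" for v w
    using submodule_closed(3)[OF assms(2) that] unfolding free_module_simps .
  moreover have "a \<odot>\<^bsub>free_module R X\<^esub> v \<in> N" if "a \<in> carrier R" "v \<in> N" for a v
    using submodule_closed(4)[OF assms(2) that] unfolding free_module_simps .
  moreover have "\<zero>\<^bsub>free_module R X\<^esub> \<in> N"
    using submodule_closed(2)[OF assms(2)] unfolding free_module_simps .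
  ultimately show ?thesis by (intro submoduleI'[OF free_module_module]) auto
qed

text \<open>Induction on the rank. The last coordinates of \<open>K\<close> form a finitely
  generated ideal; lifts of its generators, together with generators of the part of \<open>K\<close>
  with last coordinate 0, generate \<open>K\<close>.\<close>

lemma (in noetherian_cring) submodule_free_finite_gen:
  assumes "submodule K R (free_module R {..<n::nat})"
  shows "\<exists>A \<subseteq> K. finite A \<and> gen_submodule R (free_module R {..<n}) A = K"
  using assms
proof (induction n arbitrary: K)
  case 0
  let ?F = "free_module R {..<0::nat}"
  have z: "v = \<zero>\<^bsub>?F\<^esub>" if "v \<in> carrier ?F" for v
    using that unfolding free_module_carrier free_module_simps by auto
  have "gen_submodule R ?F {} \<subseteq> K" using 0 by (intro gen_submodule_minimal) auto
  moreover have "K \<subseteq> gen_submodule R ?F {}"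
    using submodule_closed(2)[OF gen_submodule_submodule(1)[OF free_module_module[of "{..<0::nat}"], of "{}"]]
      z submodule_closed(1)[OF 0] by auto
  ultimately show ?case by (intro exI[of _ "{}"]) auto
next
  case (Suc n)
  let ?F = "free_module R {..<Suc n}" and ?G = "free_module R {..<n}"
  interpret F: module R ?F by (rule free_module_module)
  note K = submodule_closed[OF Suc.prems]
  have Fc: "v \<in> carrier ?F" if "v \<in> carrier ?G" for v using that unfolding free_module_carrier by (auto simp: less_Suc_eq)
  have Gc: "v \<in> carrier ?G" if "v \<in> carrier ?F" "v n = \<zero>" for v
  proof -
    have "v x = \<zero>" if "x \<notin> {..<n}" for x
      using that \<open>v \<in> carrier ?F\<close> \<open>v n = \<zero>\<close> unfolding free_module_carrier by (cases "x = n") auto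
    then show ?thesis using that(1) unfolding free_module_carrier by auto
  qed
  define coef where "coef N = (\<lambda>v. v n) ` N" for N :: "(nat \<Rightarrow> 'a) set"
  have coef_ideal: "ideal (coef N) R" if N: "submodule N R ?F" for N
  proof -
    note Nc = submodule_closed[OF N]
    have sub: "coef N \<subseteq> carrier R"
      unfolding coef_def using free_module_val[OF subsetD[OF Nc(1)]] by (rule image_subsetI)
    have mult: "r \<otimes> a \<in> coef N" if "a \<in> coef N" "r \<in> carrier R" for a r
    proof -
      from that obtain v where "v \<in> N" "a = v n" unfolding coef_def by blast
      then show ?thesis using Nc(4)[OF that(2), of v] unfolding coef_def free_module_simps
        by (intro image_eqI[of _ _ "\<lambda>x. r \<otimes> v x"]) auto
    qed
    show ?thesis
    proof (rule idealI[OF ring_axioms])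
      show "subgroup (coef N) (add_monoid R)"
      proof (rule add.subgroupI[OF sub])
        show "coef N \<noteq> {}" unfolding coef_def using Nc(2) by blast
        show "\<ominus> a \<in> coef N" if "a \<in> coef N" for a
        proof -
          have "a \<in> carrier R" using that sub by blast
          then show ?thesis using mult[OF that, of "\<ominus> \<one>"] by (simp add: l_minus)
        qed
        show "a \<oplus> b \<in> coef N" if "a \<in> coef N" "b \<in> coef N" for a b
        proof -
          from that obtain v w where "v \<in> N" "a = v n" "w \<in> N" "b = w n" unfolding coef_def by blast
          then show ?thesis using Nc(3)[of v w] unfolding coef_def free_module_simps
            by (intro image_eqI[of _ _ "\<lambda>x. v x \<oplus> w x"]) auto
        qed
      qed
      show "x \<otimes> a \<in> coef N" if "a \<in> coef N" "x \<in> carrier R" for a x by (rule mult[OF that])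
      show "a \<otimes> x \<in> coef N" if "a \<in> coef N" "x \<in> carrier R" for a x
        unfolding m_comm[OF subsetD[OF sub that(1)] that(2)] by (rule mult[OF that])
    qed
  qed
  obtain B where B: "B \<subseteq> carrier R" "finite B" "coef K = Idl B"
    using finetely_gen[OF coef_ideal[OF Suc.prems]] by blast
  have "B \<subseteq> coef K" unfolding B(3) by (rule genideal_self[OF B(1)])
  then have "\<exists>C. C \<subseteq> K \<and> finite C \<and> B = (\<lambda>v. v n) ` C"
    unfolding coef_def using B(2) by (meson finite_subset_image)
  then obtain C where C: "C \<subseteq> K" "finite C" "B = (\<lambda>v. v n) ` C" by blast
  have K': "submodule (K \<inter> carrier ?G) R ?G" using Suc.prems by (intro submodule_free_mono[of _ "{..<Suc n}"]) auto
  obtain A where A: "A \<subseteq> K \<inter> carrier ?G" "finite A" "gen_submodule R ?G A = K \<inter> carrier ?G"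
    using Suc.IH[OF K'] by blast
  let ?D = "A \<union> C"
  have Dc: "?D \<subseteq> K" using A C by blast
  then have DF: "?D \<subseteq> carrier ?F" using K(1) by blast
  note g = gen_submodule_submodule[OF F.module_axioms DF]
  let ?N = "gen_submodule R ?F ?D"
  have NK: "?N \<subseteq> K" by (rule gen_submodule_minimal[OF Suc.prems Dc])
  moreover have "K \<subseteq> ?N"
  proof
    fix v assume v: "v \<in> K"
    have "Idl B \<subseteq> coef ?N"
      using coef_ideal[OF g(1)] g(2) unfolding C(3) coef_def by (intro genideal_minimal) auto
    then have "v n \<in> coef ?N" using v B(3) unfolding coef_def by blast
    \<comment> \<open>Subtracting an element of \<open>?N\<close> with the same last coordinate
      leaves an element of smaller rank, to which the induction hypothesis applies.\<close>
    then obtain w where w: "w \<in> ?N" "v n = w n" unfolding coef_def by blast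
    have wK: "w \<in> K" using w NK by blast
    have m: "v \<ominus>\<^bsub>?F\<^esub> w \<in> K" by (rule submodule_minus_closed[OF Suc.prems v wK])
    have c: "v \<in> carrier ?F" "w \<in> carrier ?F" using v wK K(1) by auto
    have "(v \<ominus>\<^bsub>?F\<^esub> w) \<oplus>\<^bsub>?F\<^esub> w = v" using c by (simp add: F.M.minus_eq F.M.a_assoc F.M.l_neg)
    then have e: "(v \<ominus>\<^bsub>?F\<^esub> w) n \<oplus> w n = w n" using w(2) unfolding free_module_simps by (metis (mono_tags))
    have "(v \<ominus>\<^bsub>?F\<^esub> w) n = \<zero>"
      using e free_module_val[of "v \<ominus>\<^bsub>?F\<^esub> w" _ n] free_module_val[OF c(2), of n] m K(1)
      by (metis (no_types, lifting) add.r_cancel_one subsetD)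
    then have "v \<ominus>\<^bsub>?F\<^esub> w \<in> K \<inter> carrier ?G" using Gc m K(1) by blast
    moreover have "gen_submodule R ?G A \<subseteq> ?N \<inter> carrier ?G"
      using g(2) A(1) by (intro gen_submodule_minimal submodule_free_mono[OF _ g(1)]) auto
    ultimately have "v \<ominus>\<^bsub>?F\<^esub> w \<in> ?N" using A(3) by blast
    then have "(v \<ominus>\<^bsub>?F\<^esub> w) \<oplus>\<^bsub>?F\<^esub> w \<in> ?N" using w(1) by (intro submodule_closed(3)[OF g(1)])
    then show "v \<in> ?N" unfolding \<open>(v \<ominus>\<^bsub>?F\<^esub> w) \<oplus>\<^bsub>?F\<^esub> w = v\<close> .
  qed
  ultimately show ?case using Dc A(2) C(2) by (intro exI[of _ ?D]) auto
qed

lemma (in cring) finite_gen_cover: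
  assumes M: "module R M" and A: "A \<subseteq> carrier M" "finite A"
  shows "\<exists>m. \<exists>k \<in> module_hom R (free_module R {..<m::nat}) M.
    k ` carrier (free_module R {..<m}) = gen_submodule R M A"
proof -
  obtain as where as: "set as = A" using A(2) finite_list by blast
  let ?m = "length as"
  let ?F = "free_module R {..<?m}"
  have "as ! i \<in> carrier M" if "i \<in> {..<?m}" for i using that as A(1) nth_mem by fastforce
  then obtain k where k: "k \<in> module_hom R ?F M" "\<And>i. i \<in> {..<?m} \<Longrightarrow> k (basis_vec R i) = as ! i"
    using free_module_lift[OF M, of "{..<?m}" "\<lambda>i. as ! i"] by blast
  let ?B = "basis_vec R ` {..<?m}"
  have Bc: "?B \<subseteq> carrier ?F" by (intro image_subsetI basis_vec_carrier)
  note g = gen_submodule_submodule[OF free_module_module Bc]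
  have "gen_submodule R ?F ?B = carrier ?F"
    using free_module_in_submodule[OF g(1)] g(2) submodule_closed(1)[OF g(1)] by blast
  moreover have "k ` ?B = A"
  proof -
    have "k ` ?B = (\<lambda>i. as ! i) ` {..<?m}" using k(2) by (force simp: image_iff)
    also have "\<dots> = A" using as by (auto simp: set_conv_nth)
    finally show ?thesis .
  qed
  ultimately have "k ` carrier ?F = gen_submodule R M A"
    using gen_submodule_image[OF free_module_module M k(1) Bc] by simp
  then show ?thesis using k(1) by blast
qed

lemma (in noetherian_cring) submodule_free_cover:
  assumes "submodule K R (free_module R {..<n::nat})"
  shows "\<exists>m. \<exists>k \<in> module_hom R (free_module R {..<m::nat}) (free_module R {..<n}).
    k ` carrier (free_module R {..<m}) = K"
proof -
  obtain A where A: "A \<subseteq> K" "finite A" "gen_submodule R (free_module R {..<n}) A = K"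
    using submodule_free_finite_gen[OF assms] by blast
  then show ?thesis using finite_gen_cover[OF free_module_module, of A "{..<n}"] submodule_closed(1)[OF assms] by auto
qed

lemma (in cring) free_module_finitely_generated: "finitely_generated R (free_module R {..<n::nat})"
proof -
  let ?F = "free_module R {..<n}" and ?B = "basis_vec R ` {..<n}"
  have Bc: "?B \<subseteq> carrier ?F" by (intro image_subsetI basis_vec_carrier)
  note g = gen_submodule_submodule[OF free_module_module Bc]
  have "gen_submodule R ?F ?B = carrier ?F"
    using free_module_in_submodule[OF g(1)] g(2) submodule_closed(1)[OF g(1)] by blast
  then show ?thesis unfolding finitely_generated_def using Bc free_module_module by blast
qed

lemma (in noetherian_cring) finitely_generated_of_inj:
  assumes M: "module R M" and e: "e \<in> module_hom R M (free_module R {..<n::nat})" "inj_on e (carrier M)"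
  shows "finitely_generated R M"
proof -
  let ?F = "free_module R {..<n}"
  have "submodule (e ` carrier M) R ?F"
    by (rule submodule_image[OF M free_module_module e(1) module.carrier_is_submodule[OF M]])
  then obtain A where A: "A \<subseteq> e ` carrier M" "finite A" "gen_submodule R ?F A = e ` carrier M"
    using submodule_free_finite_gen by metis
  obtain B where B: "B \<subseteq> carrier M" "finite B" "A = e ` B" using finite_subset_image[OF A(2,1)] by blast
  note g = gen_submodule_submodule[OF M B(1)]
  have "e ` gen_submodule R M B = e ` carrier M"
    using gen_submodule_image[OF M free_module_module e(1) B(1)] A(3) B(3) by simp
  then have "gen_submodule R M B = carrier M"
    using inj_on_image_eq_iff[OF e(2) submodule_closed(1)[OF g(1)] order_refl] by simp
  then show ?thesis unfolding finitely_generated_def using M B by blast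
qed

section \<open>Projective modules and resolutions\<close>

text \<open>\<open>projective_module\<close> asks for an index set in the element type of the
  module, so the index \<open>i\<close> is replaced by the vector
  \<open>basis_vec R i\<close>.\<close>

lemma (in cring) free_module_projective: "projective_module R (free_module R {..<n::nat})"
proof -
  let ?F = "free_module R {..<n}" and ?X = "basis_vec R ` {..<n} :: (nat \<Rightarrow> 'a) set"
  let ?G = "free_module R ?X"
  have "\<exists>q \<in> module_hom R ?G ?F. \<forall>x \<in> ?X. q (basis_vec R x) = x"
    by (intro free_module_lift free_module_module) (auto intro: basis_vec_carrier)
  then obtain q where q: "q \<in> module_hom R ?G ?F" "\<And>x. x \<in> ?X \<Longrightarrow> q (basis_vec R x) = x" by blast
  have "\<exists>s \<in> module_hom R ?F ?G. \<forall>i \<in> {..<n}. s (basis_vec R i) = basis_vec R (basis_vec R i)"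
    by (intro free_module_lift free_module_module) (auto intro: basis_vec_carrier)
  then obtain s where s: "s \<in> module_hom R ?F ?G"
    "\<And>i. i \<in> {..<n} \<Longrightarrow> s (basis_vec R i) = basis_vec R (basis_vec R i)" by blast
  have id: "(\<lambda>x. x) \<in> module_hom R ?F ?F" by (rule module_homI) auto
  have sub: "submodule {v \<in> carrier ?F. q (s v) = v} R ?F"
    by (rule submodule_equalizer[OF free_module_module free_module_module module_hom_comp[OF s(1) q(1)] id])
  have "basis_vec R i \<in> {v \<in> carrier ?F. q (s v) = v}" if "i \<in> {..<n}" for i
    using basis_vec_carrier[OF that] s(2)[OF that] q(2)[of "basis_vec R i"] that by simp
  then have "q (s v) = v" if "v \<in> carrier ?F" for v
    using free_module_in_submodule[OF sub _ that] by blast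
  then have "\<forall>x \<in> carrier ?F. q (s x) = x" by simp
  then have "\<exists>s \<in> module_hom R ?F ?G. \<exists>q \<in> module_hom R ?G ?F. \<forall>x \<in> carrier ?F. q (s x) = x"
    by (intro bexI[where x = s] bexI[where x = q] q(1) s(1))
  then show ?thesis unfolding projective_module_def by (intro conjI free_module_module exI[where x = ?X])
qed

text \<open>The lift is built on the free module of which \<open>P\<close> is a summand, where
  values on the basis can be chosen freely. Inclusion of images, instead of surjectivity of
  \<open>al\<close>, suits exact sequences.\<close>

lemma projective_lift:
  fixes P :: "('a, 'p, 'm) module_scheme"
  assumes P: "projective_module R P" and A: "module R A" and B: "module R B"
    and h: "h \<in> module_hom R P B" and al: "al \<in> module_hom R A B" and im: "h ` carrier P \<subseteq> al ` carrier A"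
  shows "\<exists>k \<in> module_hom R P A. \<forall>x \<in> carrier P. al (k x) = h x"
proof -
  obtain X :: "'p set" and s q where Pm: "module R P" and s: "s \<in> module_hom R P (free_module R X)"
    and q: "q \<in> module_hom R (free_module R X) P" and qs: "\<And>x. x \<in> carrier P \<Longrightarrow> q (s x) = x"
    using P unfolding projective_module_def by blast
  interpret cring R by (rule module_cring[OF A])
  let ?F = "free_module R X"
  have "\<exists>a. a \<in> carrier A \<and> al a = h (q (basis_vec R x))" if "x \<in> X" for x
  proof -
    have "q (basis_vec R x) \<in> carrier P" using module_homD(1)[OF q basis_vec_carrier[OF that]] .
    then have "h (q (basis_vec R x)) \<in> al ` carrier A" using im by blast
    then show ?thesis by (metis imageE)
  qed
  then obtain g where g: "\<And>x. x \<in> X \<Longrightarrow> g x \<in> carrier A \<and> al (g x) = h (q (basis_vec R x))" by metis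
  then obtain k where k: "k \<in> module_hom R ?F A" "\<And>x. x \<in> X \<Longrightarrow> k (basis_vec R x) = g x"
    using free_module_lift[OF A, of X g] by blast
  have sub: "submodule {v \<in> carrier ?F. al (k v) = h (q v)} R ?F"
    by (rule submodule_equalizer[OF free_module_module B module_hom_comp[OF k(1) al] module_hom_comp[OF q h]])
  have "basis_vec R x \<in> {v \<in> carrier ?F. al (k v) = h (q v)}" if "x \<in> X" for x
    using basis_vec_carrier[OF that] g[OF that] k(2)[OF that] by simp
  then have "al (k v) = h (q v)" if "v \<in> carrier ?F" for v
    using free_module_in_submodule[OF sub _ that] by blast
  then have "al (k (s x)) = h x" if "x \<in> carrier P" for x
    using that module_homD(1)[OF s that] qs by simp
  then show ?thesis using module_hom_comp[OF s k(1)] by (intro bexI[of _ "\<lambda>x. k (s x)"]) auto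
qed

text \<open>Kernels inside finite free modules are images of finite free modules, so ranks and
  differentials can be chosen step by step.\<close>

lemma (in noetherian_cring) ex_free_resolution:
  assumes M: "module R M"
    and ep: "ep \<in> module_hom R (free_module R {..<n::nat}) M" "ep ` carrier (free_module R {..<n}) = carrier M"
  shows "\<exists>m d. projective_resolution R M (\<lambda>i. free_module R {..<m i :: nat}) d ep"
proof -
  let ?F = "\<lambda>n :: nat. free_module R {..<n}"
  \<comment> \<open>A state of the recursion is (rank of the target, rank of the source, map);
    \<open>nxt\<close> below matches the ranks and demands exactness at the common module.\<close>
  define ok where "ok i x \<longleftrightarrow> (case x of (a, b, \<delta>) \<Rightarrow> \<delta> \<in> module_hom R (?F b) (?F a) \<and>
      (i = 0 \<longrightarrow> a = n \<and> \<delta> ` carrier (?F b) = {x \<in> carrier (?F n). ep x = \<zero>\<^bsub>M\<^esub>}))"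
    for i :: nat and x :: "nat \<times> nat \<times> ((nat \<Rightarrow> 'a) \<Rightarrow> nat \<Rightarrow> 'a)"
  define nxt where "nxt i x y \<longleftrightarrow> (case x of (a, b, \<delta>) \<Rightarrow> case y of (a', b', \<delta>') \<Rightarrow> a' = b \<and>
      \<delta>' ` carrier (?F b') = {x \<in> carrier (?F b). \<delta> x = \<zero>\<^bsub>?F a\<^esub>})"
    for i :: nat and x y :: "nat \<times> nat \<times> ((nat \<Rightarrow> 'a) \<Rightarrow> nat \<Rightarrow> 'a)"
  have "\<exists>x. ok 0 x"
    using submodule_free_cover[OF submodule_kernel[OF free_module_module M ep(1)]] unfolding ok_def by auto
  moreover have "\<exists>y. ok (Suc i) y \<and> nxt i x y" if "ok i x" for i x
  proof -
    obtain a b \<delta> where x: "x = (a, b, \<delta>)" by (metis surj_pair)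
    have "\<delta> \<in> module_hom R (?F b) (?F a)" using that x unfolding ok_def by simp
    from submodule_free_cover[OF submodule_kernel[OF free_module_module free_module_module this]]
    obtain m k where "k \<in> module_hom R (?F m) (?F b)" "k ` carrier (?F m) = {x \<in> carrier (?F b). \<delta> x = \<zero>\<^bsub>?F a\<^esub>}"
      by blast
    then show ?thesis unfolding ok_def nxt_def x by (intro exI[of _ "(b, m, k)"]) simp
  qed
  ultimately obtain x where x: "\<And>i. ok i (x i)" "\<And>i. nxt i (x i) (x (Suc i))"
    using dependent_nat_choice[of ok nxt] by metis
  define m where "m i = fst (x i)" for i
  define d where "d i = snd (snd (x i))" for i
  have m: "fst (snd (x i)) = m (Suc i)" for i using x(2)[of i] unfolding nxt_def m_def by (auto split: prod.splits)
  have xi: "x i = (m i, m (Suc i), d i)" for i unfolding m[symmetric] unfolding m_def d_def by simp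
  have "d i \<in> module_hom R (?F (m (Suc i))) (?F (m i))" for i using x(1)[of i] unfolding xi ok_def by simp
  moreover have "m 0 = n" "d 0 ` carrier (?F (m 1)) = {x \<in> carrier (?F n). ep x = \<zero>\<^bsub>M\<^esub>}"
    using x(1)[of 0] unfolding xi ok_def by simp_all
  moreover have "d (Suc i) ` carrier (?F (m (Suc (Suc i)))) =
      {x \<in> carrier (?F (m (Suc i))). d i x = \<zero>\<^bsub>?F (m i)\<^esub>}" for i
    using x(2)[of i] unfolding xi nxt_def by simp
  ultimately have "projective_resolution R M (\<lambda>i. free_module R {..<m i}) d ep"
    unfolding projective_resolution_def using free_module_projective ep by simp
  then show ?thesis by blast
qed

section \<open>Comparison of projective resolutions\<close>

lemma module_hom_diff:
  assumes "module R M" "module R N" "h \<in> module_hom R M N" "g \<in> module_hom R M N"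
  shows "(\<lambda>x. h x \<ominus>\<^bsub>N\<^esub> g x) \<in> module_hom R M N"
proof -
  interpret M: module R M by fact
  interpret N: module R N by fact
  note h = module_homD[OF assms(3)] and g = module_homD[OF assms(4)]
  show ?thesis
  proof (rule module_homI)
    fix x y assume x: "x \<in> carrier M" and y: "y \<in> carrier M"
    show "h x \<ominus>\<^bsub>N\<^esub> g x \<in> carrier N" using h(1)[OF x] g(1)[OF x] by simp
    have "(h x \<oplus>\<^bsub>N\<^esub> h y) \<ominus>\<^bsub>N\<^esub> (g x \<oplus>\<^bsub>N\<^esub> g y) = (h x \<ominus>\<^bsub>N\<^esub> g x) \<oplus>\<^bsub>N\<^esub> (h y \<ominus>\<^bsub>N\<^esub> g y)"
      using h(1)[OF x] h(1)[OF y] g(1)[OF x] g(1)[OF y]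
      by (simp add: N.M.minus_eq N.M.minus_add N.M.a_ac)
    then show "h (x \<oplus>\<^bsub>M\<^esub> y) \<ominus>\<^bsub>N\<^esub> g (x \<oplus>\<^bsub>M\<^esub> y) = (h x \<ominus>\<^bsub>N\<^esub> g x) \<oplus>\<^bsub>N\<^esub> (h y \<ominus>\<^bsub>N\<^esub> g y)"
      using h(2)[OF x y] g(2)[OF x y] by simp
  next
    fix a x assume a: "a \<in> carrier R" and x: "x \<in> carrier M"
    show "h (a \<odot>\<^bsub>M\<^esub> x) \<ominus>\<^bsub>N\<^esub> g (a \<odot>\<^bsub>M\<^esub> x) = a \<odot>\<^bsub>N\<^esub> (h x \<ominus>\<^bsub>N\<^esub> g x)"
      using h(1,3) g(1,3) a x by (simp add: N.M.minus_eq N.smult_r_distr N.smult_r_minus)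
  qed
qed

text \<open>Cycles in degree \<open>n\<close>, with the augmentation in the role of the differential
  leaving degree 0, so that exactness has the same form in all degrees.\<close>

definition res_cycle :: "('a, 'b, 'm) module_scheme \<Rightarrow> (nat \<Rightarrow> ('a, 'p) module)
    \<Rightarrow> (nat \<Rightarrow> 'p \<Rightarrow> 'p) \<Rightarrow> ('p \<Rightarrow> 'b) \<Rightarrow> nat \<Rightarrow> 'p \<Rightarrow> bool" where
  "res_cycle M P d ep n x \<longleftrightarrow> (case n of 0 \<Rightarrow> ep x = \<zero>\<^bsub>M\<^esub> | Suc m \<Rightarrow> d m x = \<zero>\<^bsub>P m\<^esub>)"

lemma projective_resolutionD:
  assumes "projective_resolution R M P d ep"
  shows "projective_module R (P n)" "module R (P n)" "ep \<in> module_hom R (P 0) M"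
    "d n \<in> module_hom R (P (Suc n)) (P n)" "ep ` carrier (P 0) = carrier M"
    "d n ` carrier (P (Suc n)) = {x \<in> carrier (P n). res_cycle M P d ep n x}"
  using assms unfolding projective_resolution_def projective_module_def res_cycle_def
  by (auto split: nat.splits) (cases n; force)+

lemma projective_resolution_dd:
  assumes "projective_resolution R M P d ep" "x \<in> carrier (P (Suc (Suc n)))"
  shows "d n (d (Suc n) x) = \<zero>\<^bsub>P n\<^esub>"
  using projective_resolutionD(6)[OF assms(1), of "Suc n"] assms(2) unfolding res_cycle_def by auto

lemma resolution_comparison:
  assumes P: "projective_resolution R M P d ep" and Q: "projective_resolution R M Q d' ep'"
    and M: "module R M"
  shows "\<exists>f. (\<forall>n. f n \<in> module_hom R (P n) (Q n)) \<and> (\<forall>x \<in> carrier (P 0). ep' (f 0 x) = ep x) \<and>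
    (\<forall>n. \<forall>x \<in> carrier (P (Suc n)). d' n (f (Suc n) x) = f n (d n x))"
proof -
  note p = projective_resolutionD[OF P] and q = projective_resolutionD[OF Q]
  \<comment> \<open>That \<open>f\<close> preserves cycles is carried along, because it puts the
    next composite into the image of \<open>d' n\<close>, from where it can be lifted.\<close>
  define ok where "ok n f \<longleftrightarrow> f \<in> module_hom R (P n) (Q n) \<and>
     (\<forall>x \<in> carrier (P n). res_cycle M P d ep n x \<longrightarrow> res_cycle M Q d' ep' n (f x)) \<and>
     (n = 0 \<longrightarrow> (\<forall>x \<in> carrier (P 0). ep' (f x) = ep x))" for n f
  have "\<exists>f. ok 0 f"
  proof -
    have "ep ` carrier (P 0) \<subseteq> ep' ` carrier (Q 0)" using p(5) q(5) by simp
    from projective_lift[OF p(1) q(2) M p(3) q(3) this] show ?thesis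
      unfolding ok_def res_cycle_def by auto
  qed
  moreover have "\<exists>g. ok (Suc n) g \<and> (\<forall>x \<in> carrier (P (Suc n)). d' n (g x) = f (d n x))" if f: "ok n f" for n f
  proof -
    have fh: "f \<in> module_hom R (P n) (Q n)" using f unfolding ok_def by blast
    have "(\<lambda>x. f (d n x)) ` carrier (P (Suc n)) \<subseteq> d' n ` carrier (Q (Suc n))"
      using p(6)[of n] f module_homD(1)[OF fh] unfolding q(6) ok_def by auto
    from projective_lift[OF p(1) q(2) q(2) module_hom_comp[OF p(4) fh] q(4) this]
    obtain g where g: "g \<in> module_hom R (P (Suc n)) (Q (Suc n))" "\<And>x. x \<in> carrier (P (Suc n)) \<Longrightarrow> d' n (g x) = f (d n x)"
      by blast
    then show ?thesis
      unfolding ok_def res_cycle_def using module_hom_zero[OF p(2) q(2) fh] by (intro exI[of _ g]) auto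
  qed
  ultimately obtain f where "\<And>n. ok n (f n)" "\<And>n. \<forall>x \<in> carrier (P (Suc n)). d' n (f (Suc n) x) = f n (d n x)"
    using dependent_nat_choice[of ok "\<lambda>n f g. \<forall>x \<in> carrier (P (Suc n)). d' n (g x) = f (d n x)"] by metis
  then show ?thesis unfolding ok_def by (intro exI[of _ f]) auto
qed

text \<open>\<open>u\<close> is a chain map over the zero map. Only one degree of the homotopy is
  asserted, \<open>t\<close> being its previous component, since cohomology is compared in one
  degree at a time.\<close>

lemma resolution_null_homotopy:
  assumes P: "projective_resolution R M P d ep" and M: "module R M"
    and u: "\<And>n. u n \<in> module_hom R (P n) (P n)" "\<And>x. x \<in> carrier (P 0) \<Longrightarrow> ep (u 0 x) = \<zero>\<^bsub>M\<^esub>"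
      "\<And>n x. x \<in> carrier (P (Suc n)) \<Longrightarrow> d n (u (Suc n) x) = u n (d n x)"
  shows "\<exists>s \<in> module_hom R (P n) (P (Suc n)).
    (n = 0 \<longrightarrow> (\<forall>x \<in> carrier (P 0). u 0 x = d 0 (s x))) \<and>
    (\<forall>m. n = Suc m \<longrightarrow> (\<exists>t \<in> module_hom R (P m) (P n).
       \<forall>x \<in> carrier (P n). u n x = d n (s x) \<oplus>\<^bsub>P n\<^esub> t (d m x)))"
proof (induction n)
  case 0
  note p = projective_resolutionD[OF P]
  have "u 0 ` carrier (P 0) \<subseteq> d 0 ` carrier (P (Suc 0))"
    unfolding p(6) res_cycle_def using u(2) module_homD(1)[OF u(1)] by auto
  from projective_lift[OF p(1) p(2) p(2) u(1) p(4) this] show ?case by force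
next
  case (Suc n)
  note p = projective_resolutionD[OF P]
  interpret Pn: module R "P n" by (rule p(2))
  interpret Ps: module R "P (Suc n)" by (rule p(2))
  obtain s where s: "s \<in> module_hom R (P n) (P (Suc n))"
    "n = 0 \<Longrightarrow> (\<forall>x \<in> carrier (P 0). u 0 x = d 0 (s x))"
    "\<And>m. n = Suc m \<Longrightarrow> (\<exists>t \<in> module_hom R (P m) (P n).
       \<forall>x \<in> carrier (P n). u n x = d n (s x) \<oplus>\<^bsub>P n\<^esub> t (d m x))" using Suc.IH by auto
  \<comment> \<open>On cycles the summand through \<open>d m\<close> vanishes.\<close>
  have inv: "u n y = d n (s y)" if y: "y \<in> carrier (P n)" "res_cycle M P d ep n y" for y
  proof (cases n)
    case 0 then show ?thesis using s(2) y by simp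
  next
    case (Suc m)
    then obtain t where t: "t \<in> module_hom R (P m) (P n)" "\<And>x. x \<in> carrier (P n) \<Longrightarrow> u n x = d n (s x) \<oplus>\<^bsub>P n\<^esub> t (d m x)"
      using s(3) by blast
    have "d m y = \<zero>\<^bsub>P m\<^esub>" using y(2) Suc unfolding res_cycle_def by simp
    then have "t (d m y) = \<zero>\<^bsub>P n\<^esub>" using module_hom_zero[OF p(2) p(2) t(1)] by simp
    then show ?thesis using t(2)[OF y(1)] module_homD(1)[OF p(4) module_homD(1)[OF s(1) y(1)]] by simp
  qed
  \<comment> \<open>The part of \<open>u\<close> not yet accounted for by \<open>s\<close>. By
    \<open>inv\<close> its values are cycles, so it lifts along the next differential.\<close>
  let ?v = "\<lambda>x. u (Suc n) x \<ominus>\<^bsub>P (Suc n)\<^esub> s (d n x)"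
  have v: "?v \<in> module_hom R (P (Suc n)) (P (Suc n))"
    by (rule module_hom_diff[OF p(2) p(2) u(1) module_hom_comp[OF p(4) s(1)]])
  have "?v ` carrier (P (Suc n)) \<subseteq> d (Suc n) ` carrier (P (Suc (Suc n)))"
  proof (rule image_subsetI)
    fix x assume x: "x \<in> carrier (P (Suc n))"
    have dx: "d n x \<in> carrier (P n)" "res_cycle M P d ep n (d n x)" using p(6)[of n] x by auto
    have "d n (?v x) = d n (u (Suc n) x) \<ominus>\<^bsub>P n\<^esub> d n (s (d n x))"
      using x dx by (intro module_hom_minus[OF p(2) p(2) p(4)] module_homD(1)[OF u(1)] module_homD(1)[OF s(1)])
    also have "\<dots> = \<zero>\<^bsub>P n\<^esub>"
      using u(3)[OF x] inv[OF dx] module_homD(1)[OF u(1) dx(1)] by (simp add: Pn.M.minus_eq Pn.M.r_neg)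
    finally have "d n (?v x) = \<zero>\<^bsub>P n\<^esub>" .
    then show "?v x \<in> d (Suc n) ` carrier (P (Suc (Suc n)))"
      unfolding p(6) res_cycle_def using module_homD(1)[OF v x] by simp
  qed
  from projective_lift[OF p(1) p(2) p(2) v p(4) this]
  obtain s' where s': "s' \<in> module_hom R (P (Suc n)) (P (Suc (Suc n)))"
    "\<And>x. x \<in> carrier (P (Suc n)) \<Longrightarrow> d (Suc n) (s' x) = ?v x" by blast
  have "u (Suc n) x = d (Suc n) (s' x) \<oplus>\<^bsub>P (Suc n)\<^esub> s (d n x)" if x: "x \<in> carrier (P (Suc n))" for x
  proof -
    have c: "u (Suc n) x \<in> carrier (P (Suc n))" "s (d n x) \<in> carrier (P (Suc n))"
      using module_homD(1)[OF u(1) x] module_homD(1)[OF s(1) module_homD(1)[OF p(4) x]] by auto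
    show ?thesis unfolding s'(2)[OF x] using c by (simp add: Ps.M.minus_eq Ps.M.a_assoc Ps.M.l_neg)
  qed
  then show ?case using s(1) s'(1) by (intro bexI[of _ s']) auto
qed

section \<open>Cohomology of Hom complexes\<close>

context
  fixes R :: "('a, 'r) ring_scheme" and M :: "('a, 'b, 'm) module_scheme"
    and P :: "nat \<Rightarrow> ('a, 'p) module" and d ep and N :: "('a, 'c, 'n) module_scheme"
  assumes P: "projective_resolution R M P d ep" and N: "module R N"
begin

interpretation N: module R N by (rule N)

abbreviation (input) "HZ n \<equiv> (hom_module R (P n) N)\<lparr>carrier := cocycles R P d N n\<rparr>"

lemma hom_module_memD:
  "h \<in> carrier (hom_module R (P n) N) \<Longrightarrow> h \<in> module_hom R (P n) N"
  by (simp add: hom_module_simps)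

lemma cocycles_submodule: "submodule (cocycles R P d N n) R (hom_module R (P n) N)"
proof -
  note p = projective_resolutionD[OF P]
  let ?H = "hom_module R (P n) N"
  interpret H: module R ?H by (rule hom_module_module[OF p(2) N])
  have dn: "d n x \<in> carrier (P n)" if "x \<in> carrier (P (Suc n))" for x using module_homD(1)[OF p(4) that] .
  show ?thesis
  proof (rule submoduleI'[OF H.module_axioms])
    show "cocycles R P d N n \<subseteq> carrier ?H" unfolding cocycles_def by blast
    show "\<zero>\<^bsub>?H\<^esub> \<in> cocycles R P d N n"
      unfolding cocycles_def using dn H.M.zero_closed by (auto simp: hom_module_simps(2))
    show "g \<oplus>\<^bsub>?H\<^esub> h \<in> cocycles R P d N n" if "g \<in> cocycles R P d N n" "h \<in> cocycles R P d N n" for g h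
      using that H.M.a_closed[of g h] dn unfolding cocycles_def by (auto simp: hom_module_simps(3))
    show "a \<odot>\<^bsub>?H\<^esub> h \<in> cocycles R P d N n" if "a \<in> carrier R" "h \<in> cocycles R P d N n" for a h
      using that H.smult_closed[of a h] dn unfolding cocycles_def by (auto simp: hom_module_simps(4))
  qed
qed

lemma cocycle_module: "module R (HZ n)"
  by (rule submodule_module[OF hom_module_module[OF projective_resolutionD(2)[OF P] N] cocycles_submodule])

lemma coboundaries_submodule: "submodule (coboundaries R P d N n) R (HZ n)"
proof (cases n)
  case 0
  then show ?thesis using submodule_zero[OF cocycle_module[of 0]] by simp
next
  case (Suc k)
  note p = projective_resolutionD[OF P]
  let ?f = "\<lambda>g. \<lambda>x\<in>carrier (P (Suc k)). g (d k x)"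
  have dk: "d k x \<in> carrier (P k)" if "x \<in> carrier (P (Suc k))" for x using module_homD(1)[OF p(4) that] .
  interpret Pk: module R "P (Suc k)" by (rule p(2))
  have "?f \<in> module_hom R (hom_module R (P k) N) (HZ (Suc k))"
  proof (rule module_homI)
    fix g assume g: "g \<in> carrier (hom_module R (P k) N)"
    note gh = hom_module_memD[OF g]
    have "?f g \<in> carrier (hom_module R (P (Suc k)) N)"
      by (rule restrict_hom[OF p(2) module_hom_comp[OF p(4) gh]])
    moreover have "?f g (d (Suc k) x) = \<zero>\<^bsub>N\<^esub>" if "x \<in> carrier (P (Suc (Suc k)))" for x
      using projective_resolution_dd[OF P that] module_homD(1)[OF p(4) that] module_hom_zero[OF p(2) N gh] by simp
    ultimately show "?f g \<in> carrier (HZ (Suc k))" unfolding cocycles_def by simp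
  qed (auto simp: hom_module_simps dk)
  from submodule_image[OF hom_module_module[OF p(2) N] cocycle_module this
      module.carrier_is_submodule[OF hom_module_module[OF p(2) N]]]
  show ?thesis unfolding Suc by simp
qed

lemma hom_cohomology_module: "module R (hom_cohomology R P d N n)"
  unfolding hom_cohomology_def by (rule quot_module_module[OF cocycle_module coboundaries_submodule])

end

text \<open>A homomorphism on a free module of rank \<open>q\<close> is determined by its
  \<open>q\<close> values on the basis, so the cocycles embed into a free module of rank
  \<open>q\<close>, where submodules are finitely generated.\<close>

lemma (in noetherian_cring) cocycle_module_finitely_generated:
  assumes Q: "projective_resolution R M Q d ep" and Qn: "Q n = free_module R {..<q::nat}"
  shows "finitely_generated R ((hom_module R (Q n) (self_module R))\<lparr>carrier := cocycles R Q d (self_module R) n\<rparr>)"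
    (is "finitely_generated R ?Z")
proof (rule finitely_generated_of_inj)
  let ?F = "free_module R {..<q}"
  show "module R ?Z" by (rule cocycle_module[OF Q self_module_module])
  let ?e = "\<lambda>h i. if i < q then h (basis_vec R i) else \<zero>"
  have bc: "basis_vec R i \<in> carrier ?F" if "i < q" for i using that by (intro basis_vec_carrier) simp
  have Zh: "h \<in> module_hom R ?F (self_module R)" "h \<in> extensional (carrier ?F)" if "h \<in> carrier ?Z" for h
    using that unfolding cocycles_def hom_module_simps Qn by auto
  have val: "h (basis_vec R i) \<in> carrier R" if "h \<in> carrier ?Z" "i < q" for h i
    using module_homD(1)[OF Zh(1)[OF that(1)] bc[OF that(2)]] unfolding self_module_simps .
  show "?e \<in> module_hom R ?Z ?F"
  proof (rule module_homI)
    fix h assume h: "h \<in> carrier ?Z"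
    have "finite {i. ?e h i \<noteq> \<zero>}" by (rule finite_subset[of _ "{..<q}"]) auto
    then show "?e h \<in> carrier ?F" unfolding free_module_carrier using val[OF h] by auto
  qed (auto simp: hom_module_simps free_module_simps self_module_simps Qn bc)
  show "inj_on ?e (carrier ?Z)"
  proof (rule inj_onI)
    fix g h assume g: "g \<in> carrier ?Z" and h: "h \<in> carrier ?Z" and eq: "?e g = ?e h"
    have sub: "submodule {v \<in> carrier ?F. g v = h v} R ?F"
      by (rule submodule_equalizer[OF free_module_module self_module_module Zh(1)[OF g] Zh(1)[OF h]])
    have "basis_vec R i \<in> {v \<in> carrier ?F. g v = h v}" if "i \<in> {..<q}" for i
      using that fun_cong[OF eq, of i] bc by auto
    then have "g v = h v" if "v \<in> carrier ?F" for v using free_module_in_submodule[OF sub _ that] by blast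
    then show "g = h" using extensionalityI[OF Zh(2)[OF g] Zh(2)[OF h]] by blast
  qed
qed

text \<open>The resolution chosen in the definition of \<open>Ext\<close> need not consist of finitely generated modules,
  so its cohomology has to be compared with that of a resolution which does.\<close>

lemma (in noetherian_cring) hom_cohomology_finitely_generated:
  assumes P: "projective_resolution R M P d ep" and Q: "projective_resolution R M Q d' ep'" and M: "module R M"
    and Qn: "Q n = free_module R {..<q::nat}"
  shows "finitely_generated R (hom_cohomology R P d (self_module R) n)"
proof -
  let ?N = "self_module R"
  let ?Z = "\<lambda>P d. (hom_module R (P n) ?N)\<lparr>carrier := cocycles R P d ?N n\<rparr>"
  note p = projective_resolutionD[OF P] and q = projective_resolutionD[OF Q]
  interpret N: module R ?N by (rule self_module_module)
  interpret Pn: module R "P n" by (rule p(2))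
  interpret Qm: module R "Q n" by (rule q(2))
  obtain f where f: "\<And>n. f n \<in> module_hom R (P n) (Q n)" "\<And>x. x \<in> carrier (P 0) \<Longrightarrow> ep' (f 0 x) = ep x"
    "\<And>n x. x \<in> carrier (P (Suc n)) \<Longrightarrow> d' n (f (Suc n) x) = f n (d n x)"
    using resolution_comparison[OF P Q M] by blast
  obtain g where g: "\<And>n. g n \<in> module_hom R (Q n) (P n)" "\<And>x. x \<in> carrier (Q 0) \<Longrightarrow> ep (g 0 x) = ep' x"
    "\<And>n x. x \<in> carrier (Q (Suc n)) \<Longrightarrow> d n (g (Suc n) x) = g n (d' n x)"
    using resolution_comparison[OF Q P M] by blast
  \<comment> \<open>The round trip between the resolutions minus the identity: it lies over the zero
    map of \<open>M\<close> and is therefore null-homotopic.\<close>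
  let ?u = "\<lambda>n x. g n (f n x) \<ominus>\<^bsub>P n\<^esub> x"
  have idh: "(\<lambda>x. x) \<in> module_hom R (P n) (P n)" for n by (rule module_homI) auto
  note gf = module_hom_comp[OF f(1) g(1)]
  have u: "?u n \<in> module_hom R (P n) (P n)" for n by (rule module_hom_diff[OF p(2) p(2) gf idh])
  have u0: "ep (?u 0 x) = \<zero>\<^bsub>M\<^esub>" if x: "x \<in> carrier (P 0)" for x
  proof -
    interpret M: module R M by (rule M)
    have "ep (?u 0 x) = ep (g 0 (f 0 x)) \<ominus>\<^bsub>M\<^esub> ep x"
      by (rule module_hom_minus[OF p(2) M p(3) module_homD(1)[OF gf x] x])
    also have "\<dots> = \<zero>\<^bsub>M\<^esub>"
      using g(2)[OF module_homD(1)[OF f(1) x]] f(2)[OF x] module_homD(1)[OF p(3) x]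
      by (simp add: M.M.minus_eq M.M.r_neg)
    finally show ?thesis .
  qed
  have us: "d n (?u (Suc n) x) = ?u n (d n x)" if x: "x \<in> carrier (P (Suc n))" for n x
  proof -
    have "d n (?u (Suc n) x) = d n (g (Suc n) (f (Suc n) x)) \<ominus>\<^bsub>P n\<^esub> d n x"
      by (rule module_hom_minus[OF p(2) p(2) p(4) module_homD(1)[OF gf x] x])
    then show ?thesis using g(3)[OF module_homD(1)[OF f(1) x]] f(3)[OF x] by simp
  qed
  define U where "U n x = ?u n x" for n x
  have U: "U n \<in> module_hom R (P n) (P n)" "x \<in> carrier (P 0) \<Longrightarrow> ep (U 0 x) = \<zero>\<^bsub>M\<^esub>"
    "x \<in> carrier (P (Suc n)) \<Longrightarrow> d n (U (Suc n) x) = U n (d n x)" for n x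
    unfolding U_def using u u0 us by auto
  let ?phi = "\<lambda>z. \<lambda>x\<in>carrier (P n). z (f n x)"
  have Zm: "z \<in> module_hom R (Q n) ?N" "\<And>x. x \<in> carrier (Q (Suc n)) \<Longrightarrow> z (d' n x) = \<zero>\<^bsub>?N\<^esub>"
    if "z \<in> carrier (?Z Q d')" for z using that unfolding cocycles_def hom_module_simps by auto
  have Pm: "z \<in> module_hom R (P n) ?N" "\<And>x. x \<in> carrier (P (Suc n)) \<Longrightarrow> z (d n x) = \<zero>\<^bsub>?N\<^esub>"
    "z \<in> extensional (carrier (P n))"
    if "z \<in> carrier (?Z P d)" for z using that unfolding cocycles_def hom_module_simps by auto
  have fn: "f n x \<in> carrier (Q n)" if "x \<in> carrier (P n)" for x using module_homD(1)[OF f(1) that] .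
  have phi: "?phi \<in> module_hom R (?Z Q d') (?Z P d)"
  proof (rule module_homI)
    fix z assume z: "z \<in> carrier (?Z Q d')"
    have "?phi z \<in> carrier (hom_module R (P n) ?N)"
      by (rule restrict_hom[OF p(2) module_hom_comp[OF f(1) Zm(1)[OF z]]])
    moreover have "?phi z (d n x) = \<zero>\<^bsub>?N\<^esub>" if "x \<in> carrier (P (Suc n))" for x
      using Zm(2)[OF z module_homD(1)[OF f(1) that]] f(3)[OF that] module_homD(1)[OF p(4) that] by simp
    ultimately show "?phi z \<in> carrier (?Z P d)" unfolding cocycles_def by simp
  qed (auto simp: hom_module_simps fn)
  note ZP = cocycle_module[OF P self_module_module, of n] and BP = coboundaries_submodule[OF P self_module_module, of n]
  let ?B = "coboundaries R P d ?N n"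
  let ?E = "hom_cohomology R P d ?N n"
  interpret ZP: module R "?Z P d" by (rule ZP)
  let ?psi = "\<lambda>z. ?B +>\<^bsub>?Z P d\<^esub> ?phi z"
  have psi: "?psi \<in> module_hom R (?Z Q d') ?E"
    unfolding hom_cohomology_def by (rule module_hom_comp[OF phi quot_module_proj[OF ZP BP]])
  have "carrier ?E \<subseteq> ?psi ` carrier (?Z Q d')"
  proof
    fix X assume "X \<in> carrier ?E"
    then obtain h where h: "h \<in> carrier (?Z P d)" "X = ?B +>\<^bsub>?Z P d\<^esub> h"
      unfolding hom_cohomology_def quot_module_carrier by blast
    \<comment> \<open>Composition with \<open>g\<close> carries a cocycle for \<open>P\<close> to
      one for \<open>Q\<close>; returning along \<open>f\<close> changes the original cocycle by
      \<open>?k\<close>, a coboundary.\<close>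
    let ?z = "\<lambda>y\<in>carrier (Q n). h (g n y)"
    have z: "?z \<in> carrier (?Z Q d')"
    proof -
      have "?z \<in> carrier (hom_module R (Q n) ?N)"
        by (rule restrict_hom[OF q(2) module_hom_comp[OF g(1) Pm(1)[OF h(1)]]])
      moreover have "?z (d' n x) = \<zero>\<^bsub>?N\<^esub>" if "x \<in> carrier (Q (Suc n))" for x
        using Pm(2)[OF h(1) module_homD(1)[OF g(1) that]] g(3)[OF that] module_homD(1)[OF q(4) that] by simp
      ultimately show ?thesis unfolding cocycles_def by simp
    qed
    let ?k = "\<lambda>x\<in>carrier (P n). h (U n x)"
    have kB: "?k \<in> ?B"
    proof -
      obtain s where s: "s \<in> module_hom R (P n) (P (Suc n))"
        "n = 0 \<longrightarrow> (\<forall>x \<in> carrier (P 0). U 0 x = d 0 (s x))"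
        "\<forall>m. n = Suc m \<longrightarrow> (\<exists>t \<in> module_hom R (P m) (P n).
           \<forall>x \<in> carrier (P n). U n x = d n (s x) \<oplus>\<^bsub>P n\<^esub> t (d m x))"
        using resolution_null_homotopy[of R M P d ep U n, OF P M U] by blast
      \<comment> \<open>A cocycle kills the part of the homotopy in the image of \<open>d n\<close>;
        only a map through \<open>d m\<close> is left, and in degree 0 nothing.\<close>
      have hds: "h (d n (s x)) = \<zero>\<^bsub>?N\<^esub>" if "x \<in> carrier (P n)" for x
        using Pm(2)[OF h(1) module_homD(1)[OF s(1) that]] .
      show ?thesis
      proof (cases n)
        case 0
        then have "?k = \<zero>\<^bsub>hom_module R (P 0) ?N\<^esub>"
          using s(2) hds unfolding hom_module_simps by (auto simp: restrict_def)
        then show ?thesis using 0 by simp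
      next
        case (Suc m)
        then obtain t where t: "t \<in> module_hom R (P m) (P n)"
          "\<And>x. x \<in> carrier (P n) \<Longrightarrow> U n x = d n (s x) \<oplus>\<^bsub>P n\<^esub> t (d m x)" using s(3) by blast
        let ?w = "\<lambda>y\<in>carrier (P m). h (t y)"
        have "?w \<in> carrier (hom_module R (P m) ?N)"
          by (rule restrict_hom[OF p(2) module_hom_comp[OF t(1) Pm(1)[OF h(1)]]])
        moreover have "?k = (\<lambda>x\<in>carrier (P n). ?w (d m x))"
        proof (rule restrict_ext)
          fix x assume x: "x \<in> carrier (P n)"
          have dx: "d m x \<in> carrier (P m)" using module_homD(1)[OF p(4)[of m]] x Suc by simp
          have c: "d n (s x) \<in> carrier (P n)" "t (d m x) \<in> carrier (P n)"
            using module_homD(1)[OF p(4) module_homD(1)[OF s(1) x]] module_homD(1)[OF t(1) dx] by auto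
          have "h (U n x) = h (d n (s x)) \<oplus>\<^bsub>?N\<^esub> h (t (d m x))"
            unfolding t(2)[OF x] by (rule module_homD(2)[OF Pm(1)[OF h(1)] c])
          also have "\<dots> = h (t (d m x))"
            using hds[OF x] module_homD(1)[OF Pm(1)[OF h(1)] c(2)] by simp
          finally show "h (U n x) = ?w (d m x)" using dx by simp
        qed
        ultimately show ?thesis unfolding Suc coboundaries.simps by (intro image_eqI[where x = ?w])
      qed
    qed
    then have kZ: "?k \<in> carrier (?Z P d)" using submodule_closed(1)[OF BP] by blast
    have "?phi ?z = ?k \<oplus>\<^bsub>?Z P d\<^esub> h"
    proof (rule extensionalityI[of _ "carrier (P n)"])
      show "?phi ?z \<in> extensional (carrier (P n))" by simp
      show "?k \<oplus>\<^bsub>?Z P d\<^esub> h \<in> extensional (carrier (P n))" by (simp add: hom_module_simps)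
      fix x assume x: "x \<in> carrier (P n)"
      have c: "g n (f n x) \<in> carrier (P n)" using module_homD(1)[OF gf x] .
      have hc: "h (g n (f n x)) \<in> carrier R" "h x \<in> carrier R"
        using module_homD(1)[OF Pm(1)[OF h(1)] c] module_homD(1)[OF Pm(1)[OF h(1)] x] unfolding self_module_simps by auto
      have "h (U n x) = h (g n (f n x)) \<ominus>\<^bsub>?N\<^esub> h x"
        unfolding U_def by (rule module_hom_minus[OF p(2) self_module_module Pm(1)[OF h(1)] c x])
      then have "h (U n x) \<oplus> h x = h (g n (f n x))"
        using hc by (simp add: a_minus_def self_module_simps a_assoc l_neg)
      then show "?phi ?z x = (?k \<oplus>\<^bsub>?Z P d\<^esub> h) x"
        using x fn[OF x] by (simp add: hom_module_simps self_module_simps)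
    qed
    then have "?psi ?z = (?B +>\<^bsub>?Z P d\<^esub> ?k) \<oplus>\<^bsub>?E\<^esub> X"
      unfolding h(2) hom_cohomology_def using quot_module_add[OF ZP BP kZ h(1)] by simp
    also have "\<dots> = X"
    proof -
      interpret E: module R ?E by (rule hom_cohomology_module[OF P self_module_module])
      have "?B +>\<^bsub>?Z P d\<^esub> ?k = \<zero>\<^bsub>?E\<^esub>"
        unfolding hom_cohomology_def using quot_module_eq_zero_iff[OF ZP BP kZ] kB by simp
      then show ?thesis using \<open>X \<in> carrier ?E\<close> by simp
    qed
    finally have e: "?psi ?z = X" .
    show "X \<in> ?psi ` carrier (?Z Q d')" using imageI[OF z, of ?psi] unfolding e .
  qed
  then have surj: "?psi ` carrier (?Z Q d') = carrier ?E" using module_homD(1)[OF psi] by blast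
  show ?thesis
    by (rule finitely_generated_image[OF cocycle_module_finitely_generated[where Q = Q, OF Q Qn]
        hom_cohomology_module[OF P self_module_module] psi surj])
qed

section \<open>Tensor products\<close>

definition pure_tensor ::
  "('a, 'r) ring_scheme \<Rightarrow> ('a, 'b, 'm) module_scheme \<Rightarrow> ('a, 'c, 'n) module_scheme \<Rightarrow> 'b \<Rightarrow> 'c
    \<Rightarrow> ('b \<times> 'c \<Rightarrow> 'a) set" where
  "pure_tensor R M N x y =
     gen_submodule R (free_module R (carrier M \<times> carrier N)) (tensor_relations R M N)
       +>\<^bsub>free_module R (carrier M \<times> carrier N)\<^esub> basis_vec R (x, y)"

context
  fixes R :: "('a, 'r) ring_scheme" and M :: "('a, 'b, 'm) module_scheme" and N :: "('a, 'c, 'n) module_scheme"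
  assumes M: "module R M" and N: "module R N"
begin

interpretation M: module R M by (rule M)
interpretation N: module R N by (rule N)

private abbreviation (input) "FF \<equiv> free_module R (carrier M \<times> carrier N)"
private abbreviation (input) "SS \<equiv> gen_submodule R FF (tensor_relations R M N)"

interpretation F: module R FF by (rule M.R.free_module_module)

lemma tensor_relations_carrier: "tensor_relations R M N \<subseteq> carrier FF"
proof -
  have b: "basis_vec R (x, y) \<in> carrier FF" if "x \<in> carrier M" "y \<in> carrier N" for x y
    using that by (intro M.R.basis_vec_carrier) simp
  show ?thesis unfolding tensor_relations_def Let_def
    using b by (auto intro!: F.M.minus_closed F.M.a_closed F.smult_closed)
qed

lemma tensor_submodule: "submodule SS R FF"
  by (rule gen_submodule_submodule(1)[OF F.module_axioms tensor_relations_carrier])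

lemma tensor_module_eq: "tensor_module R M N = quot_module FF SS"
  by (simp add: tensor_module_def Let_def)

lemma tensor_module_module: "module R (tensor_module R M N)"
  unfolding tensor_module_eq by (rule quot_module_module[OF F.module_axioms tensor_submodule])

lemma tensor_relD: "v \<in> tensor_relations R M N \<Longrightarrow> v \<in> SS"
  using gen_submodule_submodule(2)[OF F.module_axioms tensor_relations_carrier] by blast

lemma basis_pair_carrier: "x \<in> carrier M \<Longrightarrow> y \<in> carrier N \<Longrightarrow> basis_vec R (x, y) \<in> carrier FF"
  by (intro M.R.basis_vec_carrier) simp

lemma pure_tensor_carrier:
  "x \<in> carrier M \<Longrightarrow> y \<in> carrier N \<Longrightarrow> pure_tensor R M N x y \<in> carrier (tensor_module R M N)"
  unfolding tensor_module_eq pure_tensor_def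
  by (rule quot_module_coset_mem[OF F.module_axioms tensor_submodule basis_pair_carrier])

lemma pure_tensor_add_right:
  assumes "x \<in> carrier M" "y \<in> carrier N" "y' \<in> carrier N"
  shows "pure_tensor R M N x (y \<oplus>\<^bsub>N\<^esub> y') =
    pure_tensor R M N x y \<oplus>\<^bsub>tensor_module R M N\<^esub> pure_tensor R M N x y'"
proof -
  have "basis_vec R (x, y \<oplus>\<^bsub>N\<^esub> y') \<ominus>\<^bsub>FF\<^esub> (basis_vec R (x, y) \<oplus>\<^bsub>FF\<^esub> basis_vec R (x, y')) \<in> SS"
    using assms by (intro tensor_relD) (auto simp: tensor_relations_def Let_def)
  then show ?thesis
    unfolding pure_tensor_def tensor_module_eq
    using assms by (simp add: quot_module_add[OF F.module_axioms tensor_submodule]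
        quot_module_coset_eq_iff[OF F.module_axioms tensor_submodule] basis_pair_carrier)
qed

lemma pure_tensor_smult_right:
  assumes "a \<in> carrier R" "x \<in> carrier M" "y \<in> carrier N"
  shows "pure_tensor R M N x (a \<odot>\<^bsub>N\<^esub> y) = a \<odot>\<^bsub>tensor_module R M N\<^esub> pure_tensor R M N x y"
proof -
  have "basis_vec R (x, a \<odot>\<^bsub>N\<^esub> y) \<ominus>\<^bsub>FF\<^esub> a \<odot>\<^bsub>FF\<^esub> basis_vec R (x, y) \<in> SS"
    using assms by (intro tensor_relD) (auto simp: tensor_relations_def Let_def)
  then show ?thesis
    unfolding pure_tensor_def tensor_module_eq
    using assms by (simp add: quot_module_smult[OF F.module_axioms tensor_submodule]
        quot_module_coset_eq_iff[OF F.module_axioms tensor_submodule] basis_pair_carrier)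
qed

lemma pure_tensor_smult_left:
  assumes "a \<in> carrier R" "x \<in> carrier M" "y \<in> carrier N"
  shows "pure_tensor R M N (a \<odot>\<^bsub>M\<^esub> x) y = a \<odot>\<^bsub>tensor_module R M N\<^esub> pure_tensor R M N x y"
proof -
  have "basis_vec R (a \<odot>\<^bsub>M\<^esub> x, y) \<ominus>\<^bsub>FF\<^esub> a \<odot>\<^bsub>FF\<^esub> basis_vec R (x, y) \<in> SS"
    using assms by (intro tensor_relD) (auto simp: tensor_relations_def Let_def)
  then show ?thesis
    unfolding pure_tensor_def tensor_module_eq
    using assms by (simp add: quot_module_smult[OF F.module_axioms tensor_submodule]
        quot_module_coset_eq_iff[OF F.module_axioms tensor_submodule] basis_pair_carrier)
qed

text \<open>Pure tensors generate the tensor product because the basis vectors generate the free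
  module.\<close>

lemma tensor_module_in_submodule:
  assumes K: "submodule K R (tensor_module R M N)"
    and pure: "\<And>x y. x \<in> carrier M \<Longrightarrow> y \<in> carrier N \<Longrightarrow> pure_tensor R M N x y \<in> K"
    and t: "t \<in> carrier (tensor_module R M N)"
  shows "t \<in> K"
proof -
  note proj = quot_module_proj[OF F.module_axioms tensor_submodule]
  have sub: "submodule {v \<in> carrier FF. SS +>\<^bsub>FF\<^esub> v \<in> K} R FF"
    using submodule_preimage[OF F.module_axioms tensor_module_module[unfolded tensor_module_eq] proj]
      K[unfolded tensor_module_eq] .
  obtain v where v: "v \<in> carrier FF" "t = SS +>\<^bsub>FF\<^esub> v" using t unfolding tensor_module_eq quot_module_carrier by blast
  have "v \<in> {v \<in> carrier FF. SS +>\<^bsub>FF\<^esub> v \<in> K}"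
  proof (rule M.R.free_module_in_submodule[OF sub _ v(1)])
    fix z assume "z \<in> carrier M \<times> carrier N"
    then obtain x y where z: "z = (x, y)" "x \<in> carrier M" "y \<in> carrier N" by blast
    show "basis_vec R z \<in> {v \<in> carrier FF. SS +>\<^bsub>FF\<^esub> v \<in> K}"
      using basis_pair_carrier[OF z(2,3)] pure[OF z(2,3)] unfolding pure_tensor_def z(1) by simp
  qed
  then show ?thesis using v(2) by blast
qed

text \<open>Since (a x0) \<otimes> y = x0 \<otimes> (a y), the map sending \<open>y\<close> to the
  pure tensor of \<open>x0\<close> and \<open>y\<close> is onto.\<close>

lemma tensor_module_cyclic_finitely_generated:
  assumes x0: "x0 \<in> carrier M" and cyc: "\<And>x. x \<in> carrier M \<Longrightarrow> \<exists>a \<in> carrier R. x = a \<odot>\<^bsub>M\<^esub> x0"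
    and fg: "finitely_generated R N"
  shows "finitely_generated R (tensor_module R M N)"
proof (rule finitely_generated_image[OF fg tensor_module_module])
  let ?T = "tensor_module R M N" and ?h = "pure_tensor R M N x0"
  show h: "?h \<in> module_hom R N ?T"
    using x0 by (intro module_homI) (auto simp: pure_tensor_carrier pure_tensor_add_right pure_tensor_smult_right)
  have sub: "submodule (?h ` carrier N) R ?T"
    by (rule submodule_image[OF N tensor_module_module h module.carrier_is_submodule[OF N]])
  have "t \<in> ?h ` carrier N" if "t \<in> carrier ?T" for t
  proof (rule tensor_module_in_submodule[OF sub _ that])
    fix x y assume x: "x \<in> carrier M" and y: "y \<in> carrier N"
    then obtain a where a: "a \<in> carrier R" "x = a \<odot>\<^bsub>M\<^esub> x0" using cyc by blast
    then have "pure_tensor R M N x y = ?h (a \<odot>\<^bsub>N\<^esub> y)"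
      using x0 y by (simp add: pure_tensor_smult_left pure_tensor_smult_right)
    then show "pure_tensor R M N x y \<in> ?h ` carrier N" using a(1) y by simp
  qed
  then show "?h ` carrier N = carrier ?T" using module_homD(1)[OF h] by blast
qed

lemma annihilator_tensor_module: "annihilator R M \<subseteq> annihilator R (tensor_module R M N)"
proof
  let ?T = "tensor_module R M N"
  interpret T: module R ?T by (rule tensor_module_module)
  fix a assume a: "a \<in> annihilator R M"
  then have ac: "a \<in> carrier R" unfolding annihilator_def by blast
  have "(\<lambda>t. a \<odot>\<^bsub>?T\<^esub> t) \<in> module_hom R ?T ?T"
  proof (rule module_homI)
    fix b t assume b: "b \<in> carrier R" "t \<in> carrier ?T"
    show "a \<odot>\<^bsub>?T\<^esub> (b \<odot>\<^bsub>?T\<^esub> t) = b \<odot>\<^bsub>?T\<^esub> (a \<odot>\<^bsub>?T\<^esub> t)"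
      using T.smult_assoc1[OF ac b] T.smult_assoc1[OF b(1) ac b(2)] M.R.m_comm[OF ac b(1)] by simp
  qed (use ac in \<open>auto simp: T.smult_r_distr\<close>)
  from submodule_kernel[OF T.module_axioms T.module_axioms this]
  have sub: "submodule {t \<in> carrier ?T. a \<odot>\<^bsub>?T\<^esub> t = \<zero>\<^bsub>?T\<^esub>} R ?T" .
  have "t \<in> {t \<in> carrier ?T. a \<odot>\<^bsub>?T\<^esub> t = \<zero>\<^bsub>?T\<^esub>}" if "t \<in> carrier ?T" for t
  proof (rule tensor_module_in_submodule[OF sub _ that])
    fix x y assume x: "x \<in> carrier M" and y: "y \<in> carrier N"
    \<comment> \<open>With zero written as the zero multiple of \<open>x\<close>, linearity in the
      first argument shows that its pure tensors vanish.\<close>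
    have ax: "a \<odot>\<^bsub>M\<^esub> x = \<zero>\<^bsub>R\<^esub> \<odot>\<^bsub>M\<^esub> x" using a x unfolding annihilator_def by simp
    have "a \<odot>\<^bsub>?T\<^esub> pure_tensor R M N x y = pure_tensor R M N (a \<odot>\<^bsub>M\<^esub> x) y"
      by (rule pure_tensor_smult_left[OF ac x y, symmetric])
    also have "\<dots> = \<zero>\<^bsub>R\<^esub> \<odot>\<^bsub>?T\<^esub> pure_tensor R M N x y"
      unfolding ax by (rule pure_tensor_smult_left[OF M.R.zero_closed x y])
    also have "\<dots> = \<zero>\<^bsub>?T\<^esub>" by (rule T.smult_l_null[OF pure_tensor_carrier[OF x y]])
    finally show "pure_tensor R M N x y \<in> {t \<in> carrier ?T. a \<odot>\<^bsub>?T\<^esub> t = \<zero>\<^bsub>?T\<^esub>}"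
      using pure_tensor_carrier[OF x y] by simp
  qed
  then show "a \<in> annihilator R ?T" unfolding annihilator_def using ac by blast
qed

end

section \<open>Modules over the residue field\<close>

lemma (in field) krull_dim_field: "krull_dim R = 0"
proof -
  have "n = 0" if "pchain R n P Q" for n P Q
  proof (rule ccontr)
    assume "n \<noteq> 0"
    then obtain k where "n = Suc k" using not0_implies_Suc by blast
    then obtain P' where c: "pchain R k P P'" "P' \<subset> Q" "primeideal Q R" using \<open>pchain R n P Q\<close> by auto
    then have P': "primeideal P' R" "P' \<subset> Q" "primeideal Q R" using pchain_prime[OF c(1)] by auto
    have zero: "I = {\<zero>}" if "primeideal I R" for I
    proof -
      have "I \<in> {I. ideal I R}" using primeideal.axioms(1)[OF that] by simp
      then have "I = {\<zero>} \<or> I = carrier R" unfolding all_ideals by simp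
      then show ?thesis using primeideal.I_notcarr[OF that] by simp
    qed
    show False using zero[OF P'(1)] zero[OF P'(3)] P'(2) by simp
  qed
  then have "krull_dim R \<le> 0" unfolding krull_dim_pchain by (intro Sup_least) (auto simp: zero_enat_def)
  then show ?thesis by simp
qed

context local_noetherian_cring
begin

lemma max_ideal_eq: "max_ideal R = \<mm>"
  unfolding max_ideal_def using maximal unique_maximal by (rule the_equality)

lemma ex_inverse:
  assumes "s \<in> carrier R - \<mm>" shows "\<exists>t \<in> carrier R. t \<otimes> s = \<one>"
proof -
  have s: "s \<in> carrier R" using assms by blast
  have "\<one> \<in> PIdl s" using unit_cancel[OF assms one_closed cgenideal_ideal[OF s]] cgenideal_self[OF s] s by simp
  then show ?thesis unfolding cgenideal_def by auto
qed

lemma annihilator_eq_mm: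
  assumes V: "module R V" "\<mm> \<subseteq> annihilator R V" "carrier V \<noteq> {\<zero>\<^bsub>V\<^esub>}"
  shows "annihilator R V = \<mm>"
proof
  interpret V: module R V by (rule V(1))
  obtain x where x: "x \<in> carrier V" "x \<noteq> \<zero>\<^bsub>V\<^esub>" using V(3) V.M.zero_closed by blast
  show "annihilator R V \<subseteq> \<mm>"
  proof
    fix a assume a: "a \<in> annihilator R V"
    then have ac: "a \<in> carrier R" "a \<odot>\<^bsub>V\<^esub> x = \<zero>\<^bsub>V\<^esub>" using x unfolding annihilator_def by auto
    show "a \<in> \<mm>"
    proof (rule ccontr)
      assume "a \<notin> \<mm>"
      then obtain t where t: "t \<in> carrier R" "t \<otimes> a = \<one>" using ex_inverse ac by blast
      have "x = t \<odot>\<^bsub>V\<^esub> (a \<odot>\<^bsub>V\<^esub> x)" using V.smult_assoc1[OF t(1) ac(1) x(1)] t(2) x(1) by simp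
      then show False using ac(2) t(1) x(2) by simp
    qed
  qed
qed (rule V(2))

text \<open>A nonzero such module has annihilator \<mm>, so its dimension is that of the residue
  field, which is 0; its depth is 0 as no element of \<mm> is a nonzerodivisor on it. The zero
  module is Cohen--Macaulay by definition.\<close>

lemma residue_module_cohen_macaulay:
  assumes V: "finitely_generated R V" "\<mm> \<subseteq> annihilator R V"
  shows "cohen_macaulay R V"
proof (cases "carrier V = {\<zero>\<^bsub>V\<^esub>}")
  case True then show ?thesis unfolding cohen_macaulay_def using V by blast
next
  case False
  have Vm: "module R V" using V(1) unfolding finitely_generated_def by blast
  interpret V: module R V by (rule Vm)
  have ann: "annihilator R V = \<mm>" by (rule annihilator_eq_mm[OF Vm V(2) False])
  have "module_dim R V = 0"
    unfolding module_dim_def ann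
    by (rule field.krull_dim_field[OF maximalideal.quotient_is_field[OF maximal is_cring]])
  moreover have "xs = []" if xs: "regular_seq R V xs" "set xs \<subseteq> \<mm>" for xs
  proof (rule ccontr)
    assume "xs \<noteq> []"
    let ?O = "ideal_smult R V {}"
    have O: "?O = gen_submodule R V {}" unfolding ideal_smult_def by simp
    have z: "\<zero>\<^bsub>V\<^esub> \<in> ?O" unfolding O
      by (rule submodule_closed(2)[OF gen_submodule_submodule(1)[OF Vm]]) simp
    have le: "?O \<subseteq> {\<zero>\<^bsub>V\<^esub>}" unfolding O using submodule_zero[OF Vm] by (intro gen_submodule_minimal) auto
    \<comment> \<open>Entry 0 kills \<open>V\<close>, so regularity modulo the zero submodule
      \<open>?O\<close> forces every \<open>y\<close> into it.\<close>
    have "y \<in> ?O" if y: "y \<in> carrier V" for y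
    proof -
      have "xs ! 0 \<in> annihilator R V" using \<open>xs \<noteq> []\<close> xs(2) ann by (metis length_greater_0_conv nth_mem subsetD)
      then have "xs ! 0 \<odot>\<^bsub>V\<^esub> y \<in> ?O" using y z unfolding annihilator_def by simp
      then show ?thesis using xs(1) \<open>xs \<noteq> []\<close> y unfolding regular_seq_def by (auto dest: spec[of _ 0])
    qed
    then show False using le False V.M.zero_closed by blast
  qed
  then have "depth R V \<le> 0"
    unfolding depth_def max_regular_length_def max_ideal_eq by (intro Sup_least) (auto simp: zero_enat_def)
  ultimately show ?thesis unfolding cohen_macaulay_def using V(1) by simp
qed

lemma reg_mod_subset_mm: "reg_mod R {\<zero>} ys \<Longrightarrow> set ys \<subseteq> \<mm>"
  using reg_mod_iff[OF zeroideal, of ys] foldl_adj_ideal[OF zeroideal, of ys] proper_ideal_le_mm by blast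

text \<open>Every regular sequence of \<open>R\<close> generates a proper ideal and so lies in
  \<mm>, hence in the annihilator, whether this is \<mm> or all of \<open>R\<close>.\<close>

lemma grade_residue_module:
  assumes "\<mm> \<subseteq> annihilator R V" "length zs = d" "reg_mod R {\<zero>} zs"
    and le: "\<And>ys. reg_mod R {\<zero>} ys \<Longrightarrow> length ys \<le> d"
  shows "grade R V = enat d"
  unfolding grade_def max_regular_length_def regular_seq_self_iff
proof (rule antisym)
  show "Sup {enat (length xs) |xs. reg_mod R {\<zero>} xs \<and> set xs \<subseteq> annihilator R V} \<le> enat d"
    using le by (intro Sup_least) auto
  show "enat d \<le> Sup {enat (length xs) |xs. reg_mod R {\<zero>} xs \<and> set xs \<subseteq> annihilator R V}"
    using assms(1-3) reg_mod_subset_mm[OF assms(3)] by (intro Sup_upper) auto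
qed

end

section \<open>Koszul matrix factorizations\<close>

text \<open>The operator \<open>D = kfact M ps\<close> acts on families of \<open>2^n\<close> elements of \<open>M\<close>, indexed by the lists of
  length \<open>n = length ps\<close>; the values at other lists are irrelevant. One more pair \<open>(a, x)\<close> turns \<open>D\<close> into
  \<open>(u, w) \<mapsto> (D u + a w, x u - D w)\<close>, whose square is \<open>D\<^sup>2 + a x\<close>.\<close>

primrec kfact :: "('a, 'b, 'm) module_scheme \<Rightarrow> ('a \<times> 'a) list \<Rightarrow> (bool list \<Rightarrow> 'b) \<Rightarrow> bool list \<Rightarrow> 'b" where
  "kfact M [] v = (\<lambda>_. \<zero>\<^bsub>M\<^esub>)"
| "kfact M (p # ps) v = (\<lambda>bs. case bs of [] \<Rightarrow> \<zero>\<^bsub>M\<^esub>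
     | False # c \<Rightarrow> kfact M ps (\<lambda>e. v (False # e)) c \<oplus>\<^bsub>M\<^esub> fst p \<odot>\<^bsub>M\<^esub> v (True # c)
     | True # c \<Rightarrow> snd p \<odot>\<^bsub>M\<^esub> v (False # c) \<ominus>\<^bsub>M\<^esub> kfact M ps (\<lambda>e. v (True # e)) c)"

definition families :: "nat \<Rightarrow> 'b set \<Rightarrow> (bool list \<Rightarrow> 'b) set" where
  "families n A = {v. \<forall>bs. length bs = n \<longrightarrow> v bs \<in> A}"

lemma familiesD: "v \<in> families n A \<Longrightarrow> length bs = n \<Longrightarrow> v bs \<in> A"
  unfolding families_def by blast

lemma families_SucD:
  "v \<in> families (Suc n) A \<Longrightarrow> (\<lambda>e. v (b # e)) \<in> families n A"
  unfolding families_def by simp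

lemma length_SucE:
  assumes "length bs = Suc n"
  obtains c where "bs = False # c" "length c = n" | c where "bs = True # c" "length c = n"
proof -
  from assms obtain b c where c: "bs = b # c" "length c = n" by (auto simp: length_Suc_conv)
  show thesis by (cases b) (use that c in auto)
qed

text \<open>Only the inclusion of the kernel in the image. The reverse one follows from
  \<open>kfact_kfact\<close> if \<open>lincomb R ps\<close> is zero.\<close>

definition kexact :: "('a, 'b, 'm) module_scheme \<Rightarrow> ('a \<times> 'a) list \<Rightarrow> bool" where
  "kexact M ps \<longleftrightarrow> (\<forall>v \<in> families (length ps) (carrier M).
     (\<forall>bs. length bs = length ps \<longrightarrow> kfact M ps v bs = \<zero>\<^bsub>M\<^esub>) \<longrightarrow>
     (\<exists>w \<in> families (length ps) (carrier M). \<forall>bs. length bs = length ps \<longrightarrow> v bs = kfact M ps w bs))"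

lemma kfact_cong:
  assumes "\<And>bs. length bs = length ps \<Longrightarrow> v bs = w bs" "length bs = length ps"
  shows "kfact M ps v bs = kfact M ps w bs"
  using assms
proof (induction ps arbitrary: v w bs)
  case (Cons p ps)
  have "length bs = Suc (length ps)" using Cons.prems by simp
  then show ?case
    by (rule length_SucE) (use Cons.prems(1) Cons.IH[of "\<lambda>e. v (b # e)" "\<lambda>e. w (b # e)" for b] in auto)
qed simp

context
  fixes R :: "('a, 'r) ring_scheme" and M :: "('a, 'b, 'm) module_scheme"
  assumes M: "module R M"
begin

interpretation M: module R M by (rule M)

lemma kfact_carrier:
  assumes "set ps \<subseteq> carrier R \<times> carrier R" "v \<in> families (length ps) (carrier M)" "length bs = length ps"
  shows "kfact M ps v bs \<in> carrier M"
  using assms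
proof (induction ps arbitrary: v bs)
  case (Cons p ps)
  have p: "fst p \<in> carrier R" "snd p \<in> carrier R" "set ps \<subseteq> carrier R \<times> carrier R" using Cons.prems(1) by auto
  have v: "v \<in> families (Suc (length ps)) (carrier M)" using Cons.prems by simp
  have "length bs = Suc (length ps)" using Cons.prems by simp
  then show ?case
    using Cons.IH[OF p(3) families_SucD[OF v]] p(1,2) familiesD[OF v]
    by (elim length_SucE) auto
qed simp

text \<open>The operator is natural in the module. Below this is applied to multiplication by
  scalars, to coordinates of free modules, to splittings of projective modules and to quotient
  maps.\<close>

lemma kfact_hom:
  assumes N: "module R N" and h: "h \<in> module_hom R M N"
    and "set ps \<subseteq> carrier R \<times> carrier R" "v \<in> families (length ps) (carrier M)" "length bs = length ps"
  shows "h (kfact M ps v bs) = kfact N ps (\<lambda>e. h (v e)) bs"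
  using assms(3-)
proof (induction ps arbitrary: v bs)
  case Nil then show ?case using module_hom_zero[OF M N h] by simp
next
  case (Cons p ps)
  have p: "fst p \<in> carrier R" "snd p \<in> carrier R" "set ps \<subseteq> carrier R \<times> carrier R" using Cons.prems(1) by auto
  have v: "v \<in> families (Suc (length ps)) (carrier M)" using Cons.prems by simp
  have "length bs = Suc (length ps)" using Cons.prems by simp
  then show ?case
  proof (rule length_SucE)
    fix c assume c: "bs = False # c" "length c = length ps"
    have "kfact M ps (\<lambda>e. v (False # e)) c \<in> carrier M" "v (True # c) \<in> carrier M"
      using kfact_carrier[OF p(3) families_SucD[OF v] c(2)] familiesD[OF v] c(2) by auto
    then show ?thesis
      using Cons.IH[OF p(3) families_SucD[OF v] c(2)] p(1) unfolding c(1)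
      by (simp add: module_homD(2,3)[OF h])
  next
    fix c assume c: "bs = True # c" "length c = length ps"
    have "kfact M ps (\<lambda>e. v (True # e)) c \<in> carrier M" "v (False # c) \<in> carrier M"
      using kfact_carrier[OF p(3) families_SucD[OF v] c(2)] familiesD[OF v] c(2) by auto
    then show ?thesis
      using Cons.IH[OF p(3) families_SucD[OF v] c(2)] p(2) unfolding c(1)
      by (simp add: module_hom_minus[OF M N h] module_homD(3)[OF h])
  qed
qed

lemma kfact_smult:
  assumes "a \<in> carrier R" "set ps \<subseteq> carrier R \<times> carrier R"
    "v \<in> families (length ps) (carrier M)" "length bs = length ps"
  shows "kfact M ps (\<lambda>e. a \<odot>\<^bsub>M\<^esub> v e) bs = a \<odot>\<^bsub>M\<^esub> kfact M ps v bs"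
proof -
  have "(\<lambda>x. a \<odot>\<^bsub>M\<^esub> x) \<in> module_hom R M M"
  proof (rule module_homI)
    fix b x assume b: "b \<in> carrier R" "x \<in> carrier M"
    show "a \<odot>\<^bsub>M\<^esub> (b \<odot>\<^bsub>M\<^esub> x) = b \<odot>\<^bsub>M\<^esub> (a \<odot>\<^bsub>M\<^esub> x)"
      using M.smult_assoc1[OF assms(1) b] M.smult_assoc1[OF b(1) assms(1) b(2)] M.R.m_comm[OF assms(1) b(1)]
      by simp
  qed (use assms(1) in \<open>auto simp: M.smult_r_distr\<close>)
  from kfact_hom[OF M this assms(2-)] show ?thesis by simp
qed

lemma kfact_add:
  assumes "set ps \<subseteq> carrier R \<times> carrier R" "v \<in> families (length ps) (carrier M)"
    "w \<in> families (length ps) (carrier M)" "length bs = length ps"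
  shows "kfact M ps (\<lambda>e. v e \<oplus>\<^bsub>M\<^esub> w e) bs = kfact M ps v bs \<oplus>\<^bsub>M\<^esub> kfact M ps w bs"
  using assms
proof (induction ps arbitrary: v w bs)
  case (Cons p ps)
  have p: "fst p \<in> carrier R" "snd p \<in> carrier R" "set ps \<subseteq> carrier R \<times> carrier R" using Cons.prems(1) by auto
  have v: "v \<in> families (Suc (length ps)) (carrier M)" and w: "w \<in> families (Suc (length ps)) (carrier M)"
    using Cons.prems by simp_all
  note vS = families_SucD[OF v] and wS = families_SucD[OF w]
  note IH = Cons.IH[OF p(3) vS wS]
  note cv = kfact_carrier[OF p(3) vS] and cw = kfact_carrier[OF p(3) wS]
  have "length bs = Suc (length ps)" using Cons.prems by simp
  then show ?case
  proof (rule length_SucE)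
    fix c assume c: "bs = False # c" "length c = length ps"
    have t: "v (True # c) \<in> carrier M" "w (True # c) \<in> carrier M" using familiesD[OF v] familiesD[OF w] c(2) by auto
    show ?thesis unfolding c(1) using IH[OF c(2)] cv[OF c(2)] cw[OF c(2)] t p(1)
      by (simp add: M.smult_r_distr M.M.a_ac)
  next
    fix c assume c: "bs = True # c" "length c = length ps"
    have t: "v (False # c) \<in> carrier M" "w (False # c) \<in> carrier M" using familiesD[OF v] familiesD[OF w] c(2) by auto
    show ?thesis unfolding c(1) using IH[OF c(2)] cv[OF c(2)] cw[OF c(2)] t p(2)
      by (simp add: M.smult_r_distr M.M.minus_eq M.M.minus_add M.M.a_ac)
  qed
qed simp

lemma kfact_kfact:
  assumes "set ps \<subseteq> carrier R \<times> carrier R" "v \<in> families (length ps) (carrier M)" "length bs = length ps"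
  shows "kfact M ps (kfact M ps v) bs = lincomb R ps \<odot>\<^bsub>M\<^esub> v bs"
  using assms
proof (induction ps arbitrary: v bs)
  case Nil then show ?case unfolding families_def by simp
next
  case (Cons p ps)
  let ?n = "length ps"
  have p: "fst p \<in> carrier R" "snd p \<in> carrier R" "set ps \<subseteq> carrier R \<times> carrier R" using Cons.prems(1) by auto
  have l: "lincomb R ps \<in> carrier R" using p(3) by (induction ps) auto
  have v: "v \<in> families (Suc ?n) (carrier M)" using Cons.prems by simp
  define u where "u e = v (False # e)" for e
  define w where "w e = v (True # e)" for e
  have uw: "u \<in> families ?n (carrier M)" "w \<in> families ?n (carrier M)"
    using families_SucD[OF v] unfolding u_def w_def by auto
  let ?D = "kfact M ps"
  have D: "?D z \<in> families ?n (carrier M)" if "z \<in> families ?n (carrier M)" for z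
    using kfact_carrier[OF p(3) that] unfolding families_def by simp
  have sm: "(\<lambda>e. a \<odot>\<^bsub>M\<^esub> z e) \<in> families ?n (carrier M)" if "a \<in> carrier R" "z \<in> families ?n (carrier M)" for a z
    using that unfolding families_def by simp
  have neg: "?D (\<lambda>e. z e \<ominus>\<^bsub>M\<^esub> y e) c = ?D z c \<ominus>\<^bsub>M\<^esub> ?D y c"
    if z: "z \<in> families ?n (carrier M)" and y: "y \<in> families ?n (carrier M)" and c: "length c = ?n" for z y c
  proof -
    let ?y = "\<lambda>e. (\<ominus>\<^bsub>R\<^esub> \<one>\<^bsub>R\<^esub>) \<odot>\<^bsub>M\<^esub> y e"
    have "?D (\<lambda>e. z e \<ominus>\<^bsub>M\<^esub> y e) c = ?D (\<lambda>e. z e \<oplus>\<^bsub>M\<^esub> ?y e) c"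
      using familiesD[OF y] c by (intro kfact_cong) (simp_all add: M.smult_l_minus M.M.minus_eq)
    also have "\<dots> = ?D z c \<oplus>\<^bsub>M\<^esub> (\<ominus>\<^bsub>R\<^esub> \<one>\<^bsub>R\<^esub>) \<odot>\<^bsub>M\<^esub> ?D y c"
      using kfact_add[OF p(3) z sm[OF _ y] c] kfact_smult[OF _ p(3) y c] by simp
    also have "\<dots> = ?D z c \<ominus>\<^bsub>M\<^esub> ?D y c"
      using familiesD[OF D[OF y] c] by (simp add: M.smult_l_minus M.M.minus_eq)
    finally show ?thesis .
  qed
  have F: "(\<lambda>e. kfact M (p # ps) v (False # e)) = (\<lambda>e. ?D u e \<oplus>\<^bsub>M\<^esub> fst p \<odot>\<^bsub>M\<^esub> w e)"
    and T: "(\<lambda>e. kfact M (p # ps) v (True # e)) = (\<lambda>e. snd p \<odot>\<^bsub>M\<^esub> u e \<ominus>\<^bsub>M\<^esub> ?D w e)"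
    unfolding u_def w_def by simp_all
  have "length bs = Suc ?n" using Cons.prems by simp
  then show ?case
  proof (rule length_SucE)
    fix c assume c: "bs = False # c" "length c = ?n"
    have cc: "u c \<in> carrier M" "w c \<in> carrier M" "?D u c \<in> carrier M" "?D w c \<in> carrier M"
      using familiesD c(2) uw D by metis+
    have "kfact M (p # ps) (kfact M (p # ps) v) bs =
        ?D (\<lambda>e. ?D u e \<oplus>\<^bsub>M\<^esub> fst p \<odot>\<^bsub>M\<^esub> w e) c \<oplus>\<^bsub>M\<^esub> fst p \<odot>\<^bsub>M\<^esub> (snd p \<odot>\<^bsub>M\<^esub> u c \<ominus>\<^bsub>M\<^esub> ?D w c)"
      unfolding c(1) using F T by (simp add: fun_eq_iff)
    also have "?D (\<lambda>e. ?D u e \<oplus>\<^bsub>M\<^esub> fst p \<odot>\<^bsub>M\<^esub> w e) c = lincomb R ps \<odot>\<^bsub>M\<^esub> u c \<oplus>\<^bsub>M\<^esub> fst p \<odot>\<^bsub>M\<^esub> ?D w c"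
      using kfact_add[OF p(3) D[OF uw(1)] sm[OF p(1) uw(2)] c(2)] kfact_smult[OF p(1,3) uw(2) c(2)]
        Cons.IH[OF p(3) uw(1) c(2)] by simp
    \<comment> \<open>The two terms \<open>fst p\<close> times \<open>?D w c\<close> have opposite
      signs and cancel.\<close>
    also have "(lincomb R ps \<odot>\<^bsub>M\<^esub> u c \<oplus>\<^bsub>M\<^esub> fst p \<odot>\<^bsub>M\<^esub> ?D w c) \<oplus>\<^bsub>M\<^esub> fst p \<odot>\<^bsub>M\<^esub> (snd p \<odot>\<^bsub>M\<^esub> u c \<ominus>\<^bsub>M\<^esub> ?D w c) =
        (fst p \<otimes>\<^bsub>R\<^esub> snd p \<oplus>\<^bsub>R\<^esub> lincomb R ps) \<odot>\<^bsub>M\<^esub> u c"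
      using p(1,2) l cc
      by (simp add: M.smult_r_distr M.smult_l_distr M.smult_assoc1 M.M.minus_eq M.smult_r_minus M.M.a_ac M.M.r_neg2 M.M.r_neg1 M.M.r_neg)
    finally show ?thesis unfolding c(1) u_def by simp
  next
    fix c assume c: "bs = True # c" "length c = ?n"
    have cc: "u c \<in> carrier M" "w c \<in> carrier M" "?D u c \<in> carrier M" "?D w c \<in> carrier M"
      using familiesD c(2) uw D by metis+
    have "kfact M (p # ps) (kfact M (p # ps) v) bs =
        snd p \<odot>\<^bsub>M\<^esub> (?D u c \<oplus>\<^bsub>M\<^esub> fst p \<odot>\<^bsub>M\<^esub> w c) \<ominus>\<^bsub>M\<^esub> ?D (\<lambda>e. snd p \<odot>\<^bsub>M\<^esub> u e \<ominus>\<^bsub>M\<^esub> ?D w e) c"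
      unfolding c(1) using F T by (simp add: fun_eq_iff)
    also have "?D (\<lambda>e. snd p \<odot>\<^bsub>M\<^esub> u e \<ominus>\<^bsub>M\<^esub> ?D w e) c = snd p \<odot>\<^bsub>M\<^esub> ?D u c \<ominus>\<^bsub>M\<^esub> lincomb R ps \<odot>\<^bsub>M\<^esub> w c"
      using neg[OF sm[OF p(2) uw(1)] D[OF uw(2)] c(2)] kfact_smult[OF p(2,3) uw(1) c(2)]
        Cons.IH[OF p(3) uw(2) c(2)] by simp
    also have "snd p \<odot>\<^bsub>M\<^esub> (?D u c \<oplus>\<^bsub>M\<^esub> fst p \<odot>\<^bsub>M\<^esub> w c) \<ominus>\<^bsub>M\<^esub> (snd p \<odot>\<^bsub>M\<^esub> ?D u c \<ominus>\<^bsub>M\<^esub> lincomb R ps \<odot>\<^bsub>M\<^esub> w c) =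
        (fst p \<otimes>\<^bsub>R\<^esub> snd p \<oplus>\<^bsub>R\<^esub> lincomb R ps) \<odot>\<^bsub>M\<^esub> w c"
    proof -
      have "snd p \<odot>\<^bsub>M\<^esub> (fst p \<odot>\<^bsub>M\<^esub> w c) = (fst p \<otimes>\<^bsub>R\<^esub> snd p) \<odot>\<^bsub>M\<^esub> w c"
        using M.smult_assoc1[OF p(2,1) cc(2)] M.R.m_comm[OF p(1,2)] by simp
      moreover have "(s \<oplus>\<^bsub>M\<^esub> t) \<ominus>\<^bsub>M\<^esub> (s \<ominus>\<^bsub>M\<^esub> r) = t \<oplus>\<^bsub>M\<^esub> r"
        if "s \<in> carrier M" "t \<in> carrier M" "r \<in> carrier M" for s t r
      proof -
        have "(s \<oplus>\<^bsub>M\<^esub> t) \<ominus>\<^bsub>M\<^esub> (s \<ominus>\<^bsub>M\<^esub> r) = (t \<oplus>\<^bsub>M\<^esub> s) \<oplus>\<^bsub>M\<^esub> (\<ominus>\<^bsub>M\<^esub> s \<oplus>\<^bsub>M\<^esub> r)"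
          using that by (simp add: M.M.minus_eq M.M.minus_add M.M.a_comm[of s t])
        also have "\<dots> = t \<oplus>\<^bsub>M\<^esub> r" using that by (simp add: M.M.a_assoc M.M.r_neg2)
        finally show ?thesis .
      qed
      ultimately show ?thesis using p(1,2) l cc
        by (simp add: M.smult_r_distr M.smult_l_distr)
    qed
    finally show ?thesis unfolding c(1) w_def by simp
  qed
qed

lemma kfact_zero:
  assumes "fst ` set ps \<union> snd ` set ps \<subseteq> annihilator R M" "v \<in> families (length ps) (carrier M)" "length bs = length ps"
  shows "kfact M ps v bs = \<zero>\<^bsub>M\<^esub>"
  using assms
proof (induction ps arbitrary: v bs)
  case (Cons p ps)
  have v: "v \<in> families (Suc (length ps)) (carrier M)" using Cons.prems by simp
  have p: "fst ` set ps \<union> snd ` set ps \<subseteq> annihilator R M"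
    "\<And>x. x \<in> carrier M \<Longrightarrow> fst p \<odot>\<^bsub>M\<^esub> x = \<zero>\<^bsub>M\<^esub>" "\<And>x. x \<in> carrier M \<Longrightarrow> snd p \<odot>\<^bsub>M\<^esub> x = \<zero>\<^bsub>M\<^esub>"
    using Cons.prems(1) unfolding annihilator_def by auto
  have "length bs = Suc (length ps)" using Cons.prems by simp
  then show ?case
    using Cons.IH[OF p(1) families_SucD[OF v]] p(2,3) familiesD[OF v]
    by (elim length_SucE) (auto simp: M.M.minus_eq)
qed simp

end

section \<open>Exactness of the factorization over the hypersurface ring\<close>

lemma kfact_submodule:
  assumes M: "module R M" and K: "submodule K R M"
    and "set ps \<subseteq> carrier R \<times> carrier R" "v \<in> families (length ps) K" "length bs = length ps"
  shows "kfact (M\<lparr>carrier := K\<rparr>) ps v bs = kfact M ps v bs"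
proof -
  have i: "(\<lambda>x. x) \<in> module_hom R (M\<lparr>carrier := K\<rparr>) M"
    using submodule_closed(1)[OF K] by (intro module_homI) auto
  show ?thesis using kfact_hom[OF submodule_module[OF M K] M i assms(3)] assms(4,5) by simp
qed

lemma kexact_self_of_hypersurface:
  assumes S: "cring S" and R: "cring R" and h: "h \<in> ring_hom S R" "h ` carrier S = carrier R"
    and ker: "{s \<in> carrier S. h s = \<zero>\<^bsub>R\<^esub>} = PIdl\<^bsub>S\<^esub> f" and f: "f \<in> carrier S" "f = lincomb S ps"
    and ps: "set ps \<subseteq> carrier S \<times> carrier S"
    and reg: "\<And>a. a \<in> carrier S \<Longrightarrow> f \<otimes>\<^bsub>S\<^esub> a = \<zero>\<^bsub>S\<^esub> \<Longrightarrow> a = \<zero>\<^bsub>S\<^esub>"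
  shows "kexact (self_module R) (map (map_prod h h) ps)"
proof -
  interpret surj_cring_hom S R h by (intro surj_cring_hom.intro S R surj_cring_hom_axioms.intro h)
  interpret SM: module S "self_module S" by (rule S.self_module_module)
  let ?n = "length ps" and ?ps = "map (map_prod h h) ps"
  have carr: "kfact (self_module S) qs v bs \<in> carrier S"
    if "set qs \<subseteq> carrier S \<times> carrier S" "v \<in> families (length qs) (carrier S)" "length bs = length qs" for qs v bs
    using kfact_carrier[OF S.self_module_module that(1) _ that(3)] that(2) unfolding self_module_simps .
  \<comment> \<open>\<open>kfact_hom\<close> concerns modules over one ring; along \<open>h\<close>
    the scalars change as well, so naturality has to be proved again.\<close>
  have base: "h (kfact (self_module S) qs v bs) = kfact (self_module R) (map (map_prod h h) qs) (\<lambda>e. h (v e)) bs"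
    if "set qs \<subseteq> carrier S \<times> carrier S" "v \<in> families (length qs) (carrier S)" "length bs = length qs" for qs v bs
    using that
  proof (induction qs arbitrary: v bs)
    case Nil then show ?case by (simp add: self_module_simps h_simps)
  next
    case (Cons p qs)
    have p: "fst p \<in> carrier S" "snd p \<in> carrier S" "set qs \<subseteq> carrier S \<times> carrier S" using Cons.prems(1) by auto
    have v: "v \<in> families (Suc (length qs)) (carrier S)" using Cons.prems by simp
    note IH = Cons.IH[OF p(3) families_SucD[OF v]] and c = carr[OF p(3) families_SucD[OF v]]
    have "length bs = Suc (length qs)" using Cons.prems by simp
    then show ?case
      by (rule length_SucE)
         (use IH c p familiesD[OF v] in \<open>simp_all add: self_module_simps h_simps a_minus_def\<close>)
  qed
  show ?thesis unfolding kexact_def length_map self_module_simps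
  proof (intro ballI impI)
    fix v assume v: "v \<in> families ?n (carrier R)"
      and z: "\<forall>bs. length bs = ?n \<longrightarrow> kfact (self_module R) ?ps v bs = \<zero>\<^bsub>R\<^esub>"
    have "\<exists>s. length bs = ?n \<longrightarrow> s \<in> carrier S \<and> h s = v bs" for bs
      using lift familiesD[OF v, of bs] by (cases "length bs = ?n") auto
    then obtain y where y: "\<And>bs. length bs = ?n \<Longrightarrow> y bs \<in> carrier S \<and> h (y bs) = v bs" by metis
    have yf: "y \<in> families ?n (carrier S)" unfolding families_def using y by blast
    let ?D = "kfact (self_module S) ps"
    have "\<exists>s. length bs = ?n \<longrightarrow> s \<in> carrier S \<and> ?D y bs = f \<otimes>\<^bsub>S\<^esub> s" for bs
    proof (cases "length bs = ?n")
      case True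
      have "h (?D y bs) = kfact (self_module R) ?ps (\<lambda>e. h (y e)) bs" by (rule base[OF ps yf True])
      also have "\<dots> = kfact (self_module R) ?ps v bs" using y True by (intro kfact_cong) simp_all
      also have "\<dots> = \<zero>\<^bsub>R\<^esub>" using z True by simp
      finally have "?D y bs \<in> PIdl\<^bsub>S\<^esub> f" using carr[OF ps yf True] unfolding ker[symmetric] by simp
      then obtain s where "s \<in> carrier S" "?D y bs = s \<otimes>\<^bsub>S\<^esub> f" unfolding cgenideal_def by blast
      then show ?thesis using S.m_comm f(1) by metis
    qed simp
    \<comment> \<open>Over \<open>S\<close> the operator takes the lift \<open>y\<close> to a
      multiple of \<open>f\<close>, coordinate by coordinate.\<close>
    then obtain w where w: "\<And>bs. length bs = ?n \<Longrightarrow> w bs \<in> carrier S \<and> ?D y bs = f \<otimes>\<^bsub>S\<^esub> w bs" by metis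
    have wf: "w \<in> families ?n (carrier S)" unfolding families_def using w by blast
    have eq: "y bs = ?D w bs" if bs: "length bs = ?n" for bs
    proof -
      have c: "y bs \<in> carrier S" "?D w bs \<in> carrier S" using y[OF bs] carr[OF ps wf bs] by auto
      \<comment> \<open>D^2 = f turns D y = f w into f y = f D w.\<close>
      have "f \<otimes>\<^bsub>S\<^esub> y bs = ?D (?D y) bs"
        using kfact_kfact[OF S.self_module_module ps _ bs, of y] yf f(2) unfolding self_module_simps by simp
      also have "\<dots> = ?D (\<lambda>e. f \<otimes>\<^bsub>S\<^esub> w e) bs" using w bs by (intro kfact_cong) auto
      also have "\<dots> = f \<otimes>\<^bsub>S\<^esub> ?D w bs"
        using kfact_smult[OF S.self_module_module f(1) ps _ bs, of w] wf unfolding self_module_simps by simp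
      finally have e: "f \<otimes>\<^bsub>S\<^esub> y bs = f \<otimes>\<^bsub>S\<^esub> ?D w bs" .
      have "f \<otimes>\<^bsub>S\<^esub> (y bs \<ominus>\<^bsub>S\<^esub> ?D w bs) = f \<otimes>\<^bsub>S\<^esub> y bs \<ominus>\<^bsub>S\<^esub> f \<otimes>\<^bsub>S\<^esub> ?D w bs"
        using f(1) c by (simp add: S.r_distr S.r_minus a_minus_def)
      also have "\<dots> = \<zero>\<^bsub>S\<^esub>" unfolding e using f(1) c by (simp add: a_minus_def S.r_neg)
      finally have "f \<otimes>\<^bsub>S\<^esub> (y bs \<ominus>\<^bsub>S\<^esub> ?D w bs) = \<zero>\<^bsub>S\<^esub>" .
      from reg[OF S.minus_closed[OF c] this] show ?thesis using S.r_right_minus_eq[OF c] by simp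
    qed
    show "\<exists>w \<in> families ?n (carrier R). \<forall>bs. length bs = ?n \<longrightarrow> v bs = kfact (self_module R) ?ps w bs"
    proof (intro bexI[of _ "\<lambda>e. h (w e)"] allI impI)
      show "(\<lambda>e. h (w e)) \<in> families ?n (carrier R)" using w h_simps(1) unfolding families_def by auto
      fix bs :: "bool list" assume bs: "length bs = ?n"
      have "v bs = h (y bs)" using y[OF bs] by simp
      then show "v bs = kfact (self_module R) ?ps (\<lambda>e. h (w e)) bs" using base[OF ps wf bs] eq[OF bs] by simp
    qed
  qed
qed

text \<open>Exactness is checked in each coordinate. A solution is chosen to be zero wherever the
  coordinates of \<open>v\<close> vanish, so that the solutions together have finite
  support.\<close>

lemma (in cring) kexact_free:
  assumes ps: "set ps \<subseteq> carrier R \<times> carrier R" and ex: "kexact (self_module R) ps"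
  shows "kexact (free_module R X) ps"
  unfolding kexact_def
proof (intro ballI impI)
  let ?F = "free_module R X" and ?n = "length ps" and ?D = "kfact (self_module R) ps"
  fix v assume v: "v \<in> families ?n (carrier ?F)"
    and z: "\<forall>bs. length bs = ?n \<longrightarrow> kfact ?F ps v bs = \<zero>\<^bsub>?F\<^esub>"
  have ev: "(\<lambda>y. y x) \<in> module_hom R ?F (self_module R)" for x
    by (rule module_homI) (auto simp: self_module_simps free_module_simps free_module_val)
  note comp = kfact_hom[OF free_module_module self_module_module ev ps]
  have zero: "?D (\<lambda>_. \<zero>) bs = \<zero>" if "length bs = ?n" for bs
    using kfact_smult[OF self_module_module zero_closed ps, of "\<lambda>_. \<zero>" bs]
      kfact_carrier[OF self_module_module ps, of "\<lambda>_. \<zero>" bs] that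
    by (simp add: families_def self_module_simps)
  have "\<exists>w. w \<in> families ?n (carrier R) \<and> (\<forall>bs. length bs = ?n \<longrightarrow> v bs x = ?D w bs) \<and>
     ((\<forall>bs. length bs = ?n \<longrightarrow> v bs x = \<zero>) \<longrightarrow> w = (\<lambda>_. \<zero>))" for x
  proof (cases "\<forall>bs. length bs = ?n \<longrightarrow> v bs x = \<zero>")
    case True
    then show ?thesis using zero by (intro exI[of _ "\<lambda>_. \<zero>"]) (auto simp: families_def)
  next
    case False
    have "(\<lambda>bs. v bs x) \<in> families ?n (carrier R)"
      using free_module_val[OF familiesD[OF v]] unfolding families_def by simp
    moreover have "?D (\<lambda>bs. v bs x) bs = \<zero>" if "length bs = ?n" for bs
      using comp[OF v that, of x] z that by (simp add: free_module_simps)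
    ultimately have "\<exists>w \<in> families ?n (carrier R). \<forall>bs. length bs = ?n \<longrightarrow> v bs x = ?D w bs"
      using ex unfolding kexact_def self_module_simps by blast
    then show ?thesis using False by blast
  qed
  then obtain w where w: "\<And>x. w x \<in> families ?n (carrier R)" "\<And>x bs. length bs = ?n \<Longrightarrow> v bs x = ?D (w x) bs"
    "\<And>x. (\<And>bs. length bs = ?n \<Longrightarrow> v bs x = \<zero>) \<Longrightarrow> w x = (\<lambda>_. \<zero>)" by metis
  let ?w = "\<lambda>bs x. w x bs"
  \<comment> \<open>There are finitely many lists of length \<open>?n\<close>, and each value of
    \<open>v\<close> at such a list has finite support.\<close>
  have supp: "{x. \<exists>bs. length bs = ?n \<and> v bs x \<noteq> \<zero>} = (\<Union>bs\<in>{bs. length bs = ?n}. {x. v bs x \<noteq> \<zero>})" by blast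
  have fin: "finite {x. \<exists>bs. length bs = ?n \<and> v bs x \<noteq> \<zero>}"
    unfolding supp using finite_lists_length_eq[of "UNIV :: bool set" ?n] familiesD[OF v]
    by (intro finite_UN_I) (auto simp: free_module_carrier)
  have wf: "?w \<in> families ?n (carrier ?F)"
    unfolding families_def free_module_carrier
  proof (intro CollectI allI impI conjI ballI)
    fix bs :: "bool list" assume bs: "length bs = ?n"
    show "w x bs \<in> carrier R" for x using familiesD[OF w(1) bs] .
    show "w x bs = \<zero>" if "x \<notin> X" for x
      using w(3)[of x] familiesD[OF v] that unfolding free_module_carrier by simp
    have "{x. w x bs \<noteq> \<zero>} \<subseteq> {x. \<exists>bs. length bs = ?n \<and> v bs x \<noteq> \<zero>}" using w(3) by force
    then show "finite {x. w x bs \<noteq> \<zero>}" using fin by (rule finite_subset)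
  qed
  have "v bs = kfact ?F ps ?w bs" if bs: "length bs = ?n" for bs
    using comp[OF wf bs] w(2)[OF bs] by (intro ext) simp
  then show "\<exists>w \<in> families ?n (carrier ?F). \<forall>bs. length bs = ?n \<longrightarrow> v bs = kfact ?F ps w bs"
    using wf by blast
qed

text \<open>A direct summand of an exact complex is exact: \<open>s\<close> sends a family to the
  free module, and \<open>q\<close> brings the solution back.\<close>

lemma kexact_projective:
  fixes P :: "('a, 'p, 'm) module_scheme"
  assumes P: "projective_module R P" and ps: "set ps \<subseteq> carrier R \<times> carrier R"
    and ex: "kexact (self_module R) ps"
  shows "kexact P ps"
proof -
  obtain X :: "'p set" and s q where Pm: "module R P" and s: "s \<in> module_hom R P (free_module R X)"
    and q: "q \<in> module_hom R (free_module R X) P" and qs: "\<And>x. x \<in> carrier P \<Longrightarrow> q (s x) = x"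
    using P unfolding projective_module_def by blast
  interpret cring R by (rule module_cring[OF Pm])
  let ?F = "free_module R X" and ?n = "length ps"
  show ?thesis unfolding kexact_def
  proof (intro ballI impI)
    fix v assume v: "v \<in> families ?n (carrier P)" and z: "\<forall>bs. length bs = ?n \<longrightarrow> kfact P ps v bs = \<zero>\<^bsub>P\<^esub>"
    have "(\<lambda>e. s (v e)) \<in> families ?n (carrier ?F)"
      using v module_homD(1)[OF s] unfolding families_def by auto
    moreover have "kfact ?F ps (\<lambda>e. s (v e)) bs = \<zero>\<^bsub>?F\<^esub>" if "length bs = ?n" for bs
      using kfact_hom[OF Pm free_module_module s ps v that] z that module_hom_zero[OF Pm free_module_module s] by simp
    ultimately obtain w where w: "w \<in> families ?n (carrier ?F)"
      "\<And>bs. length bs = ?n \<Longrightarrow> s (v bs) = kfact ?F ps w bs"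
      using kexact_free[OF ps ex, of X] unfolding kexact_def by blast
    have "v bs = kfact P ps (\<lambda>e. q (w e)) bs" if "length bs = ?n" for bs
      using kfact_hom[OF free_module_module Pm q ps w(1) that] w(2)[OF that] qs[OF familiesD[OF v that]] by simp
    moreover have "(\<lambda>e. q (w e)) \<in> families ?n (carrier P)"
      using w(1) module_homD(1)[OF q] unfolding families_def by auto
    ultimately show "\<exists>w \<in> families ?n (carrier P). \<forall>bs. length bs = ?n \<longrightarrow> v bs = kfact P ps w bs" by blast
  qed
qed

text \<open>The long exact sequence of the 2-periodic complexes, as a chase. Lift \<open>v\<close>
  to y; D y lies in the kernel of \<open>h\<close> and D kills it, so D y = D t with t in the
  kernel. Then D (y - t) = 0, so y - t = D w, and v is the image under D of the family h w.\<close>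

lemma kexact_quotient:
  assumes P: "module R P" and B: "module R B" and h: "h \<in> module_hom R P B" "h ` carrier P = carrier B"
    and ps: "set ps \<subseteq> carrier R \<times> carrier R" "lincomb R ps = \<zero>\<^bsub>R\<^esub>"
    and ex: "kexact P ps" "kexact (P\<lparr>carrier := {x \<in> carrier P. h x = \<zero>\<^bsub>B\<^esub>}\<rparr>) ps"
  shows "kexact B ps"
  unfolding kexact_def
proof (intro ballI impI)
  interpret P: module R P by (rule P)
  interpret B: module R B by (rule B)
  let ?K = "{x \<in> carrier P. h x = \<zero>\<^bsub>B\<^esub>}" and ?n = "length ps"
  let ?D = "kfact P ps"
  have K: "submodule ?K R P" by (rule submodule_kernel[OF P B h(1)])
  note Keq = kfact_submodule[OF P K ps(1)]
  fix v assume v: "v \<in> families ?n (carrier B)" and z: "\<forall>bs. length bs = ?n \<longrightarrow> kfact B ps v bs = \<zero>\<^bsub>B\<^esub>"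
  have "\<exists>s. length bs = ?n \<longrightarrow> s \<in> carrier P \<and> h s = v bs" for bs
    using h(2) familiesD[OF v, of bs] by (cases "length bs = ?n") (auto simp: image_iff Bex_def, metis imageE)
  then obtain y where y: "\<And>bs. length bs = ?n \<Longrightarrow> y bs \<in> carrier P \<and> h (y bs) = v bs" by metis
  have yf: "y \<in> families ?n (carrier P)" unfolding families_def using y by blast
  have Dy: "?D y \<in> families ?n ?K"
  proof -
    have "?D y bs \<in> ?K" if bs: "length bs = ?n" for bs
    proof -
      have "h (?D y bs) = kfact B ps (\<lambda>e. h (y e)) bs" by (rule kfact_hom[OF P B h(1) ps(1) yf bs])
      also have "\<dots> = kfact B ps v bs" using y bs by (intro kfact_cong) simp_all
      finally show ?thesis using z bs kfact_carrier[OF P ps(1) yf bs] by simp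
    qed
    then show ?thesis unfolding families_def by blast
  qed
  have "kfact (P\<lparr>carrier := ?K\<rparr>) ps (?D y) bs = \<zero>\<^bsub>P\<^esub>" if bs: "length bs = ?n" for bs
    using Keq[OF Dy bs] kfact_kfact[OF P ps(1) yf bs] ps(2) y[OF bs] by simp
  then obtain t where t: "t \<in> families ?n ?K" "\<And>bs. length bs = ?n \<Longrightarrow> ?D y bs = kfact (P\<lparr>carrier := ?K\<rparr>) ps t bs"
    using ex(2) Dy unfolding kexact_def by auto
  have tf: "t \<in> families ?n (carrier P)" using t(1) unfolding families_def by auto
  \<comment> \<open>\<open>?y\<close> is y - t, written with the scalar -1 so that linearity of D
    applies directly.\<close>
  let ?t = "\<lambda>e. (\<ominus>\<^bsub>R\<^esub> \<one>\<^bsub>R\<^esub>) \<odot>\<^bsub>P\<^esub> t e" and ?y = "\<lambda>e. y e \<oplus>\<^bsub>P\<^esub> (\<ominus>\<^bsub>R\<^esub> \<one>\<^bsub>R\<^esub>) \<odot>\<^bsub>P\<^esub> t e"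
  have m1: "\<ominus>\<^bsub>R\<^esub> \<one>\<^bsub>R\<^esub> \<in> carrier R" by simp
  have tf': "?t \<in> families ?n (carrier P)" using tf unfolding families_def by simp
  have yt: "?y \<in> families ?n (carrier P)" using yf tf' unfolding families_def by simp
  have "?D ?y bs = \<zero>\<^bsub>P\<^esub>" if bs: "length bs = ?n" for bs
  proof -
    have c: "?D t bs \<in> carrier P" by (rule kfact_carrier[OF P ps(1) tf bs])
    have "?D ?y bs = ?D y bs \<oplus>\<^bsub>P\<^esub> (\<ominus>\<^bsub>R\<^esub> \<one>\<^bsub>R\<^esub>) \<odot>\<^bsub>P\<^esub> ?D t bs"
      using kfact_add[OF P ps(1) yf tf' bs] kfact_smult[OF P m1 ps(1) tf bs] by simp
    also have "\<dots> = \<zero>\<^bsub>P\<^esub>"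
      using t(2)[OF bs] Keq[OF t(1) bs] c by (simp add: P.smult_l_minus P.M.r_neg)
    finally show ?thesis .
  qed
  then obtain w where w: "w \<in> families ?n (carrier P)" "\<And>bs. length bs = ?n \<Longrightarrow> ?y bs = ?D w bs"
    using ex(1) yt unfolding kexact_def by blast
  have "v bs = kfact B ps (\<lambda>e. h (w e)) bs" if bs: "length bs = ?n" for bs
  proof -
    have tc: "t bs \<in> carrier P" "h (t bs) = \<zero>\<^bsub>B\<^esub>" using familiesD[OF t(1) bs] by auto
    have vb: "v bs \<in> carrier B" by (rule familiesD[OF v bs])
    have "h (?y bs) = h (y bs) \<oplus>\<^bsub>B\<^esub> h (?t bs)"
      using y[OF bs] familiesD[OF tf' bs] by (intro module_homD(2)[OF h(1)]) auto
    also have "\<dots> = v bs" using module_homD(3)[OF h(1) m1 tc(1)] tc(2) y[OF bs] vb by simp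
    finally have "v bs = h (?D w bs)" using w(2)[OF bs] by simp
    then show ?thesis using kfact_hom[OF P B h(1) ps(1) w(1) bs] by simp
  qed
  moreover have "(\<lambda>e. h (w e)) \<in> families ?n (carrier B)"
    using w(1) module_homD(1)[OF h(1)] unfolding families_def by auto
  ultimately show "\<exists>w \<in> families ?n (carrier B). \<forall>bs. length bs = ?n \<longrightarrow> v bs = kfact B ps w bs" by blast
qed

text \<open>Exactness of \<open>D\<close> descends along the syzygies of a bounded projective resolution.\<close>

lemma kexact_finite_proj_dim:
  assumes fpd: "finite_proj_dim R M" and M: "module R M"
    and ps: "set ps \<subseteq> carrier R \<times> carrier R" "lincomb R ps = \<zero>\<^bsub>R\<^esub>" and ex: "kexact (self_module R) ps"
  shows "kexact M ps"
proof -
  obtain P :: "nat \<Rightarrow> ('a, nat \<Rightarrow> 'a) module" and d ep k where P: "projective_resolution R M P d ep"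
    and k: "\<And>n. n > k \<Longrightarrow> carrier (P n) = {\<zero>\<^bsub>P n\<^esub>}"
    using fpd unfolding finite_proj_dim_def by blast
  note p = projective_resolutionD[OF P]
  let ?n = "length ps"
  \<comment> \<open>The syzygies. \<open>?Z (Suc k)\<close> is zero, and the induction descends from
    there to \<open>?Z 0\<close>, the kernel of the augmentation.\<close>
  let ?Z = "\<lambda>n. {x \<in> carrier (P n). res_cycle M P d ep n x}"
  have Zsub: "submodule (?Z n) R (P n)" for n
    unfolding p(6)[symmetric] by (rule submodule_image[OF p(2) p(2) p(4) module.carrier_is_submodule[OF p(2)]])
  have Z: "kexact ((P n)\<lparr>carrier := ?Z n\<rparr>) ps" if "n \<le> Suc k" for n
    using that
  proof (induction rule: inc_induct)
    case base
    have z: "?Z (Suc k) = {\<zero>\<^bsub>P (Suc k)\<^esub>}" using k[of "Suc k"] submodule_closed(2)[OF Zsub[of "Suc k"]] by auto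
    show ?case unfolding kexact_def
    proof (intro ballI impI)
      fix v assume v: "v \<in> families ?n (carrier ((P (Suc k))\<lparr>carrier := ?Z (Suc k)\<rparr>))"
        and "\<forall>bs. length bs = ?n \<longrightarrow> kfact ((P (Suc k))\<lparr>carrier := ?Z (Suc k)\<rparr>) ps v bs
            = \<zero>\<^bsub>(P (Suc k))\<lparr>carrier := ?Z (Suc k)\<rparr>\<^esub>"
      then show "\<exists>w \<in> families ?n (carrier ((P (Suc k))\<lparr>carrier := ?Z (Suc k)\<rparr>)).
          \<forall>bs. length bs = ?n \<longrightarrow> v bs = kfact ((P (Suc k))\<lparr>carrier := ?Z (Suc k)\<rparr>) ps w bs"
        using familiesD[OF v] unfolding z by (intro bexI[of _ v]) auto
    qed
  next
    case (step n)
    have "d n \<in> module_hom R (P (Suc n)) ((P n)\<lparr>carrier := ?Z n\<rparr>)"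
      using module_homD[OF p(4)[of n]] p(6)[of n] by (intro module_homI) auto
    moreover have "d n ` carrier (P (Suc n)) = carrier ((P n)\<lparr>carrier := ?Z n\<rparr>)" using p(6)[of n] by simp
    moreover have "{x \<in> carrier (P (Suc n)). d n x = \<zero>\<^bsub>(P n)\<lparr>carrier := ?Z n\<rparr>\<^esub>} = ?Z (Suc n)"
      unfolding res_cycle_def by simp
    ultimately show ?case
      using kexact_quotient[where P = "P (Suc n)" and B = "(P n)\<lparr>carrier := ?Z n\<rparr>" and h = "d n",
          OF p(2) submodule_module[OF p(2) Zsub] _ _ ps kexact_projective[OF p(1) ps(1) ex]]
        step.IH by simp
  qed
  have "{x \<in> carrier (P 0). ep x = \<zero>\<^bsub>M\<^esub>} = ?Z 0" unfolding res_cycle_def by simp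
  then show ?thesis
    using kexact_quotient[OF p(2) M p(3) p(5) ps kexact_projective[OF p(1) ps(1) ex]] Z[of 0] by simp
qed

lemma infinite_proj_dim_of_kexact:
  assumes M: "module R M" "carrier M \<noteq> {\<zero>\<^bsub>M\<^esub>}" and ps: "fst ` set ps \<union> snd ` set ps \<subseteq> annihilator R M"
    "lincomb R ps = \<zero>\<^bsub>R\<^esub>" and ex: "kexact (self_module R) ps"
  shows "\<not> finite_proj_dim R M"
proof
  assume fpd: "finite_proj_dim R M"
  let ?n = "length ps"
  obtain x where x: "x \<in> carrier M" "x \<noteq> \<zero>\<^bsub>M\<^esub>" using M(2) module_zero_closed[OF M(1)] by blast
  have psc: "set ps \<subseteq> carrier R \<times> carrier R" using ps(1) unfolding annihilator_def by force
  note kM = kexact_finite_proj_dim[OF fpd M(1) psc ps(2) ex]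
  \<comment> \<open>A constant family with nonzero value: D kills it because all scalars act as
    zero, and for the same reason it cannot be in the image.\<close>
  have c: "(\<lambda>_. x) \<in> families ?n (carrier M)" using x(1) unfolding families_def by simp
  obtain w where w: "w \<in> families ?n (carrier M)" "\<And>bs. length bs = ?n \<Longrightarrow> x = kfact M ps w bs"
    using kM c kfact_zero[OF M(1) ps(1) c] unfolding kexact_def by blast
  have "x = \<zero>\<^bsub>M\<^esub>" using w(2)[of "replicate ?n False"] kfact_zero[OF M(1) ps(1) w(1), of "replicate ?n False"] by simp
  then show False using x(2) by simp
qed

section \<open>The residue field\<close>

context local_noetherian_cring
begin

text \<open>The residue field is taken as a quotient of the free module of rank 1, so that its
  elements have the type \<open>(nat \<Rightarrow> 'a) set\<close> of the modules in the
  theorem.\<close>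

definition residue_kernel :: "(nat \<Rightarrow> 'a) set" where
  "residue_kernel = {v \<in> carrier (free_module R {..<1}). v 0 \<in> \<mm>}"

definition residue_module :: "'a coset_module" where
  "residue_module = quot_module (free_module R {..<1}) residue_kernel"

abbreviation (input) "R1 \<equiv> free_module R {..<1::nat}"

lemma residue_kernel_submodule: "submodule residue_kernel R R1"
proof -
  interpret F: module R R1 by (rule free_module_module)
  show ?thesis
  proof (rule submoduleI'[OF F.module_axioms])
    show "\<zero>\<^bsub>R1\<^esub> \<in> residue_kernel"
      using F.M.zero_closed ideal_zero_closed[OF mm_ideal] unfolding residue_kernel_def free_module_simps by simp
    show "v \<oplus>\<^bsub>R1\<^esub> w \<in> residue_kernel" if "v \<in> residue_kernel" "w \<in> residue_kernel" for v w
      using that F.M.a_closed[of v w] ideal_add_closed[OF mm_ideal, of "v 0" "w 0"]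
      unfolding residue_kernel_def free_module_simps by simp
    show "a \<odot>\<^bsub>R1\<^esub> v \<in> residue_kernel" if "a \<in> carrier R" "v \<in> residue_kernel" for a v
      using that F.smult_closed[of a v] ideal.I_l_closed[OF mm_ideal, of "v 0" a]
      unfolding residue_kernel_def free_module_simps by simp
  qed (auto simp: residue_kernel_def)
qed

lemma residue_module_module: "module R residue_module"
  unfolding residue_module_def by (rule quot_module_module[OF free_module_module residue_kernel_submodule])

lemma residue_proj: "(\<lambda>v. residue_kernel +>\<^bsub>R1\<^esub> v) \<in> module_hom R R1 residue_module"
  unfolding residue_module_def by (rule quot_module_proj[OF free_module_module residue_kernel_submodule])

lemma residue_proj_surj: "(\<lambda>v. residue_kernel +>\<^bsub>R1\<^esub> v) ` carrier R1 = carrier residue_module"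
  unfolding residue_module_def by (auto simp: quot_module_carrier)

lemma residue_module_finitely_generated: "finitely_generated R residue_module"
  by (rule finitely_generated_image[OF free_module_finitely_generated residue_module_module residue_proj residue_proj_surj])

lemma residue_module_cyclic:
  shows "residue_kernel +>\<^bsub>R1\<^esub> basis_vec R 0 \<in> carrier residue_module"
    and "x \<in> carrier residue_module \<Longrightarrow>
      \<exists>a \<in> carrier R. x = a \<odot>\<^bsub>residue_module\<^esub> (residue_kernel +>\<^bsub>R1\<^esub> basis_vec R 0)"
proof -
  have b: "basis_vec R 0 \<in> carrier R1" by (rule basis_vec_carrier) simp
  show "residue_kernel +>\<^bsub>R1\<^esub> basis_vec R 0 \<in> carrier residue_module" by (rule module_homD(1)[OF residue_proj b])
  assume "x \<in> carrier residue_module"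
  then obtain v where v: "v \<in> carrier R1" "x = residue_kernel +>\<^bsub>R1\<^esub> v"
    unfolding residue_module_def quot_module_carrier by blast
  have vc: "v 0 \<in> carrier R" by (rule free_module_val[OF v(1)])
  have "v = v 0 \<odot>\<^bsub>R1\<^esub> basis_vec R 0"
    using v(1) vc unfolding free_module_carrier free_module_simps basis_vec_def by (intro ext) auto
  then have "x = residue_kernel +>\<^bsub>R1\<^esub> (v 0 \<odot>\<^bsub>R1\<^esub> basis_vec R 0)" using v(2) by simp
  also have "\<dots> = v 0 \<odot>\<^bsub>residue_module\<^esub> (residue_kernel +>\<^bsub>R1\<^esub> basis_vec R 0)"
    by (rule module_homD(3)[OF residue_proj vc b])
  finally show "\<exists>a \<in> carrier R. x = a \<odot>\<^bsub>residue_module\<^esub> (residue_kernel +>\<^bsub>R1\<^esub> basis_vec R 0)" using vc by blast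
qed

lemma annihilator_residue_module: "\<mm> \<subseteq> annihilator R residue_module"
proof
  fix a assume a: "a \<in> \<mm>"
  then have ac: "a \<in> carrier R" using ideal.Icarr[OF mm_ideal] by blast
  have "a \<odot>\<^bsub>residue_module\<^esub> x = \<zero>\<^bsub>residue_module\<^esub>" if x: "x \<in> carrier residue_module" for x
  proof -
    obtain v where v: "v \<in> carrier R1" "x = residue_kernel +>\<^bsub>R1\<^esub> v"
      using x unfolding residue_module_def quot_module_carrier by blast
    interpret F: module R R1 by (rule free_module_module)
    have av: "a \<odot>\<^bsub>R1\<^esub> v \<in> carrier R1" using ac v(1) by (rule F.smult_closed)
    have "a \<otimes> v 0 \<in> \<mm>" by (rule ideal.I_r_closed[OF mm_ideal a free_module_val[OF v(1)]])
    then have "a \<odot>\<^bsub>R1\<^esub> v \<in> residue_kernel" using av unfolding residue_kernel_def free_module_simps by simp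
    then have "residue_kernel +>\<^bsub>R1\<^esub> (a \<odot>\<^bsub>R1\<^esub> v) = \<zero>\<^bsub>residue_module\<^esub>"
      unfolding residue_module_def
      using quot_module_eq_zero_iff[OF free_module_module residue_kernel_submodule av] by simp
    then show ?thesis using module_homD(3)[OF residue_proj ac v(1)] v(2) by simp
  qed
  then show "a \<in> annihilator R residue_module" unfolding annihilator_def using ac by blast
qed

lemma residue_module_nonzero: "carrier residue_module \<noteq> {\<zero>\<^bsub>residue_module\<^esub>}"
proof
  assume z: "carrier residue_module = {\<zero>\<^bsub>residue_module\<^esub>}"
  have b: "basis_vec R 0 \<in> carrier R1" by (rule basis_vec_carrier) simp
  have "residue_kernel +>\<^bsub>R1\<^esub> basis_vec R 0 = \<zero>\<^bsub>residue_module\<^esub>" using residue_module_cyclic(1) z by blast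
  then have "basis_vec R 0 \<in> residue_kernel"
    unfolding residue_module_def
    using quot_module_eq_zero_iff[OF free_module_module residue_kernel_submodule b] by simp
  then show False using one_notin_mm unfolding residue_kernel_def basis_vec_def by simp
qed

text \<open>The resolution hidden in \<open>Ext_module\<close> is an arbitrary choice; the finite
  free one guarantees that the choice is a resolution, and comparison with it gives finite
  generation.\<close>

lemma Ext_residue_module:
  "module R (Ext_module R n residue_module (self_module R))"
  "finitely_generated R (Ext_module R n residue_module (self_module R))"
proof -
  let ?res = "\<lambda>(P :: nat \<Rightarrow> ('a, nat \<Rightarrow> 'a) module, d). \<exists>ep. projective_resolution R residue_module P d ep"
  obtain m d where Q: "projective_resolution R residue_module (\<lambda>i. free_module R {..<m i :: nat}) d
      (\<lambda>v. residue_kernel +>\<^bsub>R1\<^esub> v)"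
    using ex_free_resolution[OF residue_module_module residue_proj residue_proj_surj] by blast
  obtain P d' where Pd: "(SOME x. ?res x) = (P, d')" by (metis surj_pair)
  have "?res (\<lambda>i. free_module R {..<m i}, d)" using Q by blast
  then have "?res (SOME x. ?res x)" by (rule someI)
  then obtain ep where P: "projective_resolution R residue_module P d' ep" unfolding Pd by auto
  have E: "Ext_module R n residue_module (self_module R) = hom_cohomology R P d' (self_module R) n"
    unfolding Ext_module_def Pd by simp
  show "module R (Ext_module R n residue_module (self_module R))"
    unfolding E by (rule hom_cohomology_module[OF P self_module_module])
  show "finitely_generated R (Ext_module R n residue_module (self_module R))"
    unfolding E by (rule hom_cohomology_finitely_generated[OF P Q residue_module_module]) simp
qed

text \<open>The tensor product is treated by the same two facts as the residue field; they cover the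
  case that it is zero.\<close>

lemma residue_module_CM_with_tensor_Ext:
  assumes "c - 1 = d" "length zs = d" "reg_mod R {\<zero>} zs"
    and "\<And>ys. reg_mod R {\<zero>} ys \<Longrightarrow> length ys \<le> d"
  shows "CM_with_tensor_Ext R c residue_module"
proof -
  let ?E = "Ext_module R (c - 1) residue_module (self_module R)"
  let ?T = "tensor_module R residue_module ?E"
  have "finitely_generated R ?T"
    by (rule tensor_module_cyclic_finitely_generated[OF residue_module_module Ext_residue_module(1)
          residue_module_cyclic Ext_residue_module(2)])
  moreover have "\<mm> \<subseteq> annihilator R ?T"
    using annihilator_residue_module annihilator_tensor_module[OF residue_module_module Ext_residue_module(1)] by blast
  ultimately show ?thesis
    unfolding CM_with_tensor_Ext_def Let_def
    using residue_module_cohen_macaulay[OF residue_module_finitely_generated annihilator_residue_module]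
      residue_module_cohen_macaulay[of ?T] grade_residue_module[OF annihilator_residue_module assms(2-4)]
      grade_residue_module[of ?T, OF _ assms(2-4)] assms(1) by simp
qed

end

section \<open>From the given hypersurface to the theorem\<close>

lemma (in surj_cring_hom) hom_lincomb:
  "set ps \<subseteq> carrier S \<times> carrier S \<Longrightarrow> h (lincomb S ps) = lincomb R (map (map_prod h h) ps)"
proof (induction ps)
  case (Cons p ps)
  have "lincomb S qs \<in> carrier S" if "set qs \<subseteq> carrier S \<times> carrier S" for qs
    using that by (induction qs) auto
  then show ?case using Cons by (auto simp: h_simps)
qed (simp add: h_simps)

text \<open>\<open>regular_or_quadratic\<close> writes \<open>f\<close> with all factors in \<mm>.
  Their images kill the residue field, and the combination becomes zero in \<open>R\<close>.\<close>

lemma (in regular_hypersurface) residue_module_infinite_proj_dim: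
  assumes "\<not> regular_local_ring R"
  shows "\<not> finite_proj_dim R R.residue_module"
proof -
  obtain ps where ps: "set ps \<subseteq> \<mm> \<times> \<mm>" "f = lincomb S ps" using regular_or_quadratic assms by blast
  have psc: "set ps \<subseteq> carrier S \<times> carrier S" using ps(1) ideal_subset_carrier[OF S.mm_ideal] by auto
  let ?ps = "map (map_prod h h) ps"
  have "f \<in> ker" unfolding ker_eq by (rule S.cgenideal_self[OF f_carr])
  then have "lincomb R ?ps = \<zero>\<^bsub>R\<^esub>" using hom_lincomb[OF psc] ps(2) by simp
  moreover have "fst ` set ?ps \<union> snd ` set ?ps \<subseteq> annihilator R R.residue_module"
    using ps(1) R.annihilator_residue_module by force
  moreover have "kexact (self_module R) ?ps"
    by (rule kexact_self_of_hypersurface[OF S.is_cring R.is_cring hom surj ker_eq f_carr ps(2) psc f_cancel])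
  ultimately show ?thesis
    by (intro infinite_proj_dim_of_kexact R.residue_module_module R.residue_module_nonzero)
qed

text \<open>The Krull dimension is attained by a chain of \<open>card A\<close> steps; raised to end
  at the maximal ideal, it is the chain that \<open>regular_system\<close> asks for.\<close>

lemma regular_local_ring_regular_system:
  assumes "regular_local_ring S"
  shows "local_noetherian_cring S (max_ideal S)"
    and "\<exists>A. local_noetherian_cring.regular_system S (max_ideal S) {\<zero>\<^bsub>S\<^esub>} A"
proof -
  have S: "noetherian_ring S" "cring S" "\<exists>!m. maximalideal m S"
    using assms unfolding regular_local_ring_def local_ring_def by auto
  obtain A where A: "A \<subseteq> carrier S" "finite A" "enat (card A) = krull_dim S" "max_ideal S = Idl\<^bsub>S\<^esub> A"
    using assms unfolding regular_local_ring_def by blast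
  show loc: "local_noetherian_cring S (max_ideal S)"
    using theI'[OF S(3)] S(3) unfolding max_ideal_def[symmetric]
    by (intro local_noetherian_cring.intro noetherian_cring.intro S local_noetherian_cring_axioms.intro) auto
  interpret local_noetherian_cring S "max_ideal S" by (rule loc)
  obtain P Q where "pchain S (card A) P Q" using krull_dim_attained[OF A(3)[symmetric] mm_prime] by blast
  then obtain P' where P': "pchain S (card A) P' (max_ideal S)" using pchain_raise_mm by blast
  have "ideal P' S" using pchain_prime[OF P'] primeideal.axioms(1) by blast
  then have "{\<zero>\<^bsub>S\<^esub>} \<subseteq> P'" using ideal_zero_closed by auto
  moreover have "Idl\<^bsub>S\<^esub> ({\<zero>\<^bsub>S\<^esub>} \<union> A) = max_ideal S"
  proof
    show "Idl\<^bsub>S\<^esub> ({\<zero>\<^bsub>S\<^esub>} \<union> A) \<subseteq> max_ideal S"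
      using genideal_self[OF A(1)] ideal_zero_closed[OF mm_ideal] unfolding A(4)[symmetric]
      by (intro genideal_minimal mm_ideal) auto
    show "max_ideal S \<subseteq> Idl\<^bsub>S\<^esub> ({\<zero>\<^bsub>S\<^esub>} \<union> A)"
      unfolding A(4) using A(1) by (intro subset_Idl_subset) auto
  qed
  ultimately have "regular_system {\<zero>\<^bsub>S\<^esub>} A"
    unfolding regular_system_def using A(1,2) P' zeroideal by blast
  then show "\<exists>A. regular_system {\<zero>\<^bsub>S\<^esub>} A" by blast
qed

text \<open>\<open>h\<close> is the projection to the quotient by \<open>f\<close>, followed by an
  isomorphism to \<open>R\<close>.\<close>

lemma local_hypersurface_regular_hypersurface:
  assumes hyp: "local_hypersurface R S f" and dom: "domain R" and dim: "krull_dim R = enat d"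
  shows "\<exists>h A. regular_hypersurface S R h (max_ideal S) f A d"
proof -
  have S: "regular_local_ring S" and f: "f \<in> max_ideal S" "f \<noteq> \<zero>\<^bsub>S\<^esub>" and iso: "R \<simeq> (S Quot (PIdl\<^bsub>S\<^esub> f))"
    using hyp unfolding local_hypersurface_def by auto
  interpret S: local_noetherian_cring S "max_ideal S" by (rule regular_local_ring_regular_system(1)[OF S])
  interpret R: domain R by (rule dom)
  have fc: "f \<in> carrier S" using f(1) ideal.Icarr[OF S.mm_ideal] by blast
  let ?I = "PIdl\<^bsub>S\<^esub> f"
  interpret I: ideal ?I S by (rule S.cgenideal_ideal[OF fc])
  obtain g where g: "g \<in> ring_iso (S Quot ?I) R"
    using ring_iso_sym[OF R.ring_axioms iso] unfolding is_ring_iso_def by blast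
  have gh: "g \<in> ring_hom (S Quot ?I) R" and gb: "bij_betw g (carrier (S Quot ?I)) (carrier R)"
    using g unfolding ring_iso_def by auto
  let ?h = "\<lambda>s. g (?I +>\<^bsub>S\<^esub> s)"
  have hom: "?h \<in> ring_hom S R"
    using ring_hom_trans[OF I.rcos_ring_hom gh] by (simp add: comp_def)
  have carr: "carrier (S Quot ?I) = (\<lambda>s. ?I +>\<^bsub>S\<^esub> s) ` carrier S"
    unfolding FactRing_def A_RCOSETS_def' by auto
  have "?h ` carrier S = g ` carrier (S Quot ?I)" unfolding carr by (simp add: image_image)
  then have surj: "?h ` carrier S = carrier R" using gb unfolding bij_betw_def by simp
  have g0: "g \<zero>\<^bsub>S Quot ?I\<^esub> = \<zero>\<^bsub>R\<^esub>"
    by (rule ring_hom_zero[OF gh I.quotient_is_ring R.ring_axioms])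
  have z: "\<zero>\<^bsub>S Quot ?I\<^esub> = ?I" by (simp add: FactRing_def)
  have zc: "?I \<in> carrier (S Quot ?I)"
    using ring.ring_simprules(2)[OF I.quotient_is_ring] unfolding z .
  have "{s \<in> carrier S. ?h s = \<zero>\<^bsub>R\<^esub>} = ?I"
  proof (intro equalityI subsetI)
    fix s assume s: "s \<in> {s \<in> carrier S. ?h s = \<zero>\<^bsub>R\<^esub>}"
    then have "g (?I +>\<^bsub>S\<^esub> s) = g ?I" using g0 unfolding z by simp
    then have "?I +>\<^bsub>S\<^esub> s = ?I" using inj_onD[OF bij_betw_imp_inj_on[OF gb]] s zc carr by blast
    then show "s \<in> ?I" using I.rcos_const_imp_mem s by simp
  next
    fix s assume s: "s \<in> ?I"
    then show "s \<in> {s \<in> carrier S. ?h s = \<zero>\<^bsub>R\<^esub>}"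
      using S.a_rcos_zero[OF I.ideal_axioms s] g0 I.Icarr unfolding z by simp
  qed
  moreover obtain A where "S.regular_system {\<zero>\<^bsub>S\<^esub>} A" using regular_local_ring_regular_system(2)[OF S] by blast
  ultimately have "regular_hypersurface S R ?h (max_ideal S) f A d"
    by (intro regular_hypersurface.intro surj_cring_hom.intro surj_cring_hom_axioms.intro
        regular_hypersurface_axioms.intro S.is_cring R.is_cring hom surj S.local_noetherian_cring_axioms f dim)
  then show ?thesis by blast
qed

theorem mainTheorem11:
  fixes R :: "('a, 'r) ring_scheme" and S :: "('s, 't) ring_scheme" and f :: 's and c :: nat
  assumes "local_hypersurface R S f"
    and "domain R"
    and "enat c = krull_dim R + 1"
  shows "((\<forall>M :: 'a coset_module.
             finitely_generated R M \<and> CM_with_tensor_Ext R c M \<longrightarrow> finite_proj_dim R M)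
           \<longrightarrow> regular_local_ring R) \<and>
         (\<not> regular_local_ring R \<longrightarrow>
           (\<exists>M :: 'a coset_module.
             finitely_generated R M \<and> CM_with_tensor_Ext R c M \<and> \<not> finite_proj_dim R M))"
proof -
  \<comment> \<open>\<open>c\<close> is a natural number, so the dimension of \<open>R\<close> is
    finite.\<close>
  obtain d where d: "krull_dim R = enat d" using assms(3) by (cases "krull_dim R") auto
  then have c: "c - 1 = d" using assms(3) by (simp add: one_enat_def)
  obtain h A where "regular_hypersurface S R h (max_ideal S) f A d"
    using local_hypersurface_regular_hypersurface[OF assms(1,2) d] by blast
  then interpret regular_hypersurface S R h "max_ideal S" f A d .
  obtain zs where zs: "length zs = d" "reg_mod R {\<zero>\<^bsub>R\<^esub>} zs" using ex_reg_seq by blast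
  have "CM_with_tensor_Ext R c R.residue_module"
    by (rule R.residue_module_CM_with_tensor_Ext[OF c zs reg_seq_length])
  then have "\<exists>M :: 'a coset_module. finitely_generated R M \<and> CM_with_tensor_Ext R c M \<and> \<not> finite_proj_dim R M"
    if "\<not> regular_local_ring R"
    using R.residue_module_finitely_generated residue_module_infinite_proj_dim[OF that] by blast
  \<comment> \<open>The first claim is the contrapositive of the second.\<close>
  then show ?thesis by blast
qed

end
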